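(* Under the standing assumptions listed in the context, let $\nu$ be a Radon measure on $\mathbb{R}^{2n}$ which satisfies the following three properties: (i) $\operatorname{supp}\nu\subset p^{-1}(\{E_0\})$; (ii) for every $\sigma\in]0,1[$ there exists $R\ge0$ such that $\int q\,d\nu=0$ for all $q\in C_0^\infty(\mathbb{R}^{2n})$ supported in $\Gamma_-(R,-\sigma)$; (iii) for all $q\in C_0^\infty(\mathbb{R}^{2n})$: $\displaystyle\int_{\mathbb{R}^{2n}}(-H_p+2\operatorname{Im}E_1+2V_2)q\,d\nu=\int_{N_E\Gamma}c(z,\xi)\,q(z,\xi)\,d\tilde\sigma(z,\xi)$, where $c(z,\xi)=\pi(2\pi)^{d-n}|A(z)|^2|\xi|^{-1}|\hat S(\xi)|^2$. Then for all $q\in C_0^\infty(\mathbb{R}^{2n})$ we have $$\int_{\mathbb{R}^{2n}}q\,d\nu=\int_0^{+\infty}\int_{N_E\Gamma}c(z,\xi)\,q(\phi^t(z,\xi))\,e^{-2t\operatorname{Im}E_1-2\int_0^tV_2(\bar x(s,z,\xi))\,ds}\,d\tilde\sigma(z,\xi)\,dt .$$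
   Context: $n\ge1$. $V_1,V_2\in C^\infty(\mathbb{R}^n,\mathbb{R})$, $V_2\ge0$, and for some $\rho>0$: $|\partial^\alpha V_j(x)|\le C_\alpha\langle x\rangle^{-\rho-|\alpha|}$ for $j\in\{1,2\}$, $\alpha\in\mathbb{N}^n$, with $\langle x\rangle=(1+|x|^2)^{1/2}$. $p(x,\xi)=|\xi|^2+V_1(x)$, $H_p=2\xi\cdot\partial_x-\nabla V_1(x)\cdot\partial_\xi$, and $\phi^t(w)=(\bar x(t,w),\bar\xi(t,w))$ is the flow of $\partial_t\bar x=2\bar\xi$, $\partial_t\bar\xi=-\nabla V_1(\bar x)$, $\phi^0(w)=w$. $V_2$ is also viewed as a function on $\mathbb{R}^{2n}$, $V_2(x,\xi)=V_2(x)$. $\mathcal{O}=\{x:V_2(x)>0\}$. Energies $E_h\in\mathbb{C}$ ($h\in]0,1]$) satisfy $\operatorname{Im}E_h\ge0$, $E_h=E_0+hE_1+o(h)$ as $h\to0$ (so $\operatorname{Im}E_1\ge0$), where $E_0>0$ satisfies: for all $w$ with $p(w)=E_0$, either $\{\phi^t(w),t\in\mathbb{R}\}$ is unbounded in $\mathbb{R}^{2n}$ or $\bar x(t,w)\in\mathcal{O}$ for some $t\in\mathbb{R}$. $\Gamma_2\subset\mathbb{R}^n$ is a bounded submanifold of dimension $d\in\{0,\dots,n-1\}$; $A$ is smooth with compact support on $\Gamma_2$; $S\in\mathcal{S}(\mathbb{R}^n)$, $\hat S(\xi)=\int e^{-i\langle y,\xi\rangle}S(y)\,dy$. $\Gamma,\Gamma_1$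 are open in $\Gamma_2$ with $\operatorname{supp}A\subset\Gamma$, $\overline\Gamma\subset\Gamma_1$, $\overline{\Gamma_1}\subset\Gamma_2$. Assume $V_1(z)<E_0$ for all $z\in\overline\Gamma$. $N_E\Gamma=\{(z,\xi)\in\Gamma\times\mathbb{R}^n:\xi\perp T_z\Gamma,\ |\xi|=\sqrt{E_0-V_1(z)}\}$, a manifold of dimension $n-1$. For $(Z,\Xi)\in T_{(z,\xi)}N_E\Gamma$, $\Xi_\perp$ denotes the orthogonal projection of $\Xi$ on $(T_z\Gamma\oplus\mathbb{R}\xi)^\perp$; $N_E\Gamma$ carries the Riemannian metric $g_{(z,\xi)}((Z^1,\Xi^1),(Z^2,\Xi^2))=\langle Z^1,Z^2\rangle+\langle\Xi^1_\perp,\Xi^2_\perp\rangle$, and $\tilde\sigma$ is the Riemannian measure of $g$. Assume $\tilde\sigma(\{(z,\xi)\in N_E\Gamma:\exists t>0,\ \phi^t(z,\xi)\in N_E\Gamma\})=0$. $\Gamma_-(R,-\sigma)=\{(x,\xi)\in\mathbb{R}^{2n}:|x|\ge R,\ \langle x,\xi\rangle<-\sigma|x||\xi|\}$. *)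

theory Defs
  imports "HOL-Analysis.Analysis" "HOL-Library.Landau_Symbols"
begin

section \<open>Smooth functions\<close>

(* The sets S below are always open. *)
primrec higher_differentiable_on ::
  "nat \<Rightarrow> 'a::real_normed_vector set \<Rightarrow> ('a \<Rightarrow> 'b::real_normed_vector) \<Rightarrow> bool" where
  "higher_differentiable_on 0 S f \<longleftrightarrow> continuous_on S f"
| "higher_differentiable_on (Suc k) S f \<longleftrightarrow>
     (\<forall>x\<in>S. f differentiable (at x)) \<and>
     (\<forall>v. higher_differentiable_on k S (\<lambda>x. frechet_derivative f (at x) v))"

definition smooth_on :: "'a::real_normed_vector set \<Rightarrow> ('a \<Rightarrow> 'b::real_normed_vector) \<Rightarrow> bool" where
  "smooth_on S f \<longleftrightarrow> (\<forall>k. higher_differentiable_on k S f)"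

definition support_in :: "'a::topological_space set \<Rightarrow> ('a \<Rightarrow> 'b::zero) \<Rightarrow> 'a set" where
  "support_in M f = M \<inter> closure {x \<in> M. f x \<noteq> 0}"

definition test_function :: "('a::real_normed_vector \<Rightarrow> complex) \<Rightarrow> bool" where
  "test_function q \<longleftrightarrow> smooth_on UNIV q \<and> compact (support_in UNIV q)"

definition partial :: "'n::finite \<Rightarrow> (real^'n \<Rightarrow> 'b::real_normed_vector) \<Rightarrow> real^'n \<Rightarrow> 'b" where
  "partial i f x = frechet_derivative f (at x) (axis i 1)"

definition gradient :: "(real^'n \<Rightarrow> real) \<Rightarrow> real^'n \<Rightarrow> real^'n" where
  "gradient f x = (\<chi> i. partial i f x)"

(* A multi-index is a function 'n => nat. The index type carries no order, so an enumeration of the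
   coordinates is chosen; by symmetry of second derivatives it does not matter for smooth f. *)
definition multi_partial ::
  "('n::finite \<Rightarrow> nat) \<Rightarrow> (real^'n \<Rightarrow> 'b::real_normed_vector) \<Rightarrow> real^'n \<Rightarrow> 'b" where
  "multi_partial \<alpha> f =
     foldr (\<lambda>i. partial i ^^ \<alpha> i) (SOME is. distinct is \<and> set is = (UNIV :: 'n set)) f"

definition japanese_bracket :: "'a::real_normed_vector \<Rightarrow> real" where
  "japanese_bracket x = sqrt (1 + (norm x)\<^sup>2)"

definition symbol_decay :: "real \<Rightarrow> (real^'n \<Rightarrow> real) \<Rightarrow> bool" where
  "symbol_decay \<rho> V \<longleftrightarrow>
     (\<forall>\<alpha>. \<exists>C. \<forall>x. \<bar>multi_partial \<alpha> V x\<bar> \<le> C * japanese_bracket x powr (- \<rho> - real (\<Sum>i\<in>UNIV. \<alpha> i)))"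

definition schwartz :: "(real^'n \<Rightarrow> complex) \<Rightarrow> bool" where
  "schwartz S \<longleftrightarrow> smooth_on UNIV S \<and>
     (\<forall>\<alpha> \<beta>. \<exists>C. \<forall>x. norm ((\<Prod>i\<in>UNIV. (x $ i) ^ \<beta> i) *\<^sub>R multi_partial \<alpha> S x) \<le> C)"

definition fourier :: "('a::euclidean_space \<Rightarrow> complex) \<Rightarrow> 'a \<Rightarrow> complex" where
  "fourier S \<xi> = (LINT y|lborel. exp (- \<i> * of_real (y \<bullet> \<xi>)) * S y)"


section \<open>Embedded submanifolds and Riemannian measures\<close>

(* f straightens M inside U: it is a diffeomorphism of U onto V with inverse g, and it maps M \<inter> U
   onto the part of V in the d-dimensional coordinate subspace spanned by B. *)
definition slice_chart ::
  "nat \<Rightarrow> 'a::euclidean_space set \<Rightarrow> 'a set \<Rightarrow> 'a set \<Rightarrow> ('a \<Rightarrow> 'a) \<Rightarrow> ('a \<Rightarrow> 'a) \<Rightarrow> 'a set \<Rightarrow> bool" where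
  "slice_chart d M U V f g B \<longleftrightarrow>
     open U \<and> open V \<and> homeomorphism U V f g \<and> smooth_on U f \<and> smooth_on V g \<and>
     B \<subseteq> Basis \<and> card B = d \<and> f ` (M \<inter> U) = V \<inter> span B"

definition submanifold :: "nat \<Rightarrow> 'a::euclidean_space set \<Rightarrow> bool" where
  "submanifold d M \<longleftrightarrow> (\<forall>x\<in>M. \<exists>U V f g B. x \<in> U \<and> slice_chart d M U V f g B)"

definition tangent_space :: "'a::real_normed_vector set \<Rightarrow> 'a \<Rightarrow> 'a set" where
  "tangent_space M x = {v. \<exists>\<epsilon>>0. \<exists>\<gamma>. smooth_on {- \<epsilon><..<\<epsilon>} \<gamma> \<and> \<gamma> ` {- \<epsilon><..<\<epsilon>} \<subseteq> M \<and>
     \<gamma> (0::real) = x \<and> (\<gamma> has_vector_derivative v) (at 0)}"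

definition smooth_on_submanifold ::
  "'a::real_normed_vector set \<Rightarrow> ('a \<Rightarrow> 'b::real_normed_vector) \<Rightarrow> bool" where
  "smooth_on_submanifold M f \<longleftrightarrow>
     (\<forall>x\<in>M. \<exists>U F. open U \<and> x \<in> U \<and> smooth_on U F \<and> (\<forall>y\<in>M \<inter> U. f y = F y))"

(* Lebesgue measure of the coordinate subspace spanned by B \<subseteq> Basis, as a Borel measure on the
   whole space; cf. lborel_def. For B = {} it is the unit mass at 0. *)
definition coord_lebesgue :: "'a::euclidean_space set \<Rightarrow> 'a measure" where
  "coord_lebesgue B = distr (PiM B (\<lambda>_. lborel)) borel (\<lambda>x. \<Sum>b\<in>B. x b *\<^sub>R b)"

(* Determinant of a matrix indexed by a finite set; cf. det_def. *)
definition det_on :: "'i set \<Rightarrow> ('i \<Rightarrow> 'i \<Rightarrow> real) \<Rightarrow> real" where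
  "det_on B a = (\<Sum>p | p permutes B. of_int (sign p) * (\<Prod>i\<in>B. a i (p i)))"

(* mu is the Riemannian measure of the metric G on the d-dimensional submanifold M: in the local
   coordinates y in V \<inter> span B given by any slice chart it has density sqrt (det (G_ij)). As M is
   covered by countably many charts, this determines mu. *)
definition riemannian_measure ::
  "nat \<Rightarrow> 'a::euclidean_space set \<Rightarrow> ('a \<Rightarrow> 'a \<Rightarrow> 'a \<Rightarrow> real) \<Rightarrow> 'a measure \<Rightarrow> bool" where
  "riemannian_measure d M G \<mu> \<longleftrightarrow>
     sets \<mu> = sets (restrict_space borel M) \<and>
     (\<forall>U V f g B. slice_chart d M U V f g B \<longrightarrow>
        (\<forall>X\<in>sets \<mu>. X \<subseteq> U \<longrightarrow>
           emeasure \<mu> X =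
             (\<integral>\<^sup>+ y. indicator (V \<inter> span B) y * indicator X (g y) *
                 ennreal (sqrt (det_on B (\<lambda>b b'.
                   G (g y) (frechet_derivative g (at y) b) (frechet_derivative g (at y) b'))))
              \<partial>coord_lebesgue B)))"

definition orth_proj :: "'a::euclidean_space set \<Rightarrow> 'a \<Rightarrow> 'a" where
  "orth_proj W x = (THE y. y \<in> W \<and> (\<forall>w\<in>W. orthogonal (x - y) w))"


section \<open>Borel measures\<close>

definition radon_measure :: "'a::t2_space measure \<Rightarrow> bool" where
  "radon_measure \<nu> \<longleftrightarrow> sets \<nu> = sets borel \<and>
     (\<forall>K. compact K \<longrightarrow> emeasure \<nu> K < \<infinity>) \<and>
     (\<forall>X\<in>sets borel. emeasure \<nu> X = (SUP K\<in>{K. compact K \<and> K \<subseteq> X}. emeasure \<nu> K))"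

definition measure_support :: "'a::topological_space measure \<Rightarrow> 'a set" where
  "measure_support \<nu> = {x. \<forall>U. open U \<and> x \<in> U \<longrightarrow> emeasure \<nu> U > 0}"


section \<open>Classical Hamiltonian dynamics\<close>

type_synonym 'n phase = "(real^'n) \<times> (real^'n)"

definition hamiltonian :: "(real^'n \<Rightarrow> real) \<Rightarrow> 'n::finite phase \<Rightarrow> real" where
  "hamiltonian V = (\<lambda>(x, \<xi>). (norm \<xi>)\<^sup>2 + V x)"

definition hamilton_field ::
  "(real^'n \<Rightarrow> real) \<Rightarrow> ('n::finite phase \<Rightarrow> complex) \<Rightarrow> 'n phase \<Rightarrow> complex" where
  "hamilton_field V q = (\<lambda>(x, \<xi>).
     (\<Sum>i\<in>UNIV. (2 * \<xi> $ i) *\<^sub>R frechet_derivative q (at (x, \<xi>)) (axis i 1, 0)) -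
     (\<Sum>i\<in>UNIV. (gradient V x $ i) *\<^sub>R frechet_derivative q (at (x, \<xi>)) (0, axis i 1)))"

definition hamilton_flow ::
  "(real^'n \<Rightarrow> real) \<Rightarrow> (real \<Rightarrow> 'n::finite phase \<Rightarrow> 'n phase) \<Rightarrow> bool" where
  "hamilton_flow V \<phi> \<longleftrightarrow> (\<forall>w. \<phi> 0 w = w \<and>
     (\<forall>t. ((\<lambda>t. fst (\<phi> t w)) has_vector_derivative 2 *\<^sub>R snd (\<phi> t w)) (at t) \<and>
          ((\<lambda>t. snd (\<phi> t w)) has_vector_derivative - gradient V (fst (\<phi> t w))) (at t)))"

definition incoming_region :: "real \<Rightarrow> real \<Rightarrow> 'n::finite phase set" where
  "incoming_region R \<sigma> = {(x, \<xi>). norm x \<ge> R \<and> x \<bullet> \<xi> < \<sigma> * norm x * norm \<xi>}"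


section \<open>The normal energy shell over the source\<close>

definition normal_shell ::
  "(real^'n \<Rightarrow> real) \<Rightarrow> real \<Rightarrow> (real^'n) set \<Rightarrow> 'n::finite phase set" where
  "normal_shell V E \<Gamma> = {(z, \<xi>). z \<in> \<Gamma> \<and> (\<forall>v\<in>tangent_space \<Gamma> z. orthogonal \<xi> v) \<and>
     norm \<xi> = sqrt (E - V z)}"

definition shell_metric ::
  "(real^'n) set \<Rightarrow> 'n::finite phase \<Rightarrow> 'n phase \<Rightarrow> 'n phase \<Rightarrow> real" where
  "shell_metric \<Gamma> = (\<lambda>(z, \<xi>) (Z1, \<Xi>1) (Z2, \<Xi>2).
     let W = orthogonal_comp {v + r *\<^sub>R \<xi> |v r. v \<in> tangent_space \<Gamma> z}
     in Z1 \<bullet> Z2 + orth_proj W \<Xi>1 \<bullet> orth_proj W \<Xi>2)"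

definition source_density ::
  "nat \<Rightarrow> (real^'n \<Rightarrow> complex) \<Rightarrow> (real^'n \<Rightarrow> complex) \<Rightarrow> 'n::finite phase \<Rightarrow> real" where
  "source_density d A S = (\<lambda>(z, \<xi>).
     pi * (2 * pi) powi (int d - int CARD('n)) * (cmod (A z))\<^sup>2 * inverse (norm \<xi>) *
     (cmod (fourier S \<xi>))\<^sup>2)"

end

(* Let q_t(w) = q(phi^t w) exp(-2 t Im E_1 - 2 int_0^t V_2). Since q_t solves
   d/dt q_t = (H_p - 2 Im E_1 - 2 V_2) q_t, testing (iii) with the time integral of q_t over [0,T]
   gives  int q dnu - int q_T dnu = int_0^T int c q_t dsigma dt.
   The flow is only shown to be locally Lipschitz in its initial value, so (iii) is first extended
   from smooth to Lipschitz functions: mollifying g with radius eps, the commutator of H_p with the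
   mollifier is O(eps), because H_p is Lipschitz.
   To let T tend to infinity: |x|^2 is convex along the flow far out, so a point whose trajectory
   reaches supp q lies in a fixed compact set or in the incoming region, where nu vanishes by (ii).
   On the compact set q_T tends to 0 pointwise: a forward trajectory escapes, or else it has an
   omega-limit point, whose bounded orbit meets V_2 > 0, so that the damping integral diverges.
   Finiteness of c dsigma comes from explicit slice charts of the normal energy shell. *)
theory Submission
  imports Defs
begin

section \<open>Smooth functions and bump functions\<close>

text \<open>The flow is given only through its equations; Gronwall makes it Lipschitz in the initial
  point at once, whereas differentiability there would call for a separate theory. What survives of
  smoothness is that the time integral \<open>g\<close> of \<open>evolve q t\<close> over [0,T] is
  differentiable along the flow: moving the initial point along its orbit merely shifts the time
  window and multiplies by an exponential. Both damping terms enter through the single rate W = 2 Im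
  E_1 + 2 V_2, which is nonnegative because the expansion of E_h forces Im E_1 \<ge> 0. The aperture
  1/3, at which (ii) is applied, is small enough that far out |x|^2 never falls below half its
  initial value. As \<open>q\<close> is complex, absolute convergence of the time integral comes
  from a nonnegative bump dominating |q|, to which monotone convergence applies. The measure on the
  shell is known only through its values in slice charts, so any statement about its size requires a
  chart around each point of a compact set.\<close>

lemma higher_diff_cong:
  assumes "open S" "\<And>x. x \<in> S \<Longrightarrow> f x = g x" "higher_differentiable_on k S f"
  shows "higher_differentiable_on k S g"
  using assms
proof (induction k arbitrary: f g)
  case 0
  then show ?case by (auto cong: continuous_on_cong)
next
  case (Suc k)
  have der: "(g has_derivative D) (at x)" if "(f has_derivative D) (at x)" "x \<in> S" for x D
    using has_derivative_transform_within_open[OF that(1) Suc.prems(1) that(2)] Suc.prems(2) by auto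
  have fr: "frechet_derivative f (at x) = frechet_derivative g (at x)" if "x \<in> S" for x
  proof -
    have "(f has_derivative frechet_derivative f (at x)) (at x)"
      using Suc.prems(3) that by (auto simp: frechet_derivative_works)
    then show ?thesis using der that by (metis frechet_derivative_at)
  qed
  show ?case
    unfolding higher_differentiable_on.simps
  proof (intro conjI ballI allI)
    fix x assume "x \<in> S"
    then show "g differentiable at x" using Suc.prems(3) der
      unfolding higher_differentiable_on.simps differentiable_def by blast
  next
    fix v
    show "higher_differentiable_on k S (\<lambda>x. frechet_derivative g (at x) v)"
      by (rule Suc.IH[OF Suc.prems(1), of "\<lambda>x. frechet_derivative f (at x) v"])
        (use Suc.prems fr in auto)
  qed
qed

text \<open>The recursion speaks of \<open>frechet_derivative\<close>; here an explicit derivative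
  \<open>D\<close> takes its place, which is how the closure properties below are proved.\<close>

lemma higher_diff_SucI:
  assumes "open S" "\<And>x. x \<in> S \<Longrightarrow> (f has_derivative D x) (at x)"
    "\<And>v. higher_differentiable_on k S (\<lambda>x. D x v)"
  shows "higher_differentiable_on (Suc k) S f"
  unfolding higher_differentiable_on.simps
proof (intro conjI ballI allI)
  fix x assume "x \<in> S"
  then show "f differentiable at x" using assms(2) unfolding differentiable_def by blast
next
  fix v
  show "higher_differentiable_on k S (\<lambda>x. frechet_derivative f (at x) v)"
    by (rule higher_diff_cong[OF assms(1) _ assms(3)]) (simp add: frechet_derivative_at[OF assms(2), symmetric])
qed

lemma higher_diff_SucD:
  assumes "higher_differentiable_on (Suc k) S f"
  shows "x \<in> S \<Longrightarrow> (f has_derivative frechet_derivative f (at x)) (at x)"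
    "higher_differentiable_on k S (\<lambda>x. frechet_derivative f (at x) v)"
  using assms by (auto simp: frechet_derivative_works)

lemma higher_diff_Suc_imp:
  assumes "higher_differentiable_on (Suc k) S f"
  shows "higher_differentiable_on k S f"
  using assms
proof (induction k arbitrary: f)
  case 0
  then have "f differentiable at x" if "x \<in> S" for x using that by simp
  then show ?case
    by (simp add: continuous_at_imp_continuous_on differentiable_imp_continuous_within)
next
  case (Suc k)
  then show ?case by (metis higher_differentiable_on.simps(2))
qed

lemma higher_diff_subset:
  assumes "higher_differentiable_on k S f" "T \<subseteq> S"
  shows "higher_differentiable_on k T f"
  using assms by (induction k arbitrary: f) (auto intro: continuous_on_subset)

lemma higher_diff_const: "open S \<Longrightarrow> higher_differentiable_on k S (\<lambda>x. c)"
proof (induction k arbitrary: c)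
  case (Suc k)
  show ?case by (rule higher_diff_SucI[OF Suc.prems, where D="\<lambda>x v. 0"]) (auto intro: Suc)
qed auto

lemma higher_diff_bounded_linear_comp:
  assumes "open S" "bounded_linear L" "higher_differentiable_on k S f"
  shows "higher_differentiable_on k S (\<lambda>x. L (f x))"
  using assms(3)
proof (induction k arbitrary: f)
  case 0
  then show ?case using bounded_linear.continuous_on[OF assms(2)] by auto
next
  case (Suc k)
  show ?case
    by (rule higher_diff_SucI[OF assms(1), where D="\<lambda>x v. L (frechet_derivative f (at x) v)"])
      (auto intro!: bounded_linear.has_derivative[OF assms(2)] Suc.IH higher_diff_SucD[OF Suc.prems])
qed

lemma higher_diff_linear:
  assumes "open S" "bounded_linear L"
  shows "higher_differentiable_on k S L"
proof (cases k)
  case 0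
  then show ?thesis using assms linear_continuous_on by auto
next
  case (Suc k)
  show ?thesis unfolding Suc
    by (rule higher_diff_SucI[OF assms(1), where D="\<lambda>x v. L v"])
     (use assms bounded_linear_imp_has_derivative higher_diff_const in auto)
qed

lemma higher_diff_add:
  assumes "open S" "higher_differentiable_on k S f" "higher_differentiable_on k S g"
  shows "higher_differentiable_on k S (\<lambda>x. f x + g x)"
  using assms(2,3)
proof (induction k arbitrary: f g)
  case 0
  then show ?case by (auto intro: continuous_intros)
next
  case (Suc k)
  show ?case
    by (rule higher_diff_SucI[OF assms(1), where D="\<lambda>x v. frechet_derivative f (at x) v + frechet_derivative g (at x) v"])
     (use higher_diff_SucD[OF Suc.prems(1)] higher_diff_SucD[OF Suc.prems(2)] Suc.IH in \<open>auto intro: has_derivative_add\<close>)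
qed

lemma higher_diff_sum:
  assumes "open S" "\<And>i. i \<in> I \<Longrightarrow> higher_differentiable_on k S (f i)"
  shows "higher_differentiable_on k S (\<lambda>x. \<Sum>i\<in>I. f i x)"
  using assms(2)
  by (induction I rule: infinite_finite_induct) (auto intro: higher_diff_const[OF assms(1)] higher_diff_add[OF assms(1)])

text \<open>In the Leibniz rule one factor stays undifferentiated and must be known to order
  \<open>k\<close>, hence \<open>higher_diff_Suc_imp\<close>. One statement covers products, scalar
  multiples and inner products.\<close>

lemma higher_diff_bilinear:
  assumes "open S" "bounded_bilinear B" "higher_differentiable_on k S f" "higher_differentiable_on k S g"
  shows "higher_differentiable_on k S (\<lambda>x. B (f x) (g x))"
  using assms(3,4)
proof (induction k arbitrary: f g)
  case 0
  then show ?case using bounded_bilinear.continuous_on[OF assms(2)] by auto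
next
  case (Suc k)
  show ?case
    by (rule higher_diff_SucI[OF assms(1), where D="\<lambda>x v. B (f x) (frechet_derivative g (at x) v) + B (frechet_derivative f (at x) v) (g x)"])
     (use higher_diff_SucD[OF Suc.prems(1)] higher_diff_SucD[OF Suc.prems(2)] higher_diff_Suc_imp[OF Suc.prems(1)] higher_diff_Suc_imp[OF Suc.prems(2)] Suc.IH
        in \<open>auto intro!: bounded_bilinear.FDERIV[OF assms(2)] higher_diff_add[OF assms(1)]\<close>)
qed

lemma frechet_derivative_euclidean:
  fixes f :: "'a::euclidean_space \<Rightarrow> 'b::real_normed_vector"
  assumes "f differentiable (at x)"
  shows "frechet_derivative f (at x) v = (\<Sum>b\<in>Basis. (v \<bullet> b) *\<^sub>R frechet_derivative f (at x) b)"
proof -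
  have "linear (frechet_derivative f (at x))"
    using assms by (rule linear_frechet_derivative)
  then show ?thesis
    by (subst euclidean_representation[symmetric, of v]) (simp only: linear_sum linear_scale)
qed

text \<open>The recursion differentiates in a fixed direction, but in the chain rule the direction
  \<open>frechet_derivative g (at x) v\<close> moves with \<open>x\<close>. Expanding it in the
  basis of the middle space gives a sum of products of a coordinate of the derivative of
  \<open>g\<close> and a derivative of \<open>f\<close> in a fixed direction, to which induction
  applies.\<close>

lemma higher_diff_compose:
  fixes f :: "'b::euclidean_space \<Rightarrow> 'c::real_normed_vector" and g :: "'a::real_normed_vector \<Rightarrow> 'b"
  assumes "open S" "g ` S \<subseteq> T" "higher_differentiable_on k T f" "higher_differentiable_on k S g"
  shows "higher_differentiable_on k S (\<lambda>x. f (g x))"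
  using assms(3,4)
proof (induction k arbitrary: f)
  case 0
  then show ?case using assms(2) continuous_on_compose2 by auto
next
  case (Suc k)
  show ?case
  proof (rule higher_diff_SucI[OF assms(1), where D="\<lambda>x v. \<Sum>b\<in>Basis. (frechet_derivative g (at x) v \<bullet> b) *\<^sub>R frechet_derivative f (at (g x)) b"])
    fix x assume x: "x \<in> S"
    then have fd: "f differentiable (at (g x))" using Suc.prems(1) assms(2) by auto
    have "((\<lambda>x. f (g x)) has_derivative (\<lambda>v. frechet_derivative f (at (g x)) (frechet_derivative g (at x) v))) (at x)"
      using has_derivative_compose[OF higher_diff_SucD(1)[OF Suc.prems(2) x]] higher_diff_SucD(1)[OF Suc.prems(1), of "g x"] assms(2) x
      by auto
    then show "((\<lambda>x. f (g x)) has_derivative (\<lambda>v. \<Sum>b\<in>Basis. (frechet_derivative g (at x) v \<bullet> b) *\<^sub>R frechet_derivative f (at (g x)) b)) (at x)"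
      by (subst (asm) frechet_derivative_euclidean[OF fd])
  next
    fix v
    show "higher_differentiable_on k S (\<lambda>x. \<Sum>b\<in>Basis. (frechet_derivative g (at x) v \<bullet> b) *\<^sub>R frechet_derivative f (at (g x)) b)"
      by (intro higher_diff_sum[OF assms(1)] higher_diff_bilinear[OF assms(1) bounded_bilinear_scaleR]
          higher_diff_bounded_linear_comp[OF assms(1) bounded_linear_inner_left] Suc.IH
          higher_diff_SucD(2)[OF Suc.prems(1)] higher_diff_SucD(2)[OF Suc.prems(2)] higher_diff_Suc_imp[OF Suc.prems(2)])
  qed
qed

lemma smooth_on_cong:
  "open S \<Longrightarrow> smooth_on S f \<Longrightarrow> (\<And>x. x \<in> S \<Longrightarrow> f x = g x) \<Longrightarrow> smooth_on S g"
  unfolding smooth_on_def using higher_diff_cong by blast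

lemma smooth_on_subset: "smooth_on S f \<Longrightarrow> T \<subseteq> S \<Longrightarrow> smooth_on T f"
  unfolding smooth_on_def using higher_diff_subset by blast

lemma smooth_on_const: "open S \<Longrightarrow> smooth_on S (\<lambda>x. c)"
  unfolding smooth_on_def using higher_diff_const by blast

lemma smooth_on_linear: "open S \<Longrightarrow> bounded_linear L \<Longrightarrow> smooth_on S L"
  unfolding smooth_on_def using higher_diff_linear by blast

lemma smooth_on_linear_comp:
  "open S \<Longrightarrow> bounded_linear L \<Longrightarrow> smooth_on S f \<Longrightarrow> smooth_on S (\<lambda>x. L (f x))"
  unfolding smooth_on_def using higher_diff_bounded_linear_comp by blast

lemma smooth_on_add:
  "open S \<Longrightarrow> smooth_on S f \<Longrightarrow> smooth_on S g \<Longrightarrow> smooth_on S (\<lambda>x. f x + g x)"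
  unfolding smooth_on_def using higher_diff_add by blast

lemma smooth_on_sum:
  "open S \<Longrightarrow> (\<And>i. i \<in> I \<Longrightarrow> smooth_on S (f i)) \<Longrightarrow> smooth_on S (\<lambda>x. \<Sum>i\<in>I. f i x)"
  unfolding smooth_on_def by (intro allI higher_diff_sum) auto

lemma smooth_on_bilinear:
  assumes "open S" "bounded_bilinear B" "smooth_on S f" "smooth_on S g"
  shows "smooth_on S (\<lambda>x. B (f x) (g x))"
  unfolding smooth_on_def
  by (rule allI, rule higher_diff_bilinear[OF assms(1,2) assms(3,4)[unfolded smooth_on_def, THEN spec]])

lemma smooth_on_compose:
  fixes f :: "'b::euclidean_space \<Rightarrow> 'c::real_normed_vector"
  assumes "open S" "g ` S \<subseteq> T" "smooth_on T f" "smooth_on S g"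
  shows "smooth_on S (\<lambda>x. f (g x))"
  unfolding smooth_on_def
  by (rule allI, rule higher_diff_compose[OF assms(1,2) assms(3,4)[unfolded smooth_on_def, THEN spec]])

lemma smooth_on_continuous: "smooth_on S f \<Longrightarrow> continuous_on S f"
  unfolding smooth_on_def by (drule spec[of _ 0]) simp

lemma smooth_on_has_derivative:
  "smooth_on S f \<Longrightarrow> x \<in> S \<Longrightarrow> (f has_derivative frechet_derivative f (at x)) (at x)"
  unfolding smooth_on_def by (drule spec[of _ "Suc 0"]) (rule higher_diff_SucD(1))

lemma smooth_on_frechet: "smooth_on S f \<Longrightarrow> smooth_on S (\<lambda>x. frechet_derivative f (at x) v)"
  unfolding smooth_on_def by (metis higher_diff_SucD(2))

lemma smooth_on_Pair:
  assumes "open S" "smooth_on S f" "smooth_on S g"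
  shows "smooth_on S (\<lambda>x. (f x, g x))"
proof -
  have "smooth_on S (\<lambda>x. (f x, 0) + (0, g x))"
    using assms by (intro smooth_on_add smooth_on_linear_comp[OF _ bounded_linear_Pair[OF bounded_linear_ident bounded_linear_zero]]
       smooth_on_linear_comp[OF _ bounded_linear_Pair[OF bounded_linear_zero bounded_linear_ident]])
  then show ?thesis by simp
qed

text \<open>Differentiation never leaves the family \<open>P\<close>, so one derivative formula for
  its members carries the induction through all orders.\<close>

lemma smooth_on_real_family:
  fixes P :: "(real \<Rightarrow> real) set"
  assumes "open S"
    and closed: "\<And>f. f \<in> P \<Longrightarrow> \<exists>f'\<in>P. \<forall>x\<in>S. (f has_real_derivative f' x) (at x)"
    and "f \<in> P"
  shows "smooth_on S f"
  unfolding smooth_on_def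
proof
  fix k show "higher_differentiable_on k S f" using \<open>f \<in> P\<close>
  proof (induction k arbitrary: f)
    case 0
    with closed show ?case
      by (metis DERIV_isCont continuous_at_imp_continuous_on higher_differentiable_on.simps(1))
  next
    case (Suc k)
    obtain f' where f': "f' \<in> P" "\<And>x. x \<in> S \<Longrightarrow> (f has_real_derivative f' x) (at x)"
      using closed[OF Suc.prems] by blast
    show ?case
      by (rule higher_diff_SucI[OF assms(1), where D="\<lambda>x v. f' x * v"])
        (use f' Suc.IH[OF f'(1)] in \<open>auto simp: has_field_derivative_def intro: higher_diff_bounded_linear_comp[OF assms(1) bounded_linear_mult_left]\<close>)
  qed
qed

text \<open>The factor \<open>c\<close> is what makes the family of powers closed under
  differentiation.\<close>

lemma smooth_on_powr: "smooth_on {0<..} (\<lambda>x::real. x powr r)"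
proof (rule smooth_on_real_family[where P="{\<lambda>x. c * x powr r |c r. True}"])
  fix f :: "real \<Rightarrow> real" assume "f \<in> {\<lambda>x. c * x powr r |c r. True}"
  then obtain c r where f: "f = (\<lambda>x. c * x powr r)" by auto
  have "(f has_real_derivative (c * r) * x powr (r - 1)) (at x)" if "x > 0" for x
    unfolding f using that by (auto intro!: derivative_eq_intros)
  then show "\<exists>f'\<in>{\<lambda>x. c * x powr r |c r. True}. \<forall>x\<in>{0<..}. (f has_real_derivative f' x) (at x)"
    by (intro bexI[of _ "\<lambda>x. (c * r) * x powr (r - 1)"]) auto
qed (force intro: exI[of _ 1])+

section \<open>The flat exponential and bump functions\<close>

definition flat_exp :: "real \<Rightarrow> real" where
  "flat_exp x = (if x > 0 then exp (- 1 / x) else 0)"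

text \<open>With y = 1/x this is the decay of a polynomial against exp(-y). It makes all derivatives
  of \<open>flat_exp\<close> match the zero function at 0.\<close>

lemma tendsto_poly_exp_flat:
  "((\<lambda>x::real. poly p (1 / x) * exp (- 1 / x)) \<longlongrightarrow> 0) (at_right 0)"
proof -
  have "((\<lambda>y::real. poly p y * exp (- y)) \<longlongrightarrow> 0) at_top"
  proof (induction p)
    case (pCons a p)
    have "((\<lambda>y::real. poly (pCons a p) y * exp (- y)) \<longlongrightarrow> 0) at_top"
    proof -
      have "((\<lambda>y::real. \<Sum>i\<le>degree (pCons a p). coeff (pCons a p) i * (y ^ i / exp y)) \<longlongrightarrow> (\<Sum>i\<le>degree (pCons a p). coeff (pCons a p) i * 0)) at_top"
        by (intro tendsto_intros tendsto_power_div_exp_0)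
      then show ?thesis unfolding poly_altdef sum_distrib_right
        by (simp add: exp_minus field_simps)
    qed
    then show ?case .
  qed auto
  then have "((\<lambda>x::real. poly p (inverse x) * exp (- inverse x)) \<longlongrightarrow> 0) (at_right 0)"
    by (rule filterlim_compose[OF _ filterlim_inverse_at_top_right])
  then show ?thesis by (simp add: divide_inverse)
qed

lemma smooth_on_flat_exp: "smooth_on UNIV flat_exp"
proof -
  \<comment> \<open>Every derivative of \<open>flat_exp\<close> is a polynomial in y = 1/x times
    exp(-y); differentiating \<open>h p\<close> replaces p by y^2 (p - p').\<close>
  define h where "h p = (\<lambda>x::real. if x > 0 then poly p (1 / x) * exp (- 1 / x) else 0)" for p
  have der: "(h p has_real_derivative h (monom 1 2 * (p - pderiv p)) x) (at x)" for p x
  proof -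
    consider "x > 0" | "x < 0" | "x = 0" by linarith
    then show ?thesis
    proof cases
      case 1
      have "((\<lambda>x. poly p (1 / x) * exp (- 1 / x)) has_real_derivative h (monom 1 2 * (p - pderiv p)) x) (at x)"
        using 1 unfolding h_def
        by (auto intro!: derivative_eq_intros simp: poly_monom field_simps power2_eq_square)
      then show ?thesis
        by (rule has_field_derivative_transform_within_open[of _ _ _ "{0<..}"]) (use 1 in \<open>auto simp: h_def\<close>)
    next
      case 2
      have "((\<lambda>x. 0) has_real_derivative h (monom 1 2 * (p - pderiv p)) x) (at x)"
        using 2 by (auto simp: h_def)
      then show ?thesis
        by (rule has_field_derivative_transform_within_open[of _ _ _ "{..<0}"]) (use 2 in \<open>auto simp: h_def\<close>)
    next
      case 3
      \<comment> \<open>For x > 0 the difference quotient at 0 is of the same form, with polynomial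
        y p, written \<open>pCons 0 p\<close>.\<close>
      have r: "((\<lambda>x. h p x / x) \<longlongrightarrow> 0) (at_right 0)"
        by (rule Lim_transform_eventually[OF tendsto_poly_exp_flat[of "pCons 0 p"]])
          (auto simp: h_def eventually_at_right_less eventually_at_filter)
      have l: "((\<lambda>x. h p x / x) \<longlongrightarrow> 0) (at_left 0)"
        by (rule Lim_transform_eventually[OF tendsto_const])
          (auto simp: h_def eventually_at_filter)
      have "((\<lambda>x. h p x / x) \<longlongrightarrow> 0) (at 0)"
        using l r by (simp add: filterlim_split_at)
      then show ?thesis using 3 by (simp add: has_field_derivative_iff h_def)
    qed
  qed
  have "smooth_on UNIV (h 1)"
    by (rule smooth_on_real_family[where P="range h"]) (use der in auto)
  moreover have "h 1 = flat_exp" unfolding h_def flat_exp_def by auto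
  ultimately show ?thesis by simp
qed

lemma flat_exp_nonneg: "flat_exp x \<ge> 0" by (simp add: flat_exp_def)

lemma flat_exp_pos_iff: "flat_exp x > 0 \<longleftrightarrow> x > 0" by (simp add: flat_exp_def)

lemma flat_exp_mono: "x \<le> y \<Longrightarrow> flat_exp x \<le> flat_exp y"
  by (auto simp: flat_exp_def field_simps)

text \<open>The squared norm keeps the argument polynomial, hence smooth also at the centre; for r
  \<ge> 0 it is positive exactly on the open ball.\<close>

definition bump :: "'a::euclidean_space \<Rightarrow> real \<Rightarrow> 'a \<Rightarrow> real" where
  "bump a r w = flat_exp (r\<^sup>2 - (norm (w - a))\<^sup>2)"

lemma smooth_on_bump: "smooth_on UNIV (bump a r)"
proof -
  have l: "smooth_on UNIV (\<lambda>w. w - a)"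
    using smooth_on_add[OF open_UNIV smooth_on_linear[OF open_UNIV bounded_linear_ident] smooth_on_const[OF open_UNIV, of "- a"]]
    by simp
  have "smooth_on UNIV (\<lambda>w. r\<^sup>2 + (- 1) * ((w - a) \<bullet> (w - a)))"
    by (intro smooth_on_add smooth_on_const smooth_on_bilinear[OF _ bounded_bilinear_mult]
      smooth_on_bilinear[OF _ bounded_bilinear_inner] l open_UNIV)
  from smooth_on_compose[OF open_UNIV _ smooth_on_flat_exp this]
  have "smooth_on UNIV (\<lambda>w. flat_exp (r\<^sup>2 + (- 1) * ((w - a) \<bullet> (w - a))))" by simp
  then show ?thesis by (simp add: bump_def[abs_def] power2_norm_eq_inner)
qed

lemma bump_nonneg: "bump a r w \<ge> 0" by (simp add: bump_def flat_exp_nonneg)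

lemma bump_pos_iff: "r \<ge> 0 \<Longrightarrow> bump a r w > 0 \<longleftrightarrow> dist a w < r"
  unfolding bump_def flat_exp_pos_iff dist_norm norm_minus_commute[of w a]
  using power_strict_mono[of "norm (a - w)" r 2] power2_less_imp_less[of "norm (a - w)" r] by auto

lemma bump_eq_0: "r \<ge> 0 \<Longrightarrow> dist a w \<ge> r \<Longrightarrow> bump a r w = 0"
  using bump_pos_iff[of r a w] bump_nonneg[of a r w] by linarith

lemma continuous_on_bump: "continuous_on S (bump a r)"
  using smooth_on_continuous[OF smooth_on_bump] continuous_on_subset by blast

lemma test_functionI:
  fixes q :: "'a::euclidean_space \<Rightarrow> complex"
  assumes "smooth_on UNIV q" "\<And>w. dist a w > r \<Longrightarrow> q w = 0"
  shows "test_function q" "support_in UNIV q \<subseteq> cball a r"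
proof -
  have "{x \<in> UNIV. q x \<noteq> 0} \<subseteq> cball a r" using assms(2) by force
  then show "support_in UNIV q \<subseteq> cball a r" unfolding support_in_def
    by (simp add: closure_minimal)
  then have "compact (support_in UNIV q)"
    using compact_Int_closed[OF compact_cball[of a r] closed_closure[of "{x \<in> UNIV. q x \<noteq> 0}"]]
      \<open>support_in UNIV q \<subseteq> cball a r\<close>
    by (simp add: support_in_def inf.absorb2)
  then show "test_function q"
    unfolding test_function_def using assms(1) by blast
qed

lemma test_function_bump:
  fixes a :: "'a::euclidean_space"
  assumes "r \<ge> 0"
  shows "test_function (\<lambda>w. complex_of_real (c * bump a r w))"
    "support_in UNIV (\<lambda>w. complex_of_real (c * bump a r w)) \<subseteq> cball a r"
proof -
  have "smooth_on UNIV (\<lambda>w. complex_of_real (c * bump a r w))"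
    by (intro smooth_on_linear_comp[OF _ bounded_linear_of_real] smooth_on_linear_comp[OF _ bounded_linear_mult_right] smooth_on_bump) auto
  note * = test_functionI[OF this, where a=a and r=r]
  have "complex_of_real (c * bump a r w) = 0" if "dist a w > r" for w
    using bump_eq_0[OF assms, of a w] that by simp
  from *[OF this] show "test_function (\<lambda>w. complex_of_real (c * bump a r w))"
    "support_in UNIV (\<lambda>w. complex_of_real (c * bump a r w)) \<subseteq> cball a r" by auto
qed


section \<open>The Hamiltonian flow\<close>

lemma lipschitz_imp_continuous_on:
  assumes "\<And>x y. x \<in> S \<Longrightarrow> y \<in> S \<Longrightarrow> norm (f x - f y) \<le> L * norm (x - y)"
  shows "continuous_on S f"
proof -
  have "(\<bar>L\<bar>)-lipschitz_on S f"
  proof (rule lipschitz_onI)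
    fix x y assume "x \<in> S" "y \<in> S"
    then have "norm (f x - f y) \<le> L * norm (x - y)" by (rule assms)
    also have "\<dots> \<le> \<bar>L\<bar> * norm (x - y)" by (intro mult_right_mono) auto
    finally show "dist (f x) (f y) \<le> \<bar>L\<bar> * dist x y" by (simp add: dist_norm)
  qed simp
  then show ?thesis by (rule lipschitz_on_continuous_on)
qed

lemma continuous_on_compact_bounded:
  fixes f :: "'a::topological_space \<Rightarrow> 'b::real_normed_vector"
  assumes "compact K" "continuous_on K f"
  obtains B where "B \<ge> 0" "\<And>x. x \<in> K \<Longrightarrow> norm (f x) \<le> B"
proof -
  from compact_imp_bounded[OF compact_continuous_image[OF assms(2,1)]]
  obtain B where B: "\<forall>y\<in>f ` K. norm y \<le> B"
    unfolding bounded_iff by (elim exE)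
  have "norm (f x) \<le> max B 0" if "x \<in> K" for x
    using B[THEN bspec, OF imageI[OF that]] by linarith
  then show thesis by (intro that[of "max B 0"]) auto
qed

text \<open>\<open>smooth_on\<close> gives local bounds only for derivatives in fixed directions;
  the finitely many basis directions control the whole derivative.\<close>

lemma norm_derivative_le_sum:
  fixes f :: "'a::euclidean_space \<Rightarrow> 'b::real_normed_vector"
  assumes "smooth_on UNIV f" "\<And>b. b \<in> Basis \<Longrightarrow> norm (frechet_derivative f (at x) b) \<le> B b"
  shows "norm (frechet_derivative f (at x) v) \<le> (\<Sum>b\<in>Basis. B b) * norm v"
proof -
  have B0: "B b \<ge> 0" if "b \<in> Basis" for b using assms(2)[OF that] norm_ge_zero order_trans by blast
  have "f differentiable (at x)" using smooth_on_has_derivative[OF assms(1)] differentiable_def by blast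
  then have "norm (frechet_derivative f (at x) v) = norm (\<Sum>b\<in>Basis. (v \<bullet> b) *\<^sub>R frechet_derivative f (at x) b)"
    by (subst frechet_derivative_euclidean) auto
  also have "\<dots> \<le> (\<Sum>b\<in>Basis. norm v * B b)"
    by (rule sum_norm_le) (auto intro!: mult_mono B0 assms(2) Basis_le_norm)
  finally show ?thesis by (simp add: sum_distrib_left mult.commute)
qed

lemma smooth_on_lipschitz_convex:
  fixes f :: "'a::euclidean_space \<Rightarrow> 'b::real_normed_vector"
  assumes f: "smooth_on UNIV f" and S: "convex S"
    and B: "\<And>x b. x \<in> S \<Longrightarrow> b \<in> Basis \<Longrightarrow> norm (frechet_derivative f (at x) b) \<le> B b"
    and xy: "x \<in> S" "y \<in> S"
  shows "norm (f x - f y) \<le> (\<Sum>b\<in>Basis. B b) * norm (x - y)"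
  using xy
  by (intro differentiable_bound[OF S, where f'="\<lambda>x. frechet_derivative f (at x)"])
    (auto intro!: has_derivative_at_withinI[OF smooth_on_has_derivative[OF f]] onorm_le
      norm_derivative_le_sum[OF f] B)

lemma smooth_on_lipschitz_cball:
  fixes f :: "'a::euclidean_space \<Rightarrow> 'b::real_normed_vector"
  assumes "smooth_on UNIV f"
  obtains L where "L \<ge> 0" "\<And>x y. x \<in> cball a r \<Longrightarrow> y \<in> cball a r \<Longrightarrow> norm (f x - f y) \<le> L * norm (x - y)"
proof -
  have "\<exists>B\<ge>0. \<forall>x\<in>cball a r. norm (frechet_derivative f (at x) b) \<le> B" for b
    by (rule continuous_on_compact_bounded[OF compact_cball
          continuous_on_subset[OF smooth_on_continuous[OF smooth_on_frechet[OF assms]]], of a r b])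
      auto
  then obtain B where B: "\<And>b. B b \<ge> 0" "\<And>b x. x \<in> cball a r \<Longrightarrow> norm (frechet_derivative f (at x) b) \<le> B b"
    by metis
  show thesis
    by (rule that[OF _ smooth_on_lipschitz_convex[OF assms convex_cball B(2)]]) (auto simp: sum_nonneg B(1))
qed

text \<open>By Cauchy-Schwarz and the Lipschitz bound, |X - Y|^2 exp(-2Lt) has nonpositive
  derivative. The Lipschitz bound is asked on a set \<open>K\<close> because the Hamiltonian vector
  field is Lipschitz only locally.\<close>

lemma gronwall_forward:
  fixes X Y :: "real \<Rightarrow> 'a::real_inner"
  assumes X: "\<And>t. 0 \<le> t \<Longrightarrow> t \<le> T \<Longrightarrow> (X has_vector_derivative F (X t)) (at t)"
    and Y: "\<And>t. 0 \<le> t \<Longrightarrow> t \<le> T \<Longrightarrow> (Y has_vector_derivative F (Y t)) (at t)"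
    and K: "\<And>t. 0 \<le> t \<Longrightarrow> t \<le> T \<Longrightarrow> X t \<in> K" "\<And>t. 0 \<le> t \<Longrightarrow> t \<le> T \<Longrightarrow> Y t \<in> K"
    and L: "\<And>x y. x \<in> K \<Longrightarrow> y \<in> K \<Longrightarrow> norm (F x - F y) \<le> L * norm (x - y)"
    and T: "0 \<le> T"
  shows "norm (X T - Y T) \<le> exp (L * T) * norm (X 0 - Y 0)"
proof -
  let ?u = "\<lambda>t. ((X t - Y t) \<bullet> (X t - Y t)) * exp (- 2 * L * t)"
  have "?u T \<le> ?u 0"
  proof (rule DERIV_nonpos_imp_nonincreasing[OF T])
    fix t assume t: "0 \<le> t" "t \<le> T"
    let ?d = "F (X t) - F (Y t)"
    have d: "((\<lambda>t. X t - Y t) has_vector_derivative ?d) (at t)"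
      using X Y t by (auto intro!: derivative_intros)
    have "((\<lambda>t. (X t - Y t) \<bullet> (X t - Y t)) has_derivative
       (\<lambda>h. (X t - Y t) \<bullet> (h *\<^sub>R ?d) + (h *\<^sub>R ?d) \<bullet> (X t - Y t))) (at t)"
      using d unfolding has_vector_derivative_def by (rule has_derivative_inner) (use d in \<open>simp add: has_vector_derivative_def\<close>)
    then have s: "((\<lambda>t. (X t - Y t) \<bullet> (X t - Y t)) has_real_derivative 2 * ((X t - Y t) \<bullet> ?d)) (at t)"
      unfolding has_field_derivative_def by (rule has_derivative_eq_rhs) (auto simp: fun_eq_iff inner_commute)
    have "(?u has_real_derivative (2 * ((X t - Y t) \<bullet> ?d) - 2 * L * ((X t - Y t) \<bullet> (X t - Y t))) * exp (- 2 * L * t)) (at t)"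
      by (rule derivative_eq_intros s refl | simp add: algebra_simps)+
    moreover have "(X t - Y t) \<bullet> ?d \<le> L * ((X t - Y t) \<bullet> (X t - Y t))"
    proof -
      have "(X t - Y t) \<bullet> ?d \<le> norm (X t - Y t) * norm ?d" by (rule norm_cauchy_schwarz)
      also have "\<dots> \<le> norm (X t - Y t) * (L * norm (X t - Y t))"
        using K t by (intro mult_left_mono L) auto
      finally show ?thesis by (simp add: power2_norm_eq_inner[symmetric] power2_eq_square algebra_simps)
    qed
    ultimately show "\<exists>y. DERIV ?u t :> y \<and> y \<le> 0"
      by (intro exI[of _ "(2 * ((X t - Y t) \<bullet> ?d) - 2 * L * ((X t - Y t) \<bullet> (X t - Y t))) * exp (- 2 * L * t)"] conjI)
        (auto intro: mult_nonpos_nonneg)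
  qed
  then have "(norm (X T - Y T))\<^sup>2 * exp (- 2 * L * T) \<le> (norm (X 0 - Y 0))\<^sup>2"
    by (simp add: power2_norm_eq_inner)
  then have "(norm (X T - Y T))\<^sup>2 \<le> (norm (X 0 - Y 0))\<^sup>2 * exp (2 * L * T)"
    by (simp add: exp_minus field_simps)
  also have "\<dots> = (exp (L * T) * norm (X 0 - Y 0))\<^sup>2"
    by (simp add: power_mult_distrib exp_double[symmetric] mult.assoc)
  finally show ?thesis by (rule power2_le_imp_le) simp
qed

lemma has_vector_derivative_reflect:
  assumes "(X has_vector_derivative D) (at (- t))"
  shows "((\<lambda>s. X (- s)) has_vector_derivative - D) (at t)"
  using vector_diff_chain_at[of uminus "- 1" t X D] assms
  by (simp add: o_def has_vector_derivative_minus[OF has_vector_derivative_id])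

text \<open>Reversing time turns a solution for \<open>F\<close> into one for \<open>- F\<close>,
  which has the same Lipschitz constant.\<close>

lemma gronwall:
  fixes X Y :: "real \<Rightarrow> 'a::real_inner"
  assumes X: "\<And>t. \<bar>t\<bar> \<le> T \<Longrightarrow> (X has_vector_derivative F (X t)) (at t)"
    and Y: "\<And>t. \<bar>t\<bar> \<le> T \<Longrightarrow> (Y has_vector_derivative F (Y t)) (at t)"
    and K: "\<And>t. \<bar>t\<bar> \<le> T \<Longrightarrow> X t \<in> K" "\<And>t. \<bar>t\<bar> \<le> T \<Longrightarrow> Y t \<in> K"
    and L: "\<And>x y. x \<in> K \<Longrightarrow> y \<in> K \<Longrightarrow> norm (F x - F y) \<le> L * norm (x - y)"
    and T: "\<bar>t\<bar> \<le> T"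
  shows "norm (X t - Y t) \<le> exp (L * \<bar>t\<bar>) * norm (X 0 - Y 0)"
proof (cases "t \<ge> 0")
  case True
  show ?thesis
    using gronwall_forward[of t X F Y K L] assms True by auto
next
  case False
  have "norm (X (- (- t)) - Y (- (- t))) \<le> exp (L * (- t)) * norm (X (- 0) - Y (- 0))"
    by (rule gronwall_forward[where F="\<lambda>x. - F x" and K=K])
      (use assms False in \<open>auto intro!: has_vector_derivative_reflect simp: norm_minus_commute\<close>)
  then show ?thesis using False by auto
qed

section \<open>The Hamiltonian vector field\<close>

lemma smooth_on_gradient:
  fixes V :: "real^'n \<Rightarrow> real"
  assumes "smooth_on UNIV V"
  shows "smooth_on UNIV (gradient V)"
proof -
  have "smooth_on UNIV (\<lambda>x. \<Sum>i\<in>UNIV. frechet_derivative V (at x) (axis i 1) *\<^sub>R (axis i 1 :: real^'n))"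
    by (intro smooth_on_sum smooth_on_linear_comp[OF _ bounded_linear_scaleR_left] smooth_on_frechet assms open_UNIV)
  moreover have "(\<lambda>x. \<Sum>i\<in>UNIV. frechet_derivative V (at x) (axis i 1) *\<^sub>R (axis i 1 :: real^'n)) = gradient V"
    by (auto simp: gradient_def partial_def vec_eq_iff axis_def if_distrib cong: if_cong)
  ultimately show ?thesis by simp
qed

lemma has_derivative_gradient:
  fixes V :: "real^'n \<Rightarrow> real"
  assumes "smooth_on UNIV V"
  shows "(V has_derivative (\<lambda>v. gradient V x \<bullet> v)) (at x)"
proof -
  have d: "(V has_derivative frechet_derivative V (at x)) (at x)"
    using smooth_on_has_derivative[OF assms] by simp
  have "frechet_derivative V (at x) v = gradient V x \<bullet> v" for v
  proof -
    have "linear (frechet_derivative V (at x))" using d has_derivative_linear by blast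
    then have "frechet_derivative V (at x) (\<Sum>i\<in>UNIV. (v $ i) *\<^sub>R axis i 1) = (\<Sum>i\<in>UNIV. v $ i * partial i V x)"
      by (simp add: linear_sum linear_scale partial_def)
    moreover have "(\<Sum>i\<in>UNIV. (v $ i) *\<^sub>R (axis i 1 :: real^'n)) = v"
      by (simp add: basis_expansion[of v, unfolded scalar_mult_eq_scaleR])
    ultimately show ?thesis by (simp add: inner_vec_def gradient_def mult.commute)
  qed
  then have "frechet_derivative V (at x) = (\<lambda>v. gradient V x \<bullet> v)" by blast
  then show ?thesis using d by simp
qed

definition hamilton_vector :: "(real^'n \<Rightarrow> real) \<Rightarrow> 'n phase \<Rightarrow> 'n::finite phase" where
  "hamilton_vector V w = (2 *\<^sub>R snd w, - gradient V (fst w))"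

lemma smooth_on_comp_fst:
  fixes f :: "real^'n \<Rightarrow> 'b::real_normed_vector"
  assumes "open S" "smooth_on T f" "fst ` S \<subseteq> T"
  shows "smooth_on S (\<lambda>w :: 'n::finite phase. f (fst w))"
  by (rule smooth_on_compose[OF assms(1,3,2)]) (rule smooth_on_linear[OF assms(1) bounded_linear_fst])

lemma smooth_on_hamilton_vector:
  assumes "smooth_on UNIV V"
  shows "smooth_on UNIV (hamilton_vector V)"
  unfolding hamilton_vector_def
  by (intro smooth_on_Pair open_UNIV smooth_on_linear_comp[OF _ bounded_linear_minus[OF bounded_linear_ident]]
    smooth_on_linear[OF _ bounded_linear_compose[OF bounded_linear_scaleR_right bounded_linear_snd]]
    smooth_on_comp_fst[OF open_UNIV smooth_on_gradient[OF assms] subset_UNIV])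

text \<open>The coordinate sums that define the field are the basis expansion of one directional
  derivative; later arguments use this form.\<close>

lemma hamilton_field_eq:
  assumes "q differentiable (at w)"
  shows "hamilton_field V q w = frechet_derivative q (at w) (hamilton_vector V w)"
proof -
  let ?D = "frechet_derivative q (at w)"
  have lin: "linear ?D" using assms by (rule linear_frechet_derivative)
  obtain x \<xi> where w: "w = (x, \<xi>)" by (cases w)
  have e: "v = (\<Sum>i\<in>UNIV. (v $ i) *\<^sub>R (axis i 1))" for v :: "real^'a"
    by (simp add: basis_expansion[of v, unfolded scalar_mult_eq_scaleR])
  have s1: "((\<Sum>i\<in>UNIV. (v $ i) *\<^sub>R (axis i 1)), 0 :: real^'a) = (\<Sum>i\<in>UNIV. (v $ i) *\<^sub>R (axis i 1, 0))" for v :: "real^'a"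
    by (simp add: prod_eq_iff fst_sum snd_sum)
  have s2: "(0 :: real^'a, (\<Sum>i\<in>UNIV. (v $ i) *\<^sub>R (axis i 1))) = (\<Sum>i\<in>UNIV. (v $ i) *\<^sub>R (0, axis i 1))" for v :: "real^'a"
    by (simp add: prod_eq_iff fst_sum snd_sum)
  have d1: "?D (v, 0) = (\<Sum>i\<in>UNIV. (v $ i) *\<^sub>R ?D (axis i 1, 0))" for v
    by (subst e, subst s1) (simp only: linear_sum[OF lin] linear_scale[OF lin])
  have d2: "?D (0, v) = (\<Sum>i\<in>UNIV. (v $ i) *\<^sub>R ?D (0, axis i 1))" for v
    by (subst e, subst s2) (simp only: linear_sum[OF lin] linear_scale[OF lin])
  have "hamilton_vector V w = (2 *\<^sub>R \<xi>, 0) + (0, - gradient V x)" by (simp add: hamilton_vector_def w)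
  then have "?D (hamilton_vector V w) = ?D (2 *\<^sub>R \<xi>, 0) + ?D (0, - gradient V x)"
    by (simp only: linear_add[OF lin])
  then show ?thesis unfolding d1[of "2 *\<^sub>R \<xi>"] d2[of "- gradient V x"] by (simp add: hamilton_field_def w sum_negf)
qed

text \<open>The Lipschitz bound, uniform for bounded times, controls the change of the point, and
  continuity in time at the fixed point controls the rest. A general time set \<open>S\<close> is
  kept because the damped evolution is estimated for nonnegative times only.\<close>

lemma continuous_joint_of_lipschitz:
  fixes F :: "real \<Rightarrow> 'a::real_normed_vector \<Rightarrow> 'b::real_normed_vector"
  assumes lip: "\<And>r T. \<exists>L. \<forall>t\<in>S. \<bar>t\<bar> \<le> T \<longrightarrow> (\<forall>u\<in>cball 0 r. \<forall>v\<in>cball 0 r. norm (F t u - F t v) \<le> L * norm (u - v))"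
    and time: "\<And>w. continuous_on S (\<lambda>t. F t w)"
  shows "continuous_on (S \<times> UNIV) (\<lambda>z. F (fst z) (snd z))"
  unfolding continuous_on_eq_continuous_within
proof
  fix z assume "z \<in> S \<times> (UNIV :: 'a set)"
  then obtain t w where z: "z = (t, w)" "t \<in> S" by (cases z) auto
  obtain L where L: "\<forall>s\<in>S. \<bar>s\<bar> \<le> \<bar>t\<bar> + 1 \<longrightarrow> (\<forall>u\<in>cball 0 (norm w + 1). \<forall>v\<in>cball 0 (norm w + 1). norm (F s u - F s v) \<le> L * norm (u - v))"
    using lip by blast
  let ?A = "at z within (S \<times> UNIV)"
  have fst_lim: "(fst \<longlongrightarrow> t) ?A" and snd_lim: "(snd \<longlongrightarrow> w) ?A"
    using tendsto_fst[OF tendsto_ident_at, of z "S \<times> UNIV"] tendsto_snd[OF tendsto_ident_at, of z "S \<times> UNIV"] z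
    by auto
  have inS: "\<forall>\<^sub>F y in ?A. fst y \<in> S"
    unfolding eventually_at_filter by (auto intro!: always_eventually)
  have "((\<lambda>z. F (fst z) w) \<longlongrightarrow> F t w) ?A"
    by (rule continuous_on_tendsto_compose[OF time fst_lim z(2) inS])
  then have "((\<lambda>z. L * norm (snd z - w) + norm (F (fst z) w - F t w)) \<longlongrightarrow> L * norm (w - w) + norm (F t w - F t w)) ?A"
    by (intro tendsto_intros snd_lim)
  then have lim: "((\<lambda>z. L * norm (snd z - w) + norm (F (fst z) w - F t w)) \<longlongrightarrow> 0) ?A" by simp
  have e1: "\<forall>\<^sub>F y in ?A. dist (fst y) t < 1" by (rule tendstoD[OF fst_lim]) simp
  have e2: "\<forall>\<^sub>F y in ?A. dist (snd y) w < 1" by (rule tendstoD[OF snd_lim]) simp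
  have "\<forall>\<^sub>F y in ?A. norm (F (fst y) (snd y) - F t w) \<le> L * norm (snd y - w) + norm (F (fst y) w - F t w)"
    using inS e1 e2
  proof eventually_elim
    case (elim y)
    have "norm (snd y) \<le> norm w + 1" using elim(3) norm_triangle_sub[of "snd y" w] by (simp add: dist_norm)
    moreover have "\<bar>fst y\<bar> \<le> \<bar>t\<bar> + 1" using elim(2) by (auto simp: dist_norm)
    ultimately have "norm (F (fst y) (snd y) - F (fst y) w) \<le> L * norm (snd y - w)"
      using L elim(1) by simp
    then show ?case
      using norm_triangle_ineq[of "F (fst y) (snd y) - F (fst y) w" "F (fst y) w - F t w"] by simp
  qed
  then have "((\<lambda>y. F (fst y) (snd y) - F t w) \<longlongrightarrow> 0) ?A"
    by (rule Lim_null_comparison[OF _ lim])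
  then show "continuous ?A (\<lambda>z. F (fst z) (snd z))"
    using z by (simp add: continuous_within LIM_zero_iff)
qed

text \<open>The flow is a given object, defined for all times by \<open>hamilton_flow\<close>.
  Boundedness of \<open>V\<close> turns energy conservation into a momentum bound and thereby keeps
  trajectories starting in a ball inside a known ball over bounded times.\<close>

locale hamiltonian_dynamics =
  fixes V :: "real^'n::finite \<Rightarrow> real" and \<phi> :: "real \<Rightarrow> 'n phase \<Rightarrow> 'n phase" and C0 :: real
  assumes smooth_V: "smooth_on UNIV V"
    and flow: "hamilton_flow V \<phi>"
    and V_bound: "\<And>x. \<bar>V x\<bar> \<le> C0"
begin

lemma C0_nonneg: "C0 \<ge> 0" using V_bound[of 0] by linarith

lemma flow_0 [simp]: "\<phi> 0 w = w" using flow unfolding hamilton_flow_def by blast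

lemma fst_flow: "((\<lambda>t. fst (\<phi> t w)) has_vector_derivative 2 *\<^sub>R snd (\<phi> t w)) (at t)"
  using flow unfolding hamilton_flow_def by blast

lemma snd_flow: "((\<lambda>t. snd (\<phi> t w)) has_vector_derivative - gradient V (fst (\<phi> t w))) (at t)"
  using flow unfolding hamilton_flow_def by blast

lemma flow_deriv: "((\<lambda>t. \<phi> t w) has_vector_derivative hamilton_vector V (\<phi> t w)) (at t)"
  using has_vector_derivative_Pair[OF fst_flow[of w t] snd_flow[of w t]] by (simp add: hamilton_vector_def)

lemma flow_energy: "hamiltonian V (\<phi> t w) = hamiltonian V w"
proof -
  have "((\<lambda>t. hamiltonian V (\<phi> t w)) has_real_derivative 0) (at t)" for t
  proof -
    let ?x = "fst (\<phi> t w)" and ?y = "snd (\<phi> t w)"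
    have 1: "((\<lambda>t. snd (\<phi> t w) \<bullet> snd (\<phi> t w)) has_derivative
       (\<lambda>h. ?y \<bullet> (h *\<^sub>R - gradient V ?x) + (h *\<^sub>R - gradient V ?x) \<bullet> ?y)) (at t)"
      by (rule has_derivative_inner) (use snd_flow[of w t] in \<open>auto simp: has_vector_derivative_def\<close>)
    have 2: "((\<lambda>t. V (fst (\<phi> t w))) has_derivative (\<lambda>h. gradient V ?x \<bullet> (h *\<^sub>R (2 *\<^sub>R ?y)))) (at t)"
      by (rule has_derivative_compose[OF _ has_derivative_gradient[OF smooth_V]])
        (use fst_flow[of w t] in \<open>auto simp: has_vector_derivative_def\<close>)
    have "((\<lambda>t. snd (\<phi> t w) \<bullet> snd (\<phi> t w) + V (fst (\<phi> t w))) has_derivative (\<lambda>h. 0)) (at t)"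
      by (rule has_derivative_eq_rhs[OF has_derivative_add[OF 1 2]]) (auto simp: inner_commute)
    then show ?thesis
      by (simp add: has_field_derivative_def hamiltonian_def case_prod_unfold power2_norm_eq_inner lambda_zero)
  qed
  then have "hamiltonian V (\<phi> t w) = hamiltonian V (\<phi> 0 w)" using DERIV_isconst_all by blast
  then show ?thesis by simp
qed

text \<open>Between two points the potential differs by at most 2 \<open>C0\<close>, so by energy
  conservation the squared momentum grows by at most that much.\<close>

lemma flow_snd_bound: "norm (snd (\<phi> t w)) \<le> norm (snd w) + sqrt (2 * C0)"
proof -
  have "(norm (snd (\<phi> t w)))\<^sup>2 + V (fst (\<phi> t w)) = (norm (snd w))\<^sup>2 + V (fst w)"
    using flow_energy[of t w] by (simp add: hamiltonian_def case_prod_unfold)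
  then have "(norm (snd (\<phi> t w)))\<^sup>2 \<le> (norm (snd w))\<^sup>2 + 2 * C0"
    using V_bound[of "fst w"] V_bound[of "fst (\<phi> t w)"] by linarith
  also have "\<dots> \<le> (norm (snd w) + sqrt (2 * C0))\<^sup>2"
    using C0_nonneg by (simp add: power2_sum)
  finally show ?thesis by (rule power2_le_imp_le) (simp add: C0_nonneg)
qed

lemma flow_fst_bound: "norm (fst (\<phi> t w)) \<le> norm (fst w) + 2 * (norm (snd w) + sqrt (2 * C0)) * \<bar>t\<bar>"
proof -
  let ?B = "2 * (norm (snd w) + sqrt (2 * C0))"
  have "norm (fst (\<phi> t w) - fst (\<phi> 0 w)) \<le> ?B * norm (t - 0)"
  proof (rule differentiable_bound[OF convex_UNIV])
    fix s :: real
    show "((\<lambda>t. fst (\<phi> t w)) has_derivative (\<lambda>h. h *\<^sub>R (2 *\<^sub>R snd (\<phi> s w)))) (at s within UNIV)"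
      using fst_flow[of w s] by (simp add: has_vector_derivative_def)
    show "onorm (\<lambda>h. h *\<^sub>R (2 *\<^sub>R snd (\<phi> s w))) \<le> ?B"
    proof (rule onorm_le)
      fix h :: real
      show "norm (h *\<^sub>R (2 *\<^sub>R snd (\<phi> s w))) \<le> ?B * norm h"
        using mult_left_mono[OF flow_snd_bound[of s w], of "2 * \<bar>h\<bar>"] by (simp add: algebra_simps abs_mult)
    qed
  qed auto
  then show ?thesis using norm_triangle_sub[of "fst (\<phi> t w)" "fst w"] by simp
qed

text \<open>The position bound plus the momentum bound at times up to \<open>T\<close>, for initial
  points in the ball of radius \<open>r\<close>.\<close>

definition flow_radius :: "real \<Rightarrow> real \<Rightarrow> real" where
  "flow_radius r T = r + 2 * (r + sqrt (2 * C0)) * T + (r + sqrt (2 * C0))"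

lemma flow_in_cball:
  assumes "w \<in> cball 0 r" "\<bar>t\<bar> \<le> T"
  shows "\<phi> t w \<in> cball 0 (flow_radius r T)"
proof -
  have w: "norm (fst w) \<le> r" "norm (snd w) \<le> r"
    using assms(1) norm_fst_le[of "fst w" "snd w"] norm_snd_le[of "snd w" "fst w"] by (auto simp: dist_norm)
  have "norm (\<phi> t w) \<le> norm (fst (\<phi> t w)) + norm (snd (\<phi> t w))"
    by (metis norm_Pair_le prod.collapse)
  also have "\<dots> \<le> (norm (fst w) + 2 * (norm (snd w) + sqrt (2 * C0)) * \<bar>t\<bar>) + (norm (snd w) + sqrt (2 * C0))"
    by (intro add_mono flow_fst_bound flow_snd_bound)
  also have "\<dots> \<le> flow_radius r T"
  proof -
    have "0 \<le> r" using w(1) norm_ge_zero[of "fst w"] by linarith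
    then show ?thesis
      unfolding flow_radius_def using w assms(2) C0_nonneg
      by (intro add_mono mult_mono) auto
  qed
  finally show ?thesis by simp
qed

text \<open>Over the time span all orbits stay in the ball of radius \<open>flow_radius r T\<close>,
  where the vector field has one Lipschitz constant, so Gronwall applies. All regularity of the flow
  in its initial point comes from here.\<close>

lemma flow_lipschitz:
  obtains L where "L \<ge> 0"
    "\<And>w w' t. w \<in> cball 0 r \<Longrightarrow> w' \<in> cball 0 r \<Longrightarrow> \<bar>t\<bar> \<le> T \<Longrightarrow> norm (\<phi> t w - \<phi> t w') \<le> L * norm (w - w')"
proof -
  obtain L where L: "L \<ge> 0" "\<And>x y. x \<in> cball 0 (flow_radius r T) \<Longrightarrow> y \<in> cball 0 (flow_radius r T)
     \<Longrightarrow> norm (hamilton_vector V x - hamilton_vector V y) \<le> L * norm (x - y)"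
    using smooth_on_lipschitz_cball[OF smooth_on_hamilton_vector[OF smooth_V]] by metis
  show thesis
  proof (rule that[of "exp (L * \<bar>T\<bar>)"])
    fix w w' :: "'n phase" and t :: real
    assume w: "w \<in> cball 0 r" "w' \<in> cball 0 r" "\<bar>t\<bar> \<le> T"
    have "norm (\<phi> t w - \<phi> t w') \<le> exp (L * \<bar>t\<bar>) * norm (\<phi> 0 w - \<phi> 0 w')"
      by (rule gronwall[OF flow_deriv flow_deriv flow_in_cball[OF w(1)] flow_in_cball[OF w(2)] L(2) w(3)])
    also have "\<dots> \<le> exp (L * \<bar>T\<bar>) * norm (w - w')"
      using w(3) L(1) by (auto intro!: mult_mono mult_left_mono)
    finally show "norm (\<phi> t w - \<phi> t w') \<le> exp (L * \<bar>T\<bar>) * norm (w - w')" .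
  qed simp
qed

text \<open>Uniqueness of solutions: both curves solve the same equation and agree at time 0, so the
  Gronwall bound is a multiple of zero.\<close>

lemma flow_add: "\<phi> (s + t) w = \<phi> s (\<phi> t w)"
proof -
  \<comment> \<open>A radius that holds both curves for all times up to |s| in absolute
    value.\<close>
  define r where "r = max (flow_radius (norm w) (\<bar>s\<bar> + \<bar>t\<bar>)) (flow_radius (norm (\<phi> t w)) \<bar>s\<bar>)"
  obtain L where L: "L \<ge> 0" "\<And>x y. x \<in> cball 0 r \<Longrightarrow> y \<in> cball 0 r
     \<Longrightarrow> norm (hamilton_vector V x - hamilton_vector V y) \<le> L * norm (x - y)"
    using smooth_on_lipschitz_cball[OF smooth_on_hamilton_vector[OF smooth_V]] by metis
  have "norm (\<phi> (s + t) w - \<phi> s (\<phi> t w)) \<le> exp (L * \<bar>s\<bar>) * norm (\<phi> (0 + t) w - \<phi> 0 (\<phi> t w))"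
  proof (rule gronwall[OF _ _ _ _ L(2) order_refl])
    fix u assume u: "\<bar>u\<bar> \<le> \<bar>s\<bar>"
    show "((\<lambda>s. \<phi> (s + t) w) has_vector_derivative hamilton_vector V (\<phi> (u + t) w)) (at u)"
      using vector_diff_chain_at[of "\<lambda>s. s + t" 1 u "\<lambda>s. \<phi> s w" "hamilton_vector V (\<phi> (u + t) w)"] flow_deriv[of w "u + t"]
      by (simp add: o_def has_vector_derivative_add_const has_vector_derivative_id)
    show "((\<lambda>s. \<phi> s (\<phi> t w)) has_vector_derivative hamilton_vector V (\<phi> u (\<phi> t w))) (at u)"
      by (rule flow_deriv)
    show "\<phi> (u + t) w \<in> cball 0 r"
      using flow_in_cball[of w "norm w" "u + t" "\<bar>s\<bar> + \<bar>t\<bar>"] u abs_triangle_ineq[of u t] by (auto simp: r_def le_max_iff_disj)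
    show "\<phi> u (\<phi> t w) \<in> cball 0 r"
      using flow_in_cball[of "\<phi> t w" "norm (\<phi> t w)" u "\<bar>s\<bar>"] u by (auto simp: r_def)
  qed
  then show ?thesis by simp
qed

lemma flow_time_continuous: "continuous_on S (\<lambda>t. \<phi> t w)"
  using flow_deriv has_vector_derivative_continuous
  by (metis continuous_at_imp_continuous_on)

lemma flow_joint_continuous: "continuous_on UNIV (\<lambda>z. \<phi> (fst z) (snd z))"
proof -
  have "continuous_on (UNIV \<times> UNIV) (\<lambda>z. \<phi> (fst z) (snd z))"
  proof (rule continuous_joint_of_lipschitz)
    fix r T :: real
    show "\<exists>L. \<forall>t\<in>UNIV. \<bar>t\<bar> \<le> T \<longrightarrow> (\<forall>u\<in>cball 0 r. \<forall>v\<in>cball 0 r. norm (\<phi> t u - \<phi> t v) \<le> L * norm (u - v))"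
      by (rule flow_lipschitz[of r T]) blast
  qed (rule flow_time_continuous)
  then show ?thesis by simp
qed

lemma flow_continuous: "continuous_on S (\<phi> t)"
proof -
  have "continuous_on S (\<lambda>w. \<phi> (fst (t, w)) (snd (t, w)))"
    by (rule continuous_on_compose2[OF flow_joint_continuous]) (auto intro: continuous_intros)
  then show ?thesis by simp
qed

end


section \<open>Mollification\<close>

lemma norm_integral_le:
  fixes f :: "'a \<Rightarrow> 'b::{banach, second_countable_topology}"
  assumes "integrable M f" "integrable M g" "\<And>x. x \<in> space M \<Longrightarrow> norm (f x) \<le> g x"
  shows "norm (integral\<^sup>L M f) \<le> integral\<^sup>L M g"
proof -
  have "norm (integral\<^sup>L M f) \<le> (\<integral>x. norm (f x) \<partial>M)" by (rule integral_norm_bound)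
  also have "\<dots> \<le> integral\<^sup>L M g" using assms by (intro integral_mono) auto
  finally show ?thesis .
qed

lemma continuous_vanishing_bounded:
  fixes f :: "'a::euclidean_space \<Rightarrow> 'b::real_normed_vector"
  assumes "continuous_on UNIV f" "\<And>x. norm x > r \<Longrightarrow> f x = 0"
  obtains B where "B \<ge> 0" "\<And>x. norm (f x) \<le> B"
proof -
  obtain B where B: "B \<ge> 0" "\<And>x. x \<in> cball 0 r \<Longrightarrow> norm (f x) \<le> B"
    using continuous_on_compact_bounded[OF compact_cball continuous_on_subset[OF assms(1) subset_UNIV]] by metis
  have "norm (f x) \<le> B" for x
    using B assms(2)[of x] by (cases "norm x > r") auto
  then show thesis using that B(1) by blast
qed

lemma continuous_vanishing_integrable:
  fixes f :: "'a::euclidean_space \<Rightarrow> 'b::{banach, second_countable_topology}"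
  assumes nu: "sets \<nu> = sets borel" "\<And>K. compact K \<Longrightarrow> emeasure \<nu> K < \<infinity>"
    and f: "continuous_on UNIV f" "\<And>x. norm x > r \<Longrightarrow> f x = 0"
  shows "integrable \<nu> f"
proof -
  obtain B where B: "B \<ge> 0" "\<And>x. norm (f x) \<le> B"
    using continuous_vanishing_bounded[OF f] by metis
  show ?thesis
  proof (rule Bochner_Integration.integrable_bound)
    show "integrable \<nu> (\<lambda>x. indicator (cball 0 r) x * B)"
      using nu by (intro integrable_mult_left integrable_real_indicator) auto
    show "f \<in> borel_measurable \<nu>"
      unfolding measurable_cong_sets[OF nu(1) refl] by (rule borel_measurable_continuous_onI[OF f(1)])
    show "AE x in \<nu>. norm (f x) \<le> norm (indicator (cball 0 r) x * B)"
    proof (rule AE_I2)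
      fix x show "norm (f x) \<le> norm (indicator (cball 0 r) x * B)"
        using f(2)[of x] B(2)[of x] by (cases "norm x > r") auto
    qed
  qed
qed

lemma continuous_vanishing_integrable_lborel:
  fixes f :: "'a::euclidean_space \<Rightarrow> 'b::{banach, second_countable_topology}"
  assumes "continuous_on UNIV f" "\<And>x. norm x > r \<Longrightarrow> f x = 0"
  shows "integrable lborel f"
  by (rule continuous_vanishing_integrable[OF sets_lborel _ assms])
    (use emeasure_compact_finite in auto)

lemma frechet_derivative_vanishing:
  fixes f :: "'a::euclidean_space \<Rightarrow> 'b::real_normed_vector"
  assumes "\<And>x. norm x > r \<Longrightarrow> f x = 0" "norm x > r"
  shows "frechet_derivative f (at x) = (\<lambda>v. 0)"
proof -
  have "open {x::'a. norm x > r}" by (intro open_Collect_less continuous_intros)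
  then have "(f has_derivative (\<lambda>v. 0)) (at x)"
    by (rule has_derivative_transform_within_open[OF has_derivative_const[of 0], of _ _ _ UNIV, simplified])
      (use assms in auto)
  then show ?thesis by (metis frechet_derivative_at)
qed

text \<open>Two points in the larger ball are covered by the local bound and two points outside the
  smaller one by zero. A pair across the margin of width 1 has distance at least 1, so the bound
  \<open>B\<close> on the values serves as a Lipschitz constant.\<close>

lemma global_lipschitz_of_vanishing:
  fixes f :: "'a::real_normed_vector \<Rightarrow> 'b::real_normed_vector"
  assumes lip: "\<And>x y. x \<in> cball 0 (r + 1) \<Longrightarrow> y \<in> cball 0 (r + 1) \<Longrightarrow> norm (f x - f y) \<le> L * norm (x - y)"
    and zero: "\<And>x. norm x > r \<Longrightarrow> f x = 0" and B: "\<And>x. norm (f x) \<le> B"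
  shows "norm (f x - f y) \<le> max (max L B) 0 * norm (x - y)"
proof -
  let ?M = "max (max L B) 0"
  have *: "norm (f x - f y) \<le> ?M * norm (x - y)" if "norm x \<le> norm y" for x y
  proof -
    consider "norm y \<le> r + 1" | "norm x > r" | "norm x \<le> r" "norm y > r + 1" by linarith
    then show ?thesis
    proof cases
      case 1
      then have "norm (f x - f y) \<le> L * norm (x - y)" using that by (intro lip) auto
      also have "\<dots> \<le> ?M * norm (x - y)" by (intro mult_right_mono) auto
      finally show ?thesis .
    next
      case 2
      then show ?thesis using zero that by simp
    next
      case 3
      then have "1 \<le> norm (x - y)" using norm_triangle_ineq2[of y x] by (simp add: norm_minus_commute)
      moreover have "norm (f x - f y) \<le> ?M" using 3 zero[of y] B[of x] by simp
      ultimately show ?thesis using mult_mono[of "norm (f x - f y)" ?M 1 "norm (x - y)"] by simp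
    qed
  qed
  show ?thesis using *[of x y] *[of y x] by (cases "norm x \<le> norm y") (auto simp: norm_minus_commute)
qed

section \<open>Convolution with smooth kernels\<close>

definition convolve :: "('a::euclidean_space \<Rightarrow> real) \<Rightarrow> ('a \<Rightarrow> complex) \<Rightarrow> 'a \<Rightarrow> complex" where
  "convolve k g x = (LINT t|lborel. k (x - t) *\<^sub>R g t)"

lemma convolve_integrable:
  fixes k :: "'a::euclidean_space \<Rightarrow> real" and g :: "'a \<Rightarrow> complex"
  assumes "continuous_on UNIV k" "continuous_on UNIV g" "\<And>x. norm x > r \<Longrightarrow> g x = 0"
  shows "integrable lborel (\<lambda>t. k (x - t) *\<^sub>R g t)"
proof (rule continuous_vanishing_integrable_lborel)
  show "continuous_on UNIV (\<lambda>t. k (x - t) *\<^sub>R g t)"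
    by (intro continuous_intros assms(2) continuous_on_compose2[OF assms(1)]) auto
qed (use assms(3) in auto)

text \<open>The remainder is needed uniformly in \<open>x\<close>, since it will be integrated over
  all translates of the kernel. The first derivatives are globally Lipschitz because they are smooth
  and vanish far out.\<close>

lemma smooth_taylor_vanishing:
  fixes k :: "'a::euclidean_space \<Rightarrow> real"
  assumes k: "smooth_on UNIV k" "\<And>x. norm x > r \<Longrightarrow> k x = 0"
  obtains C where "C \<ge> 0" "\<And>x h. norm (k (x + h) - k x - frechet_derivative k (at x) h) \<le> C * (norm h)\<^sup>2"
proof -
  let ?D = "\<lambda>x. frechet_derivative k (at x)"
  have "\<exists>C\<ge>0. \<forall>x y. norm (?D x b - ?D y b) \<le> C * norm (x - y)" for b
  proof -
    have Db: "smooth_on UNIV (\<lambda>x. ?D x b)" by (rule smooth_on_frechet[OF k(1)])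
    have zero: "?D x b = 0" if "norm x > r" for x using frechet_derivative_vanishing[OF k(2) that] by simp
    obtain L where L: "L \<ge> 0" "\<And>x y. x \<in> cball 0 (r + 1) \<Longrightarrow> y \<in> cball 0 (r + 1) \<Longrightarrow> norm (?D x b - ?D y b) \<le> L * norm (x - y)"
      using smooth_on_lipschitz_cball[OF Db] by metis
    obtain B where B: "B \<ge> 0" "\<And>x. norm (?D x b) \<le> B"
      using continuous_vanishing_bounded[OF smooth_on_continuous[OF Db] zero] by metis
    have "norm (?D x b - ?D y b) \<le> max (max L B) 0 * norm (x - y)" for x y
      by (rule global_lipschitz_of_vanishing[OF L(2) zero B(2)])
    then show ?thesis by (intro exI[of _ "max (max L B) 0"]) auto
  qed
  then obtain C where C: "\<And>b. C b \<ge> 0" "\<And>b x y. norm (?D x b - ?D y b) \<le> C b * norm (x - y)" by metis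
  show thesis
  proof (rule that[of "\<Sum>b\<in>Basis. C b"])
    show "(\<Sum>b\<in>Basis. C b) \<ge> 0" by (simp add: sum_nonneg C(1))
    fix x h :: 'a
    have lin: "bounded_linear (?D x)" for x
      using smooth_on_has_derivative[OF k(1)] has_derivative_bounded_linear by blast
    \<comment> \<open>Without its linear part the function has a derivative of size |h| on the ball
      of radius |h| about \<open>x\<close>; the mean value inequality on that ball supplies the
      second factor |h|.\<close>
    define \<psi> where "\<psi> z = k z - ?D x z" for z
    have der: "(\<psi> has_derivative (\<lambda>v. ?D z v - ?D x v)) (at z)" for z
      unfolding \<psi>_def
      by (intro has_derivative_diff smooth_on_has_derivative[OF k(1)] bounded_linear_imp_has_derivative lin) simp
    have sm: "smooth_on UNIV \<psi>"
    proof -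
      have "smooth_on UNIV (\<lambda>z. k z + (- 1) * ?D x z)"
        by (intro smooth_on_add k(1) smooth_on_linear_comp[OF _ bounded_linear_mult_right] smooth_on_linear lin open_UNIV)
      then show ?thesis by (simp add: \<psi>_def[abs_def])
    qed
    have "norm (\<psi> (x + h) - \<psi> x) \<le> (\<Sum>b\<in>Basis. C b * norm h) * norm (x + h - x)"
    proof (rule smooth_on_lipschitz_convex[OF sm convex_cball[of x "norm h"]])
      fix z b assume z: "z \<in> cball x (norm h)"
      have "norm (?D z b - ?D x b) \<le> C b * norm (z - x)" by (rule C(2))
      also have "\<dots> \<le> C b * norm h" using z by (intro mult_left_mono C) (auto simp: dist_norm norm_minus_commute)
      finally show "norm (frechet_derivative \<psi> (at z) b) \<le> C b * norm h"
        by (simp add: frechet_derivative_at[OF der[of z], symmetric])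
    qed (auto simp: dist_norm)
    moreover have "\<psi> (x + h) - \<psi> x = k (x + h) - k x - ?D x h"
      unfolding \<psi>_def by (simp add: linear_add[OF bounded_linear.linear[OF lin]])
    ultimately show "norm (k (x + h) - k x - ?D x h) \<le> (\<Sum>b\<in>Basis. C b) * (norm h)\<^sup>2"
      by (simp add: sum_distrib_right power2_eq_square mult.assoc)
  qed
qed

text \<open>All derivatives fall on the kernel, so \<open>g\<close> enters only as a continuous
  function. Differentiation under the integral follows from the uniform Taylor remainder integrated
  against |g|; the induction replaces \<open>k\<close> by a directional derivative of it, again
  smooth and vanishing beyond \<open>r\<close>.\<close>

lemma smooth_on_convolve:
  fixes k :: "'a::euclidean_space \<Rightarrow> real"
  assumes k: "smooth_on UNIV k" "\<And>x. norm x > r \<Longrightarrow> k x = 0"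
    and g: "continuous_on UNIV g" "\<And>x. norm x > R \<Longrightarrow> g x = 0"
  shows "smooth_on UNIV (convolve k g)"
  unfolding smooth_on_def
proof
  have int: "integrable lborel (\<lambda>t. k (x - t) *\<^sub>R g t)" if "smooth_on UNIV k" for k x
    by (rule convolve_integrable[OF smooth_on_continuous[OF that] g])
  have intg: "integrable lborel (\<lambda>t. norm (g t))"
    by (rule continuous_vanishing_integrable_lborel[of _ R]) (use g in \<open>auto intro: continuous_intros\<close>)
  have der: "(convolve k g has_derivative (\<lambda>v. convolve (\<lambda>y. frechet_derivative k (at y) v) g x)) (at x)"
    if k: "smooth_on UNIV k" "\<And>x. norm x > r \<Longrightarrow> k x = 0" for k x
  proof -
    let ?D = "\<lambda>x. frechet_derivative k (at x)"
    have lin: "linear (?D x)" for x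
      using smooth_on_has_derivative[OF k(1)] has_derivative_linear by blast
    have intD: "integrable lborel (\<lambda>t. ?D (x - t) v *\<^sub>R g t)" for v x
      by (rule int) (rule smooth_on_frechet[OF k(1)])
    have "\<exists>B\<ge>0. \<forall>x. norm (?D x b) \<le> B" for b
      proof -
      have "frechet_derivative k (at x) b = 0" if "norm x > r" for x
        using frechet_derivative_vanishing[of r k, OF k(2) that] by simp
      from continuous_vanishing_bounded[OF smooth_on_continuous[OF smooth_on_frechet[OF k(1), of b]] this]
      show ?thesis by metis
    qed
    then obtain B where B: "\<And>b. B b \<ge> 0" "\<And>b x. norm (?D x b) \<le> B b" by metis
    have nD: "norm (?D x v) \<le> (\<Sum>b\<in>Basis. B b) * norm v" for x v
      by (rule norm_derivative_le_sum[OF k(1) B(2)])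
    define M where "M = (LINT t|lborel. norm (g t))"
    have M0: "M \<ge> 0" unfolding M_def by simp
    have bl: "bounded_linear (\<lambda>v. convolve (\<lambda>y. ?D y v) g x)"
    proof (rule bounded_linear_intro[where K="(\<Sum>b\<in>Basis. B b) * M"])
      fix u v :: 'a
      show "convolve (\<lambda>y. ?D y (u + v)) g x = convolve (\<lambda>y. ?D y u) g x + convolve (\<lambda>y. ?D y v) g x"
        unfolding convolve_def by (simp add: linear_add[OF lin] scaleR_add_left intD)
    next
      fix c :: real and v :: 'a
      show "convolve (\<lambda>y. ?D y (c *\<^sub>R v)) g x = c *\<^sub>R convolve (\<lambda>y. ?D y v) g x"
        unfolding convolve_def
        by (simp add: linear_scale[OF lin] scaleR_scaleR[symmetric] del: scaleR_scaleR)
    next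
      fix v :: 'a
      have "norm (convolve (\<lambda>y. ?D y v) g x) \<le> (LINT t|lborel. (\<Sum>b\<in>Basis. B b) * norm v * norm (g t))"
        unfolding convolve_def
        by (rule norm_integral_le[OF intD])
          (use intg nD in \<open>auto intro!: mult_right_mono simp: abs_mult\<close>)
      then show "norm (convolve (\<lambda>y. ?D y v) g x) \<le> norm v * ((\<Sum>b\<in>Basis. B b) * M)"
        by (simp add: M_def algebra_simps)
    qed
    obtain C where C: "C \<ge> 0" "\<And>x h. norm (k (x + h) - k x - ?D x h) \<le> C * (norm h)\<^sup>2"
      using smooth_taylor_vanishing[OF k] by metis
    have est: "norm (convolve k g y - convolve k g x - convolve (\<lambda>z. ?D z (y - x)) g x) \<le> C * M * (norm (y - x))\<^sup>2" for y
    proof -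
      have "convolve k g y - convolve k g x - convolve (\<lambda>z. ?D z (y - x)) g x
        = (LINT t|lborel. k (y - t) *\<^sub>R g t - k (x - t) *\<^sub>R g t - ?D (x - t) (y - x) *\<^sub>R g t)"
        unfolding convolve_def by (simp add: int[OF k(1)] intD)
      also have "norm \<dots> \<le> (LINT t|lborel. C * (norm (y - x))\<^sup>2 * norm (g t))"
      proof (rule norm_integral_le)
        fix t
        have "norm (k ((x - t) + (y - x)) - k (x - t) - ?D (x - t) (y - x)) * norm (g t) \<le> C * (norm (y - x))\<^sup>2 * norm (g t)"
          by (intro mult_right_mono C) auto
        then show "norm (k (y - t) *\<^sub>R g t - k (x - t) *\<^sub>R g t - ?D (x - t) (y - x) *\<^sub>R g t) \<le> C * (norm (y - x))\<^sup>2 * norm (g t)"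
          by (simp add: scaleR_diff_left[symmetric])
      qed (use intg int[OF k(1)] intD in auto)
      finally show ?thesis by (simp add: M_def algebra_simps)
    qed
    have "((\<lambda>y. norm (convolve k g y - convolve k g x - convolve (\<lambda>z. ?D z (y - x)) g x) / norm (y - x)) \<longlongrightarrow> 0) (at x)"
    proof (rule Lim_null_comparison)
      show "\<forall>\<^sub>F y in at x. norm (norm (convolve k g y - convolve k g x - convolve (\<lambda>z. ?D z (y - x)) g x) / norm (y - x)) \<le> C * M * norm (y - x)"
        using est by (auto simp: eventually_at_filter divide_le_eq power2_eq_square mult.assoc intro!: always_eventually)
      show "((\<lambda>y. C * M * norm (y - x)) \<longlongrightarrow> 0) (at x)"
        by (auto intro!: tendsto_eq_intros)
    qed
    then show ?thesis unfolding has_derivative_iff_norm using bl by auto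
  qed
  fix n
  show "higher_differentiable_on n UNIV (convolve k g)" using k
  proof (induction n arbitrary: k)
    case 0
    then have "isCont (convolve k g) x" for x
      using der[of k x] has_derivative_continuous by auto
    then show ?case by (simp add: continuous_at_imp_continuous_on)
  next
    case (Suc n)
    show ?case
    proof (rule higher_diff_SucI[OF open_UNIV der[OF Suc.prems]])
      fix v
      have "higher_differentiable_on n UNIV (convolve (\<lambda>y. frechet_derivative k (at y) v) g)"
      proof (rule Suc.IH[OF smooth_on_frechet[OF Suc.prems(1)]])
        fix x :: 'a assume "norm x > r"
        then show "frechet_derivative k (at x) v = 0"
          using frechet_derivative_vanishing[of r k, OF Suc.prems(2)] by simp
      qed
      then show "higher_differentiable_on n UNIV (\<lambda>x. convolve (\<lambda>y. frechet_derivative k (at y) v) g x)" .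
    qed auto
  qed
qed

lemma convolve_vanishing:
  assumes "\<And>x. norm x > r \<Longrightarrow> k x = 0" "\<And>x. norm x > R \<Longrightarrow> g x = 0" "norm x > R + r"
  shows "convolve k g x = 0"
proof -
  have "k (x - t) *\<^sub>R g t = 0" for t
  proof (cases "norm t > R")
    case False
    then have "norm (x - t) > r" using assms(3) norm_triangle_ineq2[of x t] by linarith
    then show ?thesis using assms(1) by simp
  qed (use assms(2) in auto)
  then show ?thesis unfolding convolve_def by (simp only: integral_zero)
qed

text \<open>Translating the variable by \<open>x\<close> leaves the weight \<open>k (- y)\<close>.
  The resulting mean of \<open>g\<close> around \<open>x\<close> is the form in which all estimates
  are made.\<close>

lemma convolve_even:
  assumes even: "\<And>y. k (- y) = k y" and meas: "continuous_on UNIV k" "continuous_on UNIV g"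
  shows "convolve k g x = (LINT y|lborel. k y *\<^sub>R g (x + y))"
proof -
  have m: "(\<lambda>t. k (x - t) *\<^sub>R g t) \<in> borel_measurable borel"
    by (intro borel_measurable_continuous_onI continuous_intros meas(2) continuous_on_compose2[OF meas(1)]) auto
  have "convolve k g x = integral\<^sup>L (distr lborel borel ((+) x)) (\<lambda>t. k (x - t) *\<^sub>R g t)"
    unfolding convolve_def lborel_distr_plus ..
  also have "\<dots> = (LINT y|lborel. k (x - (x + y)) *\<^sub>R g (x + y))"
    by (subst integral_distr) (use m in auto)
  finally show ?thesis using even by simp
qed

text \<open>Evenness is built in so that convolution at \<open>x\<close> is the mean of
  \<open>g (x + y)\<close> with weight \<open>k y\<close>.\<close>

definition mollifier :: "real \<Rightarrow> ('a::euclidean_space \<Rightarrow> real) \<Rightarrow> bool" where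
  "mollifier \<epsilon> k \<longleftrightarrow> smooth_on UNIV k \<and> (\<forall>x. k x \<ge> 0) \<and> (\<forall>x. norm x > \<epsilon> \<longrightarrow> k x = 0) \<and>
     (\<forall>x. k (- x) = k x) \<and> integrable lborel k \<and> (LINT x|lborel. k x) = 1"

lemma mollifier_exists:
  fixes \<epsilon> :: real
  assumes "\<epsilon> > 0"
  obtains k :: "'a::euclidean_space \<Rightarrow> real" where "mollifier \<epsilon> k"
proof -
  let ?b = "bump (0::'a) \<epsilon>"
  define c where "c = (LINT x|lborel. ?b x)"
  have z: "norm x > \<epsilon> \<Longrightarrow> ?b x = 0" for x using bump_eq_0[of \<epsilon> 0 x] assms by simp
  have int: "integrable lborel ?b"
    by (rule continuous_vanishing_integrable_lborel[OF continuous_on_bump z])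
  have "c > 0"
  proof -
    \<comment> \<open>A nonnegative function with zero integral vanishes almost everywhere, but the
      bump is positive on a ball, which has positive volume.\<close>
    have "c \<noteq> 0"
    proof
      assume "c = 0"
      then have "AE x in lborel. ?b x = 0"
        unfolding c_def using integral_nonneg_eq_0_iff_AE[OF int] by (simp add: bump_nonneg)
      moreover have "{x. ?b x \<noteq> 0} \<in> sets lborel"
        using borel_open[OF open_Collect_neq[OF continuous_on_bump[of UNIV 0 \<epsilon>] continuous_on_const[of UNIV 0]]] by simp
      ultimately have "emeasure lborel {x. ?b x \<noteq> 0} = 0"
        by (subst (asm) AE_iff_measurable) auto
      moreover have "{x. ?b x \<noteq> 0} = ball 0 \<epsilon>"
        using bump_pos_iff[of \<epsilon> 0] bump_nonneg[of 0 \<epsilon>] assms by (force simp: less_le)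
      ultimately show False
        using assms emeasure_lborel_ball_finite[of "0::'a" \<epsilon>] content_ball_pos[of \<epsilon> "0::'a"]
        by (simp add: measure_def)
    qed
    moreover have "c \<ge> 0" unfolding c_def by (simp add: bump_nonneg)
    ultimately show ?thesis by simp
  qed
  have "mollifier \<epsilon> (\<lambda>x. inverse c * ?b x)"
    unfolding mollifier_def
  proof (intro conjI allI impI)
    show "smooth_on UNIV (\<lambda>x. inverse c * ?b x)"
      by (rule smooth_on_linear_comp[OF open_UNIV bounded_linear_mult_right smooth_on_bump])
    show "(LINT x|lborel. inverse c * ?b x) = 1" using \<open>c > 0\<close> by (simp add: c_def[symmetric])
    show "inverse c * ?b (- x) = inverse c * ?b x" for x by (simp add: bump_def)
    show "inverse c * ?b x \<ge> 0" for x using \<open>c > 0\<close> by (simp add: bump_nonneg)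
  qed (use \<open>c > 0\<close> bump_nonneg[of 0 \<epsilon>] z int in auto)
  then show thesis by (rule that)
qed

lemma mollifierD:
  assumes "mollifier \<epsilon> k"
  shows "smooth_on UNIV k" "k x \<ge> 0" "norm x > \<epsilon> \<Longrightarrow> k x = 0" "k (- x) = k x"
    "integrable lborel k" "(LINT x|lborel. k x) = 1" "continuous_on UNIV k"
  using assms smooth_on_continuous unfolding mollifier_def by blast+

lemma mollifier_shift_integrable:
  fixes k :: "'a::euclidean_space \<Rightarrow> real" and g :: "'a \<Rightarrow> complex"
  assumes "mollifier \<epsilon> k" "continuous_on UNIV g"
  shows "integrable lborel (\<lambda>y. k y *\<^sub>R g y)"
  by (rule continuous_vanishing_integrable_lborel[where r=\<epsilon>])
    (use mollifierD[OF assms(1)] assms(2) in \<open>auto intro!: continuous_intros\<close>)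

lemma norm_mollifier_integral_le:
  fixes k :: "'a::euclidean_space \<Rightarrow> real" and g :: "'a \<Rightarrow> complex"
  assumes "mollifier \<epsilon> k" "continuous_on UNIV g" "\<And>y. norm y \<le> \<epsilon> \<Longrightarrow> norm (g y) \<le> B"
  shows "norm (LINT y|lborel. k y *\<^sub>R g y) \<le> B"
proof -
  have "norm (LINT y|lborel. k y *\<^sub>R g y) \<le> (LINT y|lborel. k y * B)"
  proof (rule norm_integral_le)
    fix y
    show "norm (k y *\<^sub>R g y) \<le> k y * B"
    proof (cases "norm y > \<epsilon>")
      case True
      then show ?thesis using mollifierD(3)[OF assms(1)] by simp
    next
      case False
      then show ?thesis using mollifierD(2)[OF assms(1), of y] assms(3)[of y] by (simp add: mult_left_mono)
    qed
  qed (use mollifier_shift_integrable[OF assms(1,2)] mollifierD(5)[OF assms(1)] in auto)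
  then show ?thesis using mollifierD(6)[OF assms(1)] by simp
qed

lemma convolve_mollifier_close:
  fixes k :: "'a::euclidean_space \<Rightarrow> real" and g :: "'a \<Rightarrow> complex"
  assumes "mollifier \<epsilon> k" "continuous_on UNIV g" "\<And>y. norm y \<le> \<epsilon> \<Longrightarrow> norm (g (x + y) - g x) \<le> B"
  shows "norm (convolve k g x - g x) \<le> B"
proof -
  note k = mollifierD[OF assms(1)]
  have c: "continuous_on UNIV (\<lambda>y. g (x + y))"
    by (rule continuous_on_compose2[OF assms(2)]) (auto intro: continuous_intros)
  have "(LINT y|lborel. k y *\<^sub>R g x) = g x" using k(5,6) by simp
  then have "convolve k g x - g x = (LINT y|lborel. k y *\<^sub>R (g (x + y) - g x))"
    unfolding convolve_even[OF k(4,7) assms(2)]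
    using mollifier_shift_integrable[OF assms(1) c] k(5) by (simp add: scaleR_diff_right)
  also have "norm \<dots> \<le> B"
    by (rule norm_mollifier_integral_le[OF assms(1) _ assms(3)]) (intro continuous_intros c)
  finally show ?thesis .
qed

lemma test_function_convolve:
  assumes "mollifier \<epsilon> k" "continuous_on UNIV g" "\<And>x. norm x > r \<Longrightarrow> g x = 0"
  shows "test_function (convolve k g)"
proof (rule test_functionI)
  show "smooth_on UNIV (convolve k g)"
    using smooth_on_convolve[OF mollifierD(1,3)[OF assms(1)] assms(2,3)] by simp
  show "convolve k g w = 0" if "dist 0 w > r + \<epsilon>" for w
    using convolve_vanishing[of \<epsilon> k r g w, OF mollifierD(3)[OF assms(1)] assms(3)] that by simp
qed


section \<open>The transport equation for Lipschitz functions\<close>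

lemma continuous_hamilton_field:
  assumes "smooth_on UNIV V" "smooth_on UNIV q"
  shows "continuous_on UNIV (hamilton_field V q)"
proof -
  have "hamilton_field V q w = (\<Sum>b\<in>Basis. (hamilton_vector V w \<bullet> b) *\<^sub>R frechet_derivative q (at w) b)" for w
  proof -
    have "q differentiable (at w)" using smooth_on_has_derivative[OF assms(2)] differentiable_def by blast
    then show ?thesis by (simp add: hamilton_field_eq frechet_derivative_euclidean[symmetric])
  qed
  moreover have "continuous_on UNIV (\<lambda>w. \<Sum>b\<in>Basis. (hamilton_vector V w \<bullet> b) *\<^sub>R frechet_derivative q (at w) b)"
    by (intro continuous_intros smooth_on_continuous[OF smooth_on_hamilton_vector[OF assms(1)]]
        smooth_on_continuous[OF smooth_on_frechet[OF assms(2)]])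
  ultimately show ?thesis by simp
qed

lemma norm_diff_le_of_derivative:
  fixes X :: "real \<Rightarrow> 'a::real_normed_vector"
  assumes "\<And>t. 0 \<le> t \<Longrightarrow> t \<le> s \<Longrightarrow> (X has_vector_derivative D t) (at t)"
    "\<And>t. 0 \<le> t \<Longrightarrow> t \<le> s \<Longrightarrow> norm (D t) \<le> B" "0 \<le> s"
  shows "norm (X s - X 0) \<le> B * s"
proof -
  have "norm (X s - X 0) \<le> B * norm (s - 0)"
  proof (rule differentiable_bound[OF convex_closed_interval(1)])
    fix t assume t: "t \<in> {0..s}"
    show "(X has_derivative (\<lambda>h. h *\<^sub>R D t)) (at t within {0..s})"
      using assms(1)[of t] t unfolding has_vector_derivative_def by (auto intro: has_derivative_at_withinI)
    show "onorm (\<lambda>h. h *\<^sub>R D t) \<le> B"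
      using assms(2)[of t] t by (intro onorm_le) (auto simp: mult.commute[of B] intro: mult_left_mono)
  qed (use assms(3) in auto)
  then show ?thesis using assms(3) by simp
qed

lemma norm_divideR_le: "s > 0 \<Longrightarrow> norm x \<le> B * s \<Longrightarrow> norm (x /\<^sub>R s) \<le> B"
  by (simp add: field_simps)

lemma has_vector_derivative_quotient:
  fixes f :: "real \<Rightarrow> 'a::real_normed_vector"
  assumes "(f has_vector_derivative D) (at 0)"
  shows "((\<lambda>t. (f t - f 0) /\<^sub>R t) \<longlongrightarrow> D) (at 0)"
proof -
  have "((\<lambda>h. norm (f (0 + h) - f 0 - h *\<^sub>R D) / norm h) \<longlongrightarrow> 0) (at 0)"
    using assms unfolding has_vector_derivative_def has_derivative_at by blast
  then have "((\<lambda>t. norm ((f t - f 0) /\<^sub>R t - D)) \<longlongrightarrow> 0) (at 0)"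
  proof (rule Lim_transform_eventually)
    show "\<forall>\<^sub>F h in at 0. norm (f (0 + h) - f 0 - h *\<^sub>R D) / norm h = norm ((f h - f 0) /\<^sub>R h - D)"
      unfolding eventually_at_filter
    proof (intro always_eventually allI impI)
      fix h :: real assume "h \<noteq> 0"
      then have "(f h - f 0) /\<^sub>R h - D = (f (0 + h) - f 0 - h *\<^sub>R D) /\<^sub>R h"
        by (simp add: scaleR_diff_right)
      then show "norm (f (0 + h) - f 0 - h *\<^sub>R D) / norm h = norm ((f h - f 0) /\<^sub>R h - D)"
        by (simp add: divide_inverse mult.commute)
    qed
  qed
  then show ?thesis using tendsto_norm_zero_iff LIM_zero_iff by blast
qed

context hamiltonian_dynamics
begin

text \<open>The field and the mollifier commute up to the Lipschitz constant times the radius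
  of the mollifier; only difference quotients of \<open>g\<close> enter, never its derivatives.\<close>

lemma commutator_estimate:
  fixes g G :: "'n phase \<Rightarrow> complex"
  assumes g_lip: "\<And>x y. norm (g x - g y) \<le> L * norm (x - y)" and L: "L \<ge> 0"
    and g_zero: "\<And>x. norm x > r \<Longrightarrow> g x = 0"
    and G: "continuous_on UNIV G" "\<And>w. ((\<lambda>s. g (\<phi> s w)) has_vector_derivative G w) (at 0)"
  obtains C where "C \<ge> 0" "\<And>\<epsilon> k w. 0 < \<epsilon> \<Longrightarrow> \<epsilon> \<le> 1 \<Longrightarrow> mollifier \<epsilon> k \<Longrightarrow> w \<in> cball 0 R \<Longrightarrow>
    norm (hamilton_field V (convolve k g) w - convolve k G w) \<le> C * \<epsilon>"
proof -
  let ?b = "hamilton_vector V"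
  define \<rho> where "\<rho> = flow_radius (R + 1) 1"
  have fl: "\<phi> s u \<in> cball 0 \<rho>" if "u \<in> cball 0 (R + 1)" "\<bar>s\<bar> \<le> 1" for s u
    unfolding \<rho>_def by (rule flow_in_cball[OF that])
  have sub: "u \<in> cball 0 \<rho>" if "u \<in> cball 0 (R + 1)" for u :: "'n phase" using fl[OF that, of 0] by simp
  obtain Lb where Lb: "Lb \<ge> 0" "\<And>x y. x \<in> cball 0 \<rho> \<Longrightarrow> y \<in> cball 0 \<rho> \<Longrightarrow> norm (?b x - ?b y) \<le> Lb * norm (x - y)"
    using smooth_on_lipschitz_cball[OF smooth_on_hamilton_vector[OF smooth_V]] by metis
  obtain M where M: "M \<ge> 0" "\<And>x. x \<in> cball 0 \<rho> \<Longrightarrow> norm (?b x) \<le> M"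
    using continuous_on_compact_bounded[OF compact_cball
        continuous_on_subset[OF smooth_on_continuous[OF smooth_on_hamilton_vector[OF smooth_V]] subset_UNIV]] by metis
  have g_cont: "continuous_on S g" for S by (rule lipschitz_imp_continuous_on[OF g_lip])
  show thesis
  proof (rule that[of "L * Lb"])
    show "L * Lb \<ge> 0" using L Lb(1) by simp
    fix \<epsilon> :: real and k :: "'n phase \<Rightarrow> real" and w :: "'n phase"
    assume e: "0 < \<epsilon>" "\<epsilon> \<le> 1" and k: "mollifier \<epsilon> k" and w: "w \<in> cball 0 R"
    note kD = mollifierD[OF k]
    let ?v = "?b w" and ?q = "convolve k g"
    define s where "s n = inverse (real (Suc n))" for n
    have s: "0 < s n" "s n \<le> 1" for n by (auto simp: s_def inverse_le_1_iff)
    have s0: "s \<longlonglongrightarrow> 0" unfolding s_def by (rule LIMSEQ_inverse_real_of_nat)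
    have wy: "w + y \<in> cball 0 (R + 1)" if "norm y \<le> \<epsilon>" for y
      using w that e norm_triangle_ineq[of w y] by simp
    have flow_near: "norm (\<phi> t (w + y) - (w + y)) \<le> M * t" if "norm y \<le> \<epsilon>" "0 \<le> t" "t \<le> 1" for y :: "'n phase" and t
      using norm_diff_le_of_derivative[of t "\<lambda>t. \<phi> t (w + y)" "\<lambda>t. ?b (\<phi> t (w + y))" M]
        flow_deriv M(2)[OF fl[OF wy]] that by auto
    \<comment> \<open>The orbit of \<open>w + y\<close> is compared with straight motion at the
      velocity of the field at \<open>w\<close>. The velocities differ by at most \<open>Lb\<close>
      times the distance of the orbit from \<open>w\<close>, which up to time t is at most
      \<epsilon> + M t.\<close>
    have flow_close: "norm (\<phi> t (w + y) - (w + y + t *\<^sub>R ?v)) \<le> Lb * (\<epsilon> + M * t) * t"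
      if y: "norm y \<le> \<epsilon>" and t: "0 \<le> t" "t \<le> 1" for y :: "'n phase" and t
    proof -
      have "norm ((\<phi> t (w + y) - t *\<^sub>R ?v) - (\<phi> 0 (w + y) - 0 *\<^sub>R ?v)) \<le> Lb * (\<epsilon> + M * t) * t"
      proof (rule norm_diff_le_of_derivative[where D="\<lambda>t. ?b (\<phi> t (w + y)) - ?v"])
        fix u assume u: "0 \<le> u" "u \<le> t"
        show "((\<lambda>t. \<phi> t (w + y) - t *\<^sub>R ?v) has_vector_derivative ?b (\<phi> u (w + y)) - ?v) (at u)"
          by (rule derivative_eq_intros flow_deriv refl | simp)+
        have "norm (?b (\<phi> u (w + y)) - ?v) \<le> Lb * norm (\<phi> u (w + y) - w)"
          using u t w by (intro Lb(2) fl[OF wy[OF y]] sub) auto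
        also have "norm (\<phi> u (w + y) - w) \<le> \<epsilon> + M * u"
          using flow_near[OF y, of u] u t norm_triangle_ineq[of "\<phi> u (w + y) - (w + y)" y] y by simp
        also have "\<epsilon> + M * u \<le> \<epsilon> + M * t" using u M(1) by (simp add: mult_left_mono)
        finally show "norm (?b (\<phi> u (w + y)) - ?v) \<le> Lb * (\<epsilon> + M * t)" using Lb(1) by (simp add: mult_left_mono)
      qed (use t in auto)
      then show ?thesis by (simp add: algebra_simps)
    qed
    \<comment> \<open>Difference quotients with step \<open>s n\<close>: \<open>A\<close> moves the
      mollified function along the straight line, \<open>B\<close> moves \<open>g\<close> along the
      flow inside the mean. Their limits are the two quantities to be compared.\<close>
    define A where "A n = (?q (w + s n *\<^sub>R ?v) - ?q w) /\<^sub>R s n" for n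
    define B where "B n = (LINT y|lborel. k y *\<^sub>R ((g (\<phi> (s n) (w + y)) - g (w + y)) /\<^sub>R s n))" for n
    have q_sm: "smooth_on UNIV ?q"
      using smooth_on_convolve[OF kD(1,3) g_cont g_zero] by simp
    have hf: "hamilton_field V ?q w = frechet_derivative ?q (at w) ?v"
      using smooth_on_has_derivative[OF q_sm, of w] by (intro hamilton_field_eq) (auto simp: differentiable_def)
    have A_lim: "A \<longlonglongrightarrow> hamilton_field V ?q w"
    proof -
      have "((\<lambda>t. ?q (w + t *\<^sub>R ?v)) has_vector_derivative frechet_derivative ?q (at w) ?v) (at 0)"
      proof -
        have lin: "linear (frechet_derivative ?q (at w))"
          using smooth_on_has_derivative[OF q_sm, of w] has_derivative_linear by blast
        have "((\<lambda>t::real. w + t *\<^sub>R ?v) has_derivative (\<lambda>t. t *\<^sub>R ?v)) (at 0)"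
          by (auto intro!: derivative_eq_intros)
        from has_derivative_compose[OF this, of ?q "frechet_derivative ?q (at w)"] smooth_on_has_derivative[OF q_sm, of w]
        show ?thesis unfolding has_vector_derivative_def by (simp add: linear_scale[OF lin])
      qed
      then have "((\<lambda>t. (?q (w + t *\<^sub>R ?v) - ?q w) /\<^sub>R t) \<longlongrightarrow> hamilton_field V ?q w) (at 0)"
        unfolding hf by (drule_tac has_vector_derivative_quotient) simp
      then show ?thesis unfolding A_def
        by (rule filterlim_compose) (use s0 s(1) in \<open>auto simp: filterlim_at less_imp_neq[symmetric]\<close>)
    qed
    have tr: "continuous_on UNIV (\<lambda>y. w + y + c)" for c :: "'n phase" by (intro continuous_intros)
    have tr0: "continuous_on UNIV (\<lambda>y. w + y)" by (intro continuous_intros)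
    have cs: "continuous_on UNIV (\<lambda>y. g (w + y + c))" for c
      by (rule continuous_on_compose2[OF g_cont tr subset_UNIV])
    have cs0: "continuous_on UNIV (\<lambda>y. g (w + y))" using cs[of 0] by simp
    have cp: "continuous_on UNIV (\<lambda>y. g (\<phi> t (w + y)))" for t
      by (rule continuous_on_compose2[OF g_cont continuous_on_compose2[OF flow_continuous tr0 subset_UNIV] subset_UNIV])
    have cG: "continuous_on UNIV (\<lambda>y. G (w + y))"
      by (rule continuous_on_compose2[OF G(1) tr0 subset_UNIV])
    \<comment> \<open>The dominating function is the kernel times L M, because \<open>g\<close> is
      L-Lipschitz and the flow moves at speed at most \<open>M\<close>.\<close>
    have B_lim: "B \<longlonglongrightarrow> convolve k G w"
      unfolding B_def convolve_even[OF kD(4,7) G(1)]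
    proof (rule integral_dominated_convergence[where w="\<lambda>y. k y * (L * M)"])
      show "integrable lborel (\<lambda>y. k y * (L * M))" using kD(5) by simp
      show "(\<lambda>y. k y *\<^sub>R G (w + y)) \<in> borel_measurable lborel"
        using mollifier_shift_integrable[OF k cG] by simp
      show "(\<lambda>y. k y *\<^sub>R ((g (\<phi> (s n) (w + y)) - g (w + y)) /\<^sub>R s n)) \<in> borel_measurable lborel" for n
        by (rule borel_measurable_integrable, rule mollifier_shift_integrable[OF k])
          (intro continuous_intros cs0 cp)
      show "AE y in lborel. (\<lambda>n. k y *\<^sub>R ((g (\<phi> (s n) (w + y)) - g (w + y)) /\<^sub>R s n)) \<longlonglongrightarrow> k y *\<^sub>R G (w + y)"
      proof (rule AE_I2)
        fix y :: "'n phase"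
        have "((\<lambda>t. (g (\<phi> t (w + y)) - g (\<phi> 0 (w + y))) /\<^sub>R t) \<longlongrightarrow> G (w + y)) (at 0)"
          by (rule has_vector_derivative_quotient[OF G(2)])
        then have "(\<lambda>n. (g (\<phi> (s n) (w + y)) - g (w + y)) /\<^sub>R s n) \<longlonglongrightarrow> G (w + y)"
          unfolding flow_0
          by (rule filterlim_compose) (use s0 s(1) in \<open>auto simp: filterlim_at less_imp_neq[symmetric]\<close>)
        then show "(\<lambda>n. k y *\<^sub>R ((g (\<phi> (s n) (w + y)) - g (w + y)) /\<^sub>R s n)) \<longlonglongrightarrow> k y *\<^sub>R G (w + y)"
          by (intro tendsto_intros)
      qed
      show "AE y in lborel. norm (k y *\<^sub>R ((g (\<phi> (s n) (w + y)) - g (w + y)) /\<^sub>R s n)) \<le> k y * (L * M)" for n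
      proof (rule AE_I2)
        fix y :: "'n phase"
        show "norm (k y *\<^sub>R ((g (\<phi> (s n) (w + y)) - g (w + y)) /\<^sub>R s n)) \<le> k y * (L * M)"
        proof (cases "norm y > \<epsilon>")
          case True then show ?thesis using kD(3) by simp
        next
          case False
          have "norm (g (\<phi> (s n) (w + y)) - g (w + y)) \<le> L * (M * s n)"
            using flow_near[of y "s n"] False s[of n] L
            by (intro order_trans[OF g_lip] mult_left_mono) auto
          then have "norm ((g (\<phi> (s n) (w + y)) - g (w + y)) /\<^sub>R s n) \<le> L * M"
            by (intro norm_divideR_le s(1)) (simp add: mult.assoc)
          then show ?thesis using mult_left_mono[OF _ kD(2)[of y]] by (simp only: norm_scaleR abs_of_nonneg[OF kD(2)])
        qed
      qed
    qed
    have bound: "norm (A n - B n) \<le> L * (Lb * (\<epsilon> + M * s n))" for n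
    proof -
      have "A n = (LINT y|lborel. k y *\<^sub>R ((g (w + y + s n *\<^sub>R ?v) - g (w + y)) /\<^sub>R s n))"
      proof -
        have "?q (w + s n *\<^sub>R ?v) = (LINT y|lborel. k y *\<^sub>R g (w + y + s n *\<^sub>R ?v))"
          unfolding convolve_even[OF kD(4,7) g_cont]
          by (intro Bochner_Integration.integral_cong refl) (simp add: ac_simps)
        then have "A n = inverse (s n) *\<^sub>R (LINT y|lborel. k y *\<^sub>R g (w + y + s n *\<^sub>R ?v) - k y *\<^sub>R g (w + y))"
          unfolding A_def convolve_even[OF kD(4,7) g_cont, of w]
          using mollifier_shift_integrable[OF k cs[of "s n *\<^sub>R ?v"]] mollifier_shift_integrable[OF k cs0]
          by simp
        also have "\<dots> = (LINT y|lborel. k y *\<^sub>R ((g (w + y + s n *\<^sub>R ?v) - g (w + y)) /\<^sub>R s n))"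
          unfolding integral_scaleR_right[symmetric]
          by (intro Bochner_Integration.integral_cong refl) (simp add: scaleR_diff_right mult.commute)
        finally show ?thesis .
      qed
      moreover have i1: "integrable lborel (\<lambda>y. k y *\<^sub>R ((g (w + y + s n *\<^sub>R ?v) - g (w + y)) /\<^sub>R s n))"
        by (rule mollifier_shift_integrable[OF k]) (intro continuous_intros cs cs0)
      moreover have i2: "integrable lborel (\<lambda>y. k y *\<^sub>R ((g (\<phi> (s n) (w + y)) - g (w + y)) /\<^sub>R s n))"
        by (rule mollifier_shift_integrable[OF k]) (intro continuous_intros cp cs0)
      ultimately have "A n - B n = (LINT y|lborel. k y *\<^sub>R ((g (w + y + s n *\<^sub>R ?v) - g (w + y)) /\<^sub>R s n)
          - k y *\<^sub>R ((g (\<phi> (s n) (w + y)) - g (w + y)) /\<^sub>R s n))"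
        unfolding B_def by simp
      \<comment> \<open>The values at \<open>w + y\<close> cancel; what remains is a difference of
        \<open>g\<close> between the straight and the flowed point.\<close>
      also have "\<dots> = (LINT y|lborel. k y *\<^sub>R ((g (w + y + s n *\<^sub>R ?v) - g (\<phi> (s n) (w + y))) /\<^sub>R s n))"
        by (intro Bochner_Integration.integral_cong refl) (simp add: scaleR_diff_right algebra_simps)
      also have "norm \<dots> \<le> L * (Lb * (\<epsilon> + M * s n))"
      proof (rule norm_mollifier_integral_le[OF k])
        show "continuous_on UNIV (\<lambda>y. (g (w + y + s n *\<^sub>R ?v) - g (\<phi> (s n) (w + y))) /\<^sub>R s n)"
          by (intro continuous_intros cs cp)
        fix y :: "'n phase" assume y: "norm y \<le> \<epsilon>"
        have "norm (g (w + y + s n *\<^sub>R ?v) - g (\<phi> (s n) (w + y))) \<le> L * (Lb * (\<epsilon> + M * s n) * s n)"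
          using flow_close[OF y, of "s n"] s[of n] L
          by (intro order_trans[OF g_lip] mult_left_mono) (auto simp: norm_minus_commute)
        then show "norm ((g (w + y + s n *\<^sub>R ?v) - g (\<phi> (s n) (w + y))) /\<^sub>R s n) \<le> L * (Lb * (\<epsilon> + M * s n))"
          by (intro norm_divideR_le s(1)) (simp add: mult.assoc)
      qed
      finally show ?thesis .
    qed
    have "norm (hamilton_field V ?q w - convolve k G w) \<le> L * (Lb * (\<epsilon> + M * 0))"
      by (rule LIMSEQ_le[OF tendsto_norm[OF tendsto_diff[OF A_lim B_lim]]
          tendsto_mult[OF tendsto_const tendsto_mult[OF tendsto_const tendsto_add[OF tendsto_const tendsto_mult[OF tendsto_const s0]]]]])
        (use bound in auto)
    then show "norm (hamilton_field V ?q w - convolve k G w) \<le> L * Lb * \<epsilon>" by (simp add: mult.assoc)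
  qed
qed

text \<open>\<open>G\<close> takes the place of the field applied to \<open>g\<close>; only a
  derivative along the flow is asked for. The mollified functions satisfy the weak equation,
  converge to \<open>g\<close>, and have field derivatives converging to \<open>G\<close> by the
  commutator estimate. They are uniformly bounded and vanish outside one fixed ball, so dominated
  convergence applies on both sides.\<close>

lemma weak_transport_lipschitz:
  fixes g G :: "'n phase \<Rightarrow> complex" and W :: "'n phase \<Rightarrow> real" and \<nu> m :: "'n phase measure"
  assumes nu: "sets \<nu> = sets borel" "\<And>K. compact K \<Longrightarrow> emeasure \<nu> K < \<infinity>"
    and m: "sets m = sets borel" "finite_measure m"
    and W: "continuous_on UNIV W"
    and weak: "\<And>q. test_function q \<Longrightarrow>
      (LINT w|\<nu>. - hamilton_field V q w + of_real (W w) * q w) = (LINT w|m. q w)"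
    and g_lip: "\<And>x y. norm (g x - g y) \<le> L * norm (x - y)" and L: "L \<ge> 0"
    and g_zero: "\<And>x. norm x > r \<Longrightarrow> g x = 0"
    and G: "continuous_on UNIV G" "\<And>w. ((\<lambda>s. g (\<phi> s w)) has_vector_derivative G w) (at 0)"
  shows "(LINT w|\<nu>. - G w + of_real (W w) * g w) = (LINT w|m. g w)"
proof -
  have g_cont: "continuous_on S g" for S by (rule lipschitz_imp_continuous_on[OF g_lip])
  \<comment> \<open>A point outside the ball stays outside for short times, so \<open>g\<close> is
    constantly 0 along its orbit near time 0.\<close>
  have G_zero: "G w = 0" if "norm w > r" for w
  proof -
    have "open {s. norm (\<phi> s w) > r}"
      by (intro open_Collect_less continuous_intros flow_time_continuous)
    then have "((\<lambda>s. g (\<phi> s w)) has_vector_derivative 0) (at 0)"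
      by (rule has_vector_derivative_transform_within_open[OF has_vector_derivative_const[of 0]])
        (use that g_zero in auto)
    then show ?thesis using G(2) vector_derivative_unique_at by blast
  qed
  obtain Bg where Bg: "Bg \<ge> 0" "\<And>x. norm (g x) \<le> Bg"
    using continuous_vanishing_bounded[OF g_cont g_zero] by metis
  obtain BG where BG: "BG \<ge> 0" "\<And>x. norm (G x) \<le> BG"
    using continuous_vanishing_bounded[OF G(1) G_zero] by metis
  define K where "K = cball (0 :: 'n phase) (r + 1)"
  have K: "compact K" "K \<in> sets \<nu>" by (auto simp: K_def nu)
  obtain BW where BW: "BW \<ge> 0" "\<And>x. x \<in> K \<Longrightarrow> norm (W x) \<le> BW"
    using continuous_on_compact_bounded[OF K(1) continuous_on_subset[OF W subset_UNIV]] by metis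
  obtain C where C: "C \<ge> 0" "\<And>\<epsilon> k w. 0 < \<epsilon> \<Longrightarrow> \<epsilon> \<le> 1 \<Longrightarrow> mollifier \<epsilon> k \<Longrightarrow> w \<in> K \<Longrightarrow>
    norm (hamilton_field V (convolve k g) w - convolve k G w) \<le> C * \<epsilon>"
    unfolding K_def using commutator_estimate[OF g_lip L g_zero G] by metis
  define s where "s n = inverse (real (Suc n))" for n
  have s: "0 < s n" "s n \<le> 1" for n by (auto simp: s_def inverse_le_1_iff)
  have s0: "s \<longlonglongrightarrow> 0" unfolding s_def by (rule LIMSEQ_inverse_real_of_nat)
  have "\<exists>k :: 'n phase \<Rightarrow> real. mollifier (s n) k" for n using mollifier_exists[OF s(1)] by metis
  then obtain k :: "nat \<Rightarrow> 'n phase \<Rightarrow> real" where k: "\<And>n. mollifier (s n) (k n)" by metis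
  define q where "q n = convolve (k n) g" for n
  have q_test: "test_function (q n)" for n
    unfolding q_def by (rule test_function_convolve[OF k g_cont g_zero])
  have q_sm: "smooth_on UNIV (q n)" for n using q_test[of n] by (simp add: test_function_def)
  have q_cont: "continuous_on UNIV (q n)" for n by (rule smooth_on_continuous[OF q_sm])
  have q_zero: "q n w = 0" if "norm w > r + 1" for n w
    unfolding q_def
    by (rule convolve_vanishing[OF mollifierD(3)[OF k] g_zero]) (use that s(2)[of n] in auto)
  have H_zero: "hamilton_field V (q n) w = 0" if "norm w > r + 1" for n w
  proof -
    have "q n differentiable (at w)" using smooth_on_has_derivative[OF q_sm] differentiable_def by blast
    then show ?thesis
      using frechet_derivative_vanishing[of "r + 1" "q n", OF q_zero that] by (simp add: hamilton_field_eq)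
  qed
  have conv_bound: "norm (convolve (k n) f w) \<le> B"
    if "continuous_on UNIV f" "\<And>x. norm (f x) \<le> B" for n f B w
    unfolding convolve_even[OF mollifierD(4,7)[OF k] that(1)]
    by (rule norm_mollifier_integral_le[OF k _ that(2)])
      (rule continuous_on_compose2[OF that(1) _ subset_UNIV], intro continuous_intros)
  have q_lim: "(\<lambda>n. q n w) \<longlonglongrightarrow> g w" for w
  proof (rule LIM_zero_cancel, rule Lim_null_comparison)
    show "\<forall>\<^sub>F n in sequentially. norm (q n w - g w) \<le> L * s n"
    proof (rule always_eventually, rule allI)
      fix n
      show "norm (q n w - g w) \<le> L * s n"
        unfolding q_def
      proof (rule convolve_mollifier_close[OF k g_cont])
        fix y :: "'n phase" assume "norm y \<le> s n"
        then show "norm (g (w + y) - g w) \<le> L * s n"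
          using L by (intro order_trans[OF g_lip] mult_left_mono) auto
      qed
    qed
    show "(\<lambda>n. L * s n) \<longlonglongrightarrow> 0" using tendsto_mult_right_zero[OF s0] .
  qed
  have G_lim: "(\<lambda>n. convolve (k n) G w) \<longlonglongrightarrow> G w" for w
  proof (rule metric_LIMSEQ_I)
    fix e :: real assume e: "e > 0"
    have "isCont G w" using G(1) continuous_on_eq_continuous_at by blast
    then obtain d where d: "d > 0" "\<And>x. dist x w < d \<Longrightarrow> dist (G x) (G w) < e / 2"
      unfolding continuous_at_eps_delta using half_gt_zero[OF e] by blast
    obtain N where N: "\<And>n. n \<ge> N \<Longrightarrow> s n < d" using order_tendstoD(2)[OF s0 d(1)] unfolding eventually_sequentially by blast
    have "dist (convolve (k n) G w) (G w) < e" if "n \<ge> N" for n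
    proof -
      have "norm (convolve (k n) G w - G w) \<le> e / 2"
      proof (rule convolve_mollifier_close[OF k G(1)])
        fix y :: "'n phase" assume "norm y \<le> s n"
        then have "dist (w + y) w < d" using N[OF that] by (simp add: dist_norm)
        from d(2)[OF this] show "norm (G (w + y) - G w) \<le> e / 2" by (simp add: dist_norm)
      qed
      then show ?thesis using e by (simp add: dist_norm)
    qed
    then show "\<exists>N. \<forall>n\<ge>N. dist (convolve (k n) G w) (G w) < e" by blast
  qed
  have H_lim: "(\<lambda>n. hamilton_field V (q n) w) \<longlonglongrightarrow> G w" for w
  proof (cases "w \<in> K")
    case True
    have "(\<lambda>n. hamilton_field V (q n) w - convolve (k n) G w) \<longlonglongrightarrow> 0"
    proof (rule Lim_null_comparison)
      show "\<forall>\<^sub>F n in sequentially. norm (hamilton_field V (q n) w - convolve (k n) G w) \<le> C * s n"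
        unfolding q_def using C(2)[OF s k True] by (intro always_eventually) blast
      show "(\<lambda>n. C * s n) \<longlonglongrightarrow> 0" using tendsto_mult_right_zero[OF s0] .
    qed
    from tendsto_add[OF this G_lim[of w]] show ?thesis by simp
  next
    case False
    then have "norm w > r + 1" by (auto simp: K_def)
    then show ?thesis using H_zero G_zero[of w] by simp
  qed
  define f where "f n w = - hamilton_field V (q n) w + of_real (W w) * q n w" for n w
  have "(\<lambda>n. LINT w|\<nu>. f n w) \<longlonglongrightarrow> (LINT w|\<nu>. - G w + of_real (W w) * g w)"
  proof (rule integral_dominated_convergence[where w="\<lambda>w. indicator K w * (C + BG + BW * Bg)"])
    show "(\<lambda>w. - G w + of_real (W w) * g w) \<in> borel_measurable \<nu>"
      unfolding measurable_cong_sets[OF nu(1) refl]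
      by (intro borel_measurable_continuous_onI continuous_intros G(1) W g_cont)
    show "f n \<in> borel_measurable \<nu>" for n
      unfolding measurable_cong_sets[OF nu(1) refl] f_def
      by (intro borel_measurable_continuous_onI continuous_intros continuous_hamilton_field[OF smooth_V q_sm] W q_cont)
    show "integrable \<nu> (\<lambda>w. indicator K w * (C + BG + BW * Bg))"
      using K nu(2)[OF K(1)] by (intro integrable_mult_left integrable_real_indicator) auto
    show "AE w in \<nu>. (\<lambda>n. f n w) \<longlonglongrightarrow> - G w + of_real (W w) * g w"
      unfolding f_def by (intro AE_I2 tendsto_intros H_lim q_lim)
    show "AE w in \<nu>. norm (f n w) \<le> indicator K w * (C + BG + BW * Bg)" for n
    proof (rule AE_I2)
      fix w
      show "norm (f n w) \<le> indicator K w * (C + BG + BW * Bg)"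
      proof (cases "w \<in> K")
        case True
        have "norm (hamilton_field V (q n) w) \<le> C + BG"
          using C(2)[OF s(1)[of n] s(2)[of n] k True] conv_bound[OF G(1) BG(2), of n w] s(2)[of n] C(1)
            norm_triangle_sub[of "hamilton_field V (q n) w" "convolve (k n) G w"] mult_left_le[of "s n" C]
          unfolding q_def by linarith
        moreover have "norm (of_real (W w) * q n w) \<le> BW * Bg"
          using BW(2)[OF True] conv_bound[OF g_cont Bg(2), of n w] BW(1)
          unfolding q_def by (auto simp: norm_mult intro!: mult_mono)
        ultimately have "norm (f n w) \<le> C + BG + BW * Bg"
          unfolding f_def by (intro order_trans[OF norm_triangle_ineq]) simp
        then show ?thesis using True by simp
      next
        case False
        then have "norm w > r + 1" by (auto simp: K_def)
        then show ?thesis using H_zero q_zero False by (simp add: f_def)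
      qed
    qed
  qed
  moreover have "(\<lambda>n. LINT w|m. q n w) \<longlonglongrightarrow> (LINT w|m. g w)"
  proof (rule integral_dominated_convergence[where w="\<lambda>w. Bg"])
    show "g \<in> borel_measurable m" "q n \<in> borel_measurable m" for n
      unfolding measurable_cong_sets[OF m(1) refl]
      by (intro borel_measurable_continuous_onI g_cont q_cont)+
    show "integrable m (\<lambda>w. Bg)" using m(2) by (rule finite_measure.integrable_const)
    show "AE w in m. (\<lambda>n. q n w) \<longlonglongrightarrow> g w" by (intro AE_I2 q_lim)
    show "AE w in m. norm (q n w) \<le> Bg" for n
      unfolding q_def by (intro AE_I2 conv_bound[OF g_cont Bg(2)])
  qed
  moreover have "(LINT w|\<nu>. f n w) = (LINT w|m. q n w)" for n
    unfolding f_def by (rule weak[OF q_test])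
  ultimately show ?thesis using LIMSEQ_unique by auto
qed

end


section \<open>Duhamel's formula\<close>

text \<open>For t < 0 the interval \<open>{0..t}\<close> is empty and contributes 0; the second term
  then supplies the oriented integral. Negative times matter because derivatives along the flow are
  two-sided at time 0.\<close>

definition signed_integral :: "(real \<Rightarrow> 'a::banach) \<Rightarrow> real \<Rightarrow> 'a" where
  "signed_integral f t = integral {0..t} f - integral {t..0} f"

lemma signed_integral_nonneg: "t \<ge> 0 \<Longrightarrow> signed_integral f t = integral {0..t} f"
  by (cases "t = 0") (auto simp: signed_integral_def)

lemma signed_integral_0 [simp]: "signed_integral f 0 = 0"
  by (simp add: signed_integral_def)

lemma signed_integral_deriv:
  assumes "continuous_on UNIV f"
  shows "(signed_integral f has_vector_derivative f t) (at t)"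
proof -
  \<comment> \<open>Taking -N as base point changes the function only by a constant on the interval
    from -N to N, and \<open>t\<close> is interior to that interval.\<close>
  define N where "N = \<bar>t\<bar> + 1"
  have c: "continuous_on S f" for S using assms continuous_on_subset by blast
  have i: "f integrable_on {a..b}" for a b by (rule integrable_continuous_real[OF c])
  have eq: "signed_integral f u = integral {-N..u} f - integral {-N..0} f" if "u \<in> {-N<..<N}" for u
  proof (cases "u \<ge> 0")
    case True
    then show ?thesis
      using Henstock_Kurzweil_Integration.integral_combine[of "-N" 0 u f] i
      by (simp add: signed_integral_nonneg N_def algebra_simps)
  next
    case False
    then show ?thesis
      using Henstock_Kurzweil_Integration.integral_combine[of "-N" u 0 f] i that
      by (simp add: signed_integral_def algebra_simps)
  qed
  have t: "t \<in> {-N<..<N}" by (auto simp: N_def)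
  have "((\<lambda>u. integral {-N..u} f) has_vector_derivative f t) (at t within {-N..N})"
    by (rule integral_has_vector_derivative[OF c]) (use t in auto)
  then have "((\<lambda>u. integral {-N..u} f) has_vector_derivative f t) (at t)"
    using t by (subst (asm) at_within_interior) auto
  then have "((\<lambda>u. integral {-N..u} f - integral {-N..0} f) has_vector_derivative f t) (at t)"
    using has_vector_derivative_diff[OF _ has_vector_derivative_const] by fastforce
  then show ?thesis
    by (rule has_vector_derivative_transform_within_open[OF _ open_greaterThanLessThan t]) (use eq in simp)
qed

lemma has_vector_derivative_shift_time:
  assumes "(f has_vector_derivative D) (at (t + s))"
  shows "((\<lambda>t. f (t + s)) has_vector_derivative D) (at t)"
  using vector_diff_chain_at[of "\<lambda>t. t + s" 1 t f D] assms
  by (simp add: o_def has_vector_derivative_add_const has_vector_derivative_id)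

lemma abs_exp_minus_diff_le:
  fixes a b :: real
  assumes "a \<ge> 0" "b \<ge> 0"
  shows "\<bar>exp (- a) - exp (- b)\<bar> \<le> \<bar>a - b\<bar>"
proof -
  have *: "exp (- a) - exp (- b) \<le> b - a" if "a \<le> b" "a \<ge> 0" for a b :: real
  proof -
    have "exp (- a) - exp (- b) = exp (- a) * (1 - exp (a - b))" by (simp add: algebra_simps exp_add[symmetric])
    also have "\<dots> \<le> 1 * (b - a)"
    proof (rule mult_mono)
      show "1 - exp (a - b) \<le> b - a" using exp_ge_add_one_self[of "a - b"] by linarith
    qed (use that in auto)
    finally show ?thesis by simp
  qed
  show ?thesis
  proof (cases "a \<le> b")
    case True then show ?thesis using *[of a b] assms by simp
  next
    case False then show ?thesis using *[of b a] assms by simp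
  qed
qed

lemma test_functionD:
  fixes q :: "'a::euclidean_space \<Rightarrow> complex"
  assumes "test_function q"
  obtains r where "r \<ge> 0" "\<And>w. norm w > r \<Longrightarrow> q w = 0"
proof -
  have "bounded (support_in UNIV q)" using assms compact_imp_bounded by (auto simp: test_function_def)
  then obtain r where r: "\<And>w. w \<in> support_in UNIV q \<Longrightarrow> norm w \<le> r" using bounded_iff by metis
  have "q w = 0" if "norm w > max r 0" for w
  proof (rule ccontr)
    assume "q w \<noteq> 0"
    then have "w \<in> support_in UNIV q" unfolding support_in_def using closure_subset by fastforce
    then show False using r[of w] that by simp
  qed
  then show thesis using that[of "max r 0"] by auto
qed

lemma smooth_vanishing_lipschitz:
  fixes q :: "'a::euclidean_space \<Rightarrow> 'b::real_normed_vector"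
  assumes "smooth_on UNIV q" "\<And>w. norm w > r \<Longrightarrow> q w = 0"
  obtains L where "L \<ge> 0" "\<And>x y. norm (q x - q y) \<le> L * norm (x - y)"
proof -
  obtain L where L: "\<And>x y. x \<in> cball 0 (r + 1) \<Longrightarrow> y \<in> cball 0 (r + 1) \<Longrightarrow> norm (q x - q y) \<le> L * norm (x - y)"
    using smooth_on_lipschitz_cball[OF assms(1)] by metis
  obtain B where B: "\<And>x. norm (q x) \<le> B"
    using continuous_vanishing_bounded[OF smooth_on_continuous[OF assms(1)] assms(2)] by metis
  from global_lipschitz_of_vanishing[OF L assms(2) B] show thesis
    by (intro that[of "max (max L B) 0"]) auto
qed

section \<open>The damped evolution along the flow\<close>

locale damped_dynamics = hamiltonian_dynamics V \<phi> C0
  for V :: "real^'n::finite \<Rightarrow> real" and \<phi> :: "real \<Rightarrow> 'n phase \<Rightarrow> 'n phase" and C0 :: real +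
  fixes W :: "'n phase \<Rightarrow> real"
  assumes W_smooth: "smooth_on UNIV W" and W_nonneg: "\<And>w. W w \<ge> 0"
begin

definition action :: "real \<Rightarrow> 'n phase \<Rightarrow> real" where
  "action t w = signed_integral (\<lambda>s. W (\<phi> s w)) t"

lemma W_cont: "continuous_on S W" using smooth_on_continuous[OF W_smooth] continuous_on_subset by blast

lemma W_flow_cont: "continuous_on S (\<lambda>s. W (\<phi> s w))"
  by (rule continuous_on_compose2[OF W_cont flow_time_continuous subset_UNIV])

lemma action_deriv: "((\<lambda>t. action t w) has_vector_derivative W (\<phi> t w)) (at t)"
  unfolding action_def by (rule signed_integral_deriv[OF W_flow_cont])

lemma action_0 [simp]: "action 0 w = 0" by (simp add: action_def)

lemma action_eq: "t \<ge> 0 \<Longrightarrow> action t w = integral {0..t} (\<lambda>s. W (\<phi> s w))"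
  by (simp add: action_def signed_integral_nonneg)

lemma action_nonneg: "t \<ge> 0 \<Longrightarrow> action t w \<ge> 0"
  by (simp add: action_eq Henstock_Kurzweil_Integration.integral_nonneg integrable_continuous_real W_flow_cont W_nonneg)

text \<open>Both sides have the same derivative in \<open>t\<close> because of
  \<open>flow_add\<close>, and they agree at t = 0.\<close>

lemma action_add: "action (t + s) w = action t (\<phi> s w) + action s w"
proof -
  have "((\<lambda>t. action (t + s) w - action t (\<phi> s w)) has_vector_derivative
      W (\<phi> (u + s) w) - W (\<phi> u (\<phi> s w))) (at u)" for u
    by (intro has_vector_derivative_diff action_deriv has_vector_derivative_shift_time)
  then have "((\<lambda>t. action (t + s) w - action t (\<phi> s w)) has_real_derivative 0) (at u)" for u
    by (simp add: flow_add has_real_derivative_iff_has_vector_derivative)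
  then have "action (t + s) w - action t (\<phi> s w) = action (0 + s) w - action 0 (\<phi> s w)"
    using DERIV_isconst_all by blast
  then show ?thesis by simp
qed

lemma action_lipschitz:
  obtains L where "L \<ge> 0"
    "\<And>t u v. u \<in> cball 0 r \<Longrightarrow> v \<in> cball 0 r \<Longrightarrow> 0 \<le> t \<Longrightarrow> t \<le> T \<Longrightarrow> \<bar>action t u - action t v\<bar> \<le> L * norm (u - v)"
proof -
  obtain L1 where L1: "L1 \<ge> 0" "\<And>x y. x \<in> cball 0 (flow_radius r T) \<Longrightarrow> y \<in> cball 0 (flow_radius r T) \<Longrightarrow> norm (W x - W y) \<le> L1 * norm (x - y)"
    using smooth_on_lipschitz_cball[OF W_smooth] by metis
  obtain L2 where L2: "L2 \<ge> 0" "\<And>w w' t. w \<in> cball 0 r \<Longrightarrow> w' \<in> cball 0 r \<Longrightarrow> \<bar>t\<bar> \<le> T \<Longrightarrow> norm (\<phi> t w - \<phi> t w') \<le> L2 * norm (w - w')"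
    using flow_lipschitz by metis
  show thesis
  proof (rule that[of "L1 * L2 * \<bar>T\<bar>"])
    show "L1 * L2 * \<bar>T\<bar> \<ge> 0" using L1 L2 by simp
    fix t and u v :: "'n phase"
    assume uv: "u \<in> cball 0 r" "v \<in> cball 0 r" and t: "0 \<le> t" "t \<le> T"
    have "norm ((action t u - action t v) - (action 0 u - action 0 v)) \<le> L1 * (L2 * norm (u - v)) * t"
    proof (rule norm_diff_le_of_derivative[where D="\<lambda>s. W (\<phi> s u) - W (\<phi> s v)"])
      fix s assume s: "0 \<le> s" "s \<le> t"
      show "((\<lambda>t. action t u - action t v) has_vector_derivative W (\<phi> s u) - W (\<phi> s v)) (at s)"
        by (intro has_vector_derivative_diff action_deriv)
      show "norm (W (\<phi> s u) - W (\<phi> s v)) \<le> L1 * (L2 * norm (u - v))"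
        using s t uv L1 L2 by (intro order_trans[OF L1(2)] mult_left_mono L2(2) flow_in_cball) auto
    qed (use t in auto)
    also have "\<dots> \<le> L1 * (L2 * norm (u - v)) * \<bar>T\<bar>"
      using t L1 L2 by (intro mult_left_mono) auto
    finally show "\<bar>action t u - action t v\<bar> \<le> L1 * L2 * \<bar>T\<bar> * norm (u - v)" by (simp add: algebra_simps)
  qed
qed

text \<open>In semigroup notation, exp(t (H_p - W)) applied to \<open>q\<close>.\<close>

definition evolve :: "('n phase \<Rightarrow> complex) \<Rightarrow> real \<Rightarrow> 'n phase \<Rightarrow> complex" where
  "evolve q t w = q (\<phi> t w) * of_real (exp (- action t w))"

lemma evolve_0 [simp]: "evolve q 0 w = q w" by (simp add: evolve_def)

lemma norm_evolve_le: "t \<ge> 0 \<Longrightarrow> norm (q (\<phi> t w)) \<le> B \<Longrightarrow> norm (evolve q t w) \<le> B"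
  using action_nonneg[of t w] mult_mono[of "norm (q (\<phi> t w))" B "exp (- action t w)" 1]
    order_trans[OF norm_ge_zero]
  by (fastforce simp: evolve_def norm_mult)

text \<open>The product is split into a difference of values of \<open>q\<close> and a difference of
  damping factors. For nonnegative times the factor is at most 1, and it is 1-Lipschitz as a
  function of the action.\<close>

lemma evolve_lipschitz:
  assumes q: "\<And>x y. norm (q x - q y) \<le> Lq * norm (x - y)" "Lq \<ge> 0" "\<And>x. norm (q x) \<le> B"
  obtains L where "L \<ge> 0"
    "\<And>t u v. u \<in> cball 0 r \<Longrightarrow> v \<in> cball 0 r \<Longrightarrow> 0 \<le> t \<Longrightarrow> t \<le> T \<Longrightarrow> norm (evolve q t u - evolve q t v) \<le> L * norm (u - v)"
proof -
  obtain L1 where L1: "L1 \<ge> 0" "\<And>t u v. u \<in> cball 0 r \<Longrightarrow> v \<in> cball 0 r \<Longrightarrow> 0 \<le> t \<Longrightarrow> t \<le> T \<Longrightarrow> \<bar>action t u - action t v\<bar> \<le> L1 * norm (u - v)"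
    using action_lipschitz by metis
  obtain L2 where L2: "L2 \<ge> 0" "\<And>w w' t. w \<in> cball 0 r \<Longrightarrow> w' \<in> cball 0 r \<Longrightarrow> \<bar>t\<bar> \<le> T \<Longrightarrow> norm (\<phi> t w - \<phi> t w') \<le> L2 * norm (w - w')"
    using flow_lipschitz by metis
  have B: "B \<ge> 0" using order_trans[OF norm_ge_zero q(3)] .
  show thesis
  proof (rule that[of "Lq * L2 + B * L1"])
    show "Lq * L2 + B * L1 \<ge> 0" using q(2) L2(1) B L1(1) by simp
    fix t and u v :: "'n phase"
    assume uv: "u \<in> cball 0 r" "v \<in> cball 0 r" and t: "0 \<le> t" "t \<le> T"
    let ?e = "\<lambda>w. exp (- action t w)"
    have "evolve q t u - evolve q t v = (q (\<phi> t u) - q (\<phi> t v)) * of_real (?e u) + q (\<phi> t v) * of_real (?e u - ?e v)"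
      by (simp add: evolve_def algebra_simps)
    also have "norm \<dots> \<le> norm (q (\<phi> t u) - q (\<phi> t v)) * ?e u + norm (q (\<phi> t v)) * \<bar>?e u - ?e v\<bar>"
      by (rule order_trans[OF norm_triangle_ineq]) (simp add: norm_mult del: of_real_diff)
    also have "\<dots> \<le> (Lq * (L2 * norm (u - v))) * 1 + B * (L1 * norm (u - v))"
    proof (intro add_mono mult_mono)
      show "norm (q (\<phi> t u) - q (\<phi> t v)) \<le> Lq * (L2 * norm (u - v))"
        using q(2) uv t by (intro order_trans[OF q(1)] mult_left_mono L2(2)) auto
      show "?e u \<le> 1" using action_nonneg[OF t(1), of u] by simp
      have "\<bar>?e u - ?e v\<bar> \<le> \<bar>action t u - action t v\<bar>"
        by (rule abs_exp_minus_diff_le) (use action_nonneg[OF t(1)] in auto)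
      also have "\<dots> \<le> L1 * norm (u - v)" by (rule L1(2)[OF uv t])
      finally show "\<bar>?e u - ?e v\<bar> \<le> L1 * norm (u - v)" .
    qed (use q B L2(1) in auto)
    finally show "norm (evolve q t u - evolve q t v) \<le> (Lq * L2 + B * L1) * norm (u - v)"
      by (simp add: algebra_simps)
  qed
qed

lemma evolve_time_continuous:
  assumes "continuous_on UNIV q"
  shows "continuous_on S (\<lambda>t. evolve q t w)"
proof -
  have "continuous_on S (\<lambda>t. action t w)"
    using action_deriv has_vector_derivative_continuous by (intro continuous_at_imp_continuous_on) blast
  then show ?thesis
    unfolding evolve_def
    by (intro continuous_intros continuous_on_compose2[OF assms flow_time_continuous subset_UNIV])
qed

text \<open>Moving the starting point along its orbit amounts to a shift in time, up to a factor
  independent of \<open>t\<close>. This is what makes time integrals of \<open>evolve q t\<close>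
  differentiable along the flow.\<close>

lemma evolve_flow:
  "evolve q t (\<phi> s w) = of_real (exp (action s w)) * evolve q (t + s) w"
proof -
  have "exp (action s w) * exp (- action (t + s) w) = exp (- action t (\<phi> s w))"
    by (simp add: exp_add[symmetric] action_add)
  then have "of_real (exp (action s w)) * of_real (exp (- action (t + s) w)) = (of_real (exp (- action t (\<phi> s w))) :: complex)"
    by (metis of_real_mult)
  then show ?thesis
    by (simp only: evolve_def flow_add mult.left_commute[of "of_real (exp (action s w))"])
qed

text \<open>A point carried into the ball of radius \<open>r\<close> within time \<open>T\<close> is
  recovered by the reversed flow, hence started in the ball of radius
  \<open>flow_radius r T\<close>.\<close>

lemma evolve_vanishing:
  assumes "\<And>w. norm w > r \<Longrightarrow> q w = 0" "\<bar>t\<bar> \<le> T" "norm w > flow_radius r T"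
  shows "evolve q t w = 0"
proof -
  have "norm (\<phi> t w) > r"
  proof (rule ccontr)
    assume "\<not> norm (\<phi> t w) > r"
    then have "\<phi> (- t) (\<phi> t w) \<in> cball 0 (flow_radius r T)"
      using assms(2) by (intro flow_in_cball) auto
    then show False using assms(3) by (simp add: flow_add[symmetric])
  qed
  then show ?thesis using assms(1) by (simp add: evolve_def)
qed

lemma evolve_joint_continuous:
  assumes "test_function q"
  shows "continuous_on ({0..} \<times> UNIV) (\<lambda>z. evolve q (fst z) (snd z))"
proof (rule continuous_joint_of_lipschitz)
  have sm: "smooth_on UNIV q" using assms by (simp add: test_function_def)
  obtain r where r: "\<And>w. norm w > r \<Longrightarrow> q w = 0" using test_functionD[OF assms] by metis
  obtain L where L: "L \<ge> 0" "\<And>x y. norm (q x - q y) \<le> L * norm (x - y)"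
    using smooth_vanishing_lipschitz[OF sm r] by metis
  obtain B where B: "\<And>x. norm (q x) \<le> B"
    using continuous_vanishing_bounded[OF smooth_on_continuous[OF sm] r] by metis
  fix r T :: real
  obtain K where "\<And>t u v. u \<in> cball 0 r \<Longrightarrow> v \<in> cball 0 r \<Longrightarrow> 0 \<le> t \<Longrightarrow> t \<le> T \<Longrightarrow> norm (evolve q t u - evolve q t v) \<le> K * norm (u - v)"
    using evolve_lipschitz[OF L(2,1) B] by metis
  then show "\<exists>L. \<forall>t\<in>{0..}. \<bar>t\<bar> \<le> T \<longrightarrow> (\<forall>u\<in>cball 0 r. \<forall>v\<in>cball 0 r. norm (evolve q t u - evolve q t v) \<le> L * norm (u - v))"
    by (intro exI[of _ K]) auto
  show "continuous_on {0..} (\<lambda>t. evolve q t w)" for w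
    by (rule evolve_time_continuous[OF smooth_on_continuous[OF sm]])
qed

lemma evolve_continuous:
  assumes "test_function q" "t \<ge> 0"
  shows "continuous_on UNIV (evolve q t)"
proof -
  have "continuous_on UNIV (\<lambda>w. evolve q (fst (t, w)) (snd (t, w)))"
    by (rule continuous_on_compose2[OF evolve_joint_continuous[OF assms(1)]])
      (use assms(2) in \<open>auto intro!: continuous_intros\<close>)
  then show ?thesis by simp
qed

text \<open>The weak equation is tested with \<open>g = \<integral>\<^sub>0\<^sup>T evolve q t dt\<close>, whose derivative along the flow
  is \<open>W g + evolve q T - q\<close>.\<close>

lemma duhamel:
  fixes \<nu> m :: "'n phase measure"
  assumes nu: "sets \<nu> = sets borel" "\<And>K. compact K \<Longrightarrow> emeasure \<nu> K < \<infinity>"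
    and m: "sets m = sets borel" "finite_measure m"
    and weak: "\<And>q. test_function q \<Longrightarrow>
      (LINT w|\<nu>. - hamilton_field V q w + of_real (W w) * q w) = (LINT w|m. q w)"
    and q: "test_function q" and T: "T \<ge> 0"
  shows "(LINT w|\<nu>. q w) - (LINT w|\<nu>. evolve q T w) = (LINT t:{0..T}|lborel. LINT w|m. evolve q t w)"
    "set_integrable lborel {0..T} (\<lambda>t. LINT w|m. evolve q t w)"
proof -
  interpret m: finite_measure m by (rule m(2))
  have sm: "smooth_on UNIV q" using q by (simp add: test_function_def)
  have qc: "continuous_on UNIV q" by (rule smooth_on_continuous[OF sm])
  obtain r where r: "r \<ge> 0" "\<And>w. norm w > r \<Longrightarrow> q w = 0" using test_functionD[OF q] by metis
  obtain Lq where Lq: "Lq \<ge> 0" "\<And>x y. norm (q x - q y) \<le> Lq * norm (x - y)"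
    using smooth_vanishing_lipschitz[OF sm r(2)] by metis
  obtain B where B: "B \<ge> 0" "\<And>x. norm (q x) \<le> B"
    using continuous_vanishing_bounded[OF qc r(2)] by metis
  define \<rho> where "\<rho> = flow_radius r T"
  have ev_zero: "evolve q t w = 0" if "0 \<le> t" "t \<le> T" "norm w > \<rho>" for t w
    by (rule evolve_vanishing[OF r(2)]) (use that in \<open>auto simp: \<rho>_def\<close>)
  have ev_B: "norm (evolve q t w) \<le> B" if "0 \<le> t" for t w
    using norm_evolve_le[OF that B(2)] .
  obtain L where L: "L \<ge> 0" "\<And>t u v. u \<in> cball 0 (\<rho> + 1) \<Longrightarrow> v \<in> cball 0 (\<rho> + 1) \<Longrightarrow> 0 \<le> t \<Longrightarrow> t \<le> T \<Longrightarrow> norm (evolve q t u - evolve q t v) \<le> L * norm (u - v)"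
    using evolve_lipschitz[OF Lq(2,1) B(2)] by metis
  have ev_int: "(\<lambda>t. evolve q t w) integrable_on {a..b}" for w a b
    by (rule integrable_continuous_real[OF evolve_time_continuous[OF qc]])
  define g where "g w = integral {0..T} (\<lambda>t. evolve q t w)" for w
  have g_zero: "g w = 0" if "norm w > \<rho>" for w
    unfolding g_def using ev_zero[OF _ _ that] by (intro integral_unique has_integral_is_0) auto
  have g_B: "norm (g w) \<le> B * T" for w
    unfolding g_def
    using integral_bound[OF T evolve_time_continuous[OF qc], of w B] ev_B by auto
  have "norm (g u - g v) \<le> max (max (L * T) (B * T)) 0 * norm (u - v)" for u v
  proof (rule global_lipschitz_of_vanishing[OF _ g_zero g_B])
    fix u v :: "'n phase" assume uv: "u \<in> cball 0 (\<rho> + 1)" "v \<in> cball 0 (\<rho> + 1)"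
    have "g u - g v = integral {0..T} (\<lambda>t. evolve q t u - evolve q t v)"
      unfolding g_def by (rule Henstock_Kurzweil_Integration.integral_diff[symmetric]) (rule ev_int)+
    also have "norm \<dots> \<le> L * norm (u - v) * (T - 0)"
      by (rule integral_bound[OF T])
        (use L(2)[OF uv] in \<open>auto intro!: continuous_intros evolve_time_continuous[OF qc]\<close>)
    finally show "norm (g u - g v) \<le> L * T * norm (u - v)" by (simp add: algebra_simps)
  qed
  then obtain Lg where Lg: "Lg \<ge> 0" "\<And>u v. norm (g u - g v) \<le> Lg * norm (u - v)" by (metis max.cobounded2)
  have g_cont: "continuous_on S g" for S by (rule lipschitz_imp_continuous_on[OF Lg(2)])
  define G where "G w = of_real (W w) * g w + evolve q T w - q w" for w
  have G_cont: "continuous_on UNIV G"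
    unfolding G_def by (intro continuous_intros g_cont W_cont qc evolve_continuous[OF q T])
  have G_der: "((\<lambda>s. g (\<phi> s w)) has_vector_derivative G w) (at 0)" for w
  proof -
    define P where "P = signed_integral (\<lambda>t. evolve q t w)"
    have P: "(P has_vector_derivative evolve q t w) (at t)" for t
      unfolding P_def by (rule signed_integral_deriv[OF evolve_time_continuous[OF qc]])
    \<comment> \<open>By \<open>evolve_flow\<close> the window [0,T] of integration becomes
      [s, T + s]. Differentiating in s therefore produces only the two end values and the derivative
      of the exponential factor.\<close>
    have g_flow: "g (\<phi> s w) = of_real (exp (action s w)) * (P (T + s) - P s)" for s
    proof -
      have "((\<lambda>t. evolve q (t + s) w) has_integral P (T + s) - P (0 + s)) {0..T}"
        by (rule fundamental_theorem_of_calculus[OF T])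
          (auto intro!: has_vector_derivative_at_within has_vector_derivative_shift_time P)
      then have "integral {0..T} (\<lambda>t. of_real (exp (action s w)) * evolve q (t + s) w)
        = of_real (exp (action s w)) * (P (T + s) - P s)"
        by (simp add: integral_unique)
      then show ?thesis unfolding g_def evolve_flow .
    qed
    have e: "((\<lambda>s. complex_of_real (exp (action s w))) has_vector_derivative of_real (W w)) (at 0)"
    proof -
      have "((\<lambda>s. action s w) has_real_derivative W w) (at 0)"
        using action_deriv[of w 0] by (simp add: has_real_derivative_iff_has_vector_derivative)
      then have "((\<lambda>s. exp (action s w)) has_real_derivative W w) (at 0)"
        by (auto intro!: derivative_eq_intros)
      then show ?thesis
        by (intro has_vector_derivative_of_real) (simp add: has_real_derivative_iff_has_vector_derivative)
    qed
    have p: "((\<lambda>s. P (T + s) - P s) has_vector_derivative evolve q T w - q w) (at 0)"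
      using has_vector_derivative_diff[OF has_vector_derivative_shift_time[of P "evolve q T w" 0 T] P[of 0]] P[of T]
      by (simp add: add.commute)
    have "((\<lambda>s. of_real (exp (action s w)) * (P (T + s) - P s)) has_vector_derivative
       of_real (exp (action 0 w)) * (evolve q T w - q w) + of_real (W w) * (P (T + 0) - P 0)) (at 0)"
      by (rule has_vector_derivative_mult[OF e p])
    moreover have "P (T + 0) - P 0 = g w"
      unfolding P_def g_def by (simp add: signed_integral_nonneg[OF T])
    ultimately show ?thesis unfolding g_flow G_def by (simp add: algebra_simps)
  qed
  have "(LINT w|\<nu>. - G w + of_real (W w) * g w) = (LINT w|m. g w)"
    by (rule weak_transport_lipschitz[OF nu m W_cont weak Lg(2,1) g_zero G_cont G_der])
  moreover have "- G w + of_real (W w) * g w = q w - evolve q T w" for w by (simp add: G_def)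
  moreover have "integrable \<nu> q" by (rule continuous_vanishing_integrable[OF nu qc r(2)])
  moreover have "integrable \<nu> (evolve q T)"
    by (rule continuous_vanishing_integrable[OF nu evolve_continuous[OF q T], of \<rho>]) (use ev_zero T in auto)
  ultimately have main: "(LINT w|\<nu>. q w) - (LINT w|\<nu>. evolve q T w) = (LINT w|m. g w)" by simp
  \<comment> \<open>With the indicator inside, the time integral is one over all of
    \<open>lborel\<close>. On the product, \<open>f\<close> is bounded and lives on a set of finite
    measure, so Fubini applies.\<close>
  define f where "f t w = indicator {0..T} t *\<^sub>R evolve q t w" for t w
  interpret pair_sigma_finite lborel m
    by (simp add: pair_sigma_finite_def sigma_finite_lborel m.sigma_finite_measure_axioms)
  have sets_pair: "sets (lborel \<Otimes>\<^sub>M m) = sets (borel :: (real \<times> 'n phase) measure)"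
    by (simp add: borel_prod[symmetric] m(1) cong: sets_pair_measure_cong)
  have meas: "case_prod f \<in> borel_measurable (lborel \<Otimes>\<^sub>M m)"
  proof -
    have "(\<lambda>z. indicator ({0..T} \<times> UNIV) z *\<^sub>R evolve q (fst z) (snd z)) \<in> borel_measurable borel"
      by (rule borel_measurable_continuous_on_indicator)
        (auto intro: borel_closed closed_Times continuous_on_subset[OF evolve_joint_continuous[OF q]])
    moreover have "(\<lambda>z. indicator ({0..T} \<times> UNIV) z *\<^sub>R evolve q (fst z) (snd z)) = case_prod f"
      by (auto simp: f_def indicator_def fun_eq_iff)
    ultimately show ?thesis by (simp add: measurable_cong_sets[OF sets_pair refl])
  qed
  have int: "integrable (lborel \<Otimes>\<^sub>M m) (case_prod f)"
  proof (rule Bochner_Integration.integrable_bound[OF _ meas])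
    have "emeasure (lborel \<Otimes>\<^sub>M m) ({0..T} \<times> space m) = emeasure lborel {0..T} * emeasure m (space m)"
      by (rule m.emeasure_pair_measure_Times) auto
    also have "\<dots> < \<infinity>" using T m.emeasure_finite[of "space m"]
      by (auto simp: ennreal_mult_eq_top_iff less_top[symmetric])
    finally show "integrable (lborel \<Otimes>\<^sub>M m) (\<lambda>z. indicator ({0..T} \<times> space m) z * B)"
      by (intro integrable_mult_left integrable_real_indicator) auto
    show "AE z in lborel \<Otimes>\<^sub>M m. norm (case_prod f z) \<le> norm (indicator ({0..T} \<times> space m) z * B)"
      by (rule AE_I2) (auto simp: f_def indicator_def space_pair_measure ev_B B(1))
  qed
  have g_eq: "g w = (LINT t|lborel. f t w)" for w
  proof -
    have "set_integrable lborel {0..T} (\<lambda>t. evolve q t w)"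
      unfolding set_integrable_def
      by (rule borel_integrable_compact) (auto intro: evolve_time_continuous[OF qc])
    from set_borel_integral_eq_integral(2)[OF this] show ?thesis
      by (simp add: g_def f_def set_lebesgue_integral_def)
  qed
  have inner: "(LINT w|m. f t w) = indicator {0..T} t *\<^sub>R (LINT w|m. evolve q t w)" for t
    unfolding f_def by simp
  show "(LINT w|\<nu>. q w) - (LINT w|\<nu>. evolve q T w) = (LINT t:{0..T}|lborel. LINT w|m. evolve q t w)"
    unfolding main g_eq set_lebesgue_integral_def inner[symmetric]
    by (rule Fubini_integral[OF int])
  have "integrable lborel (\<lambda>t. LINT w|m. f t w)"
    using integrable_fst'[OF int] by simp
  then show "set_integrable lborel {0..T} (\<lambda>t. LINT w|m. evolve q t w)"
    unfolding set_integrable_def inner .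
qed

end


section \<open>Escape and damping\<close>

text \<open>Convexity is available only while f \<ge> c. Up to the first time at which f = c the
  parabola bounds f from below, and the parabola lies strictly above c; so no such time
  exists.\<close>

lemma convex_escape:
  fixes f f' f'' :: "real \<Rightarrow> real"
  assumes f: "\<And>t. (f has_real_derivative f' t) (at t)" "\<And>t. (f' has_real_derivative f'' t) (at t)"
    and convex: "\<And>t. f t \<ge> c \<Longrightarrow> f'' t \<ge> k"
    and above: "\<And>t. t \<ge> 0 \<Longrightarrow> f 0 + f' 0 * t + k / 2 * t\<^sup>2 > c"
    and t: "t \<ge> 0"
  shows "f t \<ge> f 0 + f' 0 * t + k / 2 * t\<^sup>2"
proof -
  have taylor: "f u \<ge> f 0 + f' 0 * u + k / 2 * u\<^sup>2"
    if u: "u \<ge> 0" and ge: "\<And>s. 0 \<le> s \<Longrightarrow> s \<le> u \<Longrightarrow> f s \<ge> c" for u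
  proof -
    have 1: "f' s - k * s \<ge> f' 0" if s: "0 \<le> s" "s \<le> u" for s
    proof -
      have "(\<lambda>s. f' s - k * s) 0 \<le> (\<lambda>s. f' s - k * s) s"
      proof (rule DERIV_nonneg_imp_nondecreasing[OF s(1)])
        fix x assume x: "0 \<le> x" "x \<le> s"
        have "((\<lambda>s. f' s - k * s) has_real_derivative f'' x - k) (at x)"
          by (rule derivative_eq_intros f(2) refl | simp)+
        then show "\<exists>y. ((\<lambda>s. f' s - k * s) has_real_derivative y) (at x) \<and> 0 \<le> y"
          using convex[OF ge[of x]] x s by auto
      qed
      then show ?thesis by simp
    qed
    have "(\<lambda>s. f s - f' 0 * s - k / 2 * s\<^sup>2) 0 \<le> (\<lambda>s. f s - f' 0 * s - k / 2 * s\<^sup>2) u"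
    proof (rule DERIV_nonneg_imp_nondecreasing[OF u])
      fix x assume x: "0 \<le> x" "x \<le> u"
      have "((\<lambda>s. f s - f' 0 * s - k / 2 * s\<^sup>2) has_real_derivative f' x - f' 0 - k * x) (at x)"
        by (rule derivative_eq_intros f(1) refl | simp)+
      then show "\<exists>y. ((\<lambda>s. f s - f' 0 * s - k / 2 * s\<^sup>2) has_real_derivative y) (at x) \<and> 0 \<le> y"
        using 1[OF x] by auto
    qed
    then show ?thesis by simp
  qed
  have cont: "continuous_on S f" for S
    using f(1) DERIV_isCont by (intro continuous_at_imp_continuous_on) blast
  have "f s \<ge> c" if s: "s \<ge> 0" for s
  proof (rule ccontr)
    assume low: "\<not> f s \<ge> c"
    \<comment> \<open>A compact set of times; its least element is the first time at which f has
      come down to c.\<close>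
    define Z where "Z = {x \<in> {0..s}. f x \<le> c}"
    have "closed Z" unfolding Z_def
      by (intro continuous_closed_preimage_constant continuous_on_closed_Collect_le cont continuous_on_const) auto
    then have "compact Z" unfolding Z_def
      by (metis (no_types, lifting) bounded_closed_interval bounded_subset compact_eq_bounded_closed mem_Collect_eq subsetI)
    moreover have "s \<in> Z" using low s by (simp add: Z_def)
    ultimately obtain u where u: "u \<in> Z" "\<And>x. x \<in> Z \<Longrightarrow> u \<le> x"
      using compact_attains_inf[of Z] by blast
    have u0: "0 \<le> u" "u \<le> s" "f u \<le> c" using u(1) by (auto simp: Z_def)
    have f0: "f 0 > c" using above[of 0] by simp
    have fu: "f u = c"
    proof (rule ccontr)
      assume "f u \<noteq> c"
      then have "f u < c" using u0 by simp
      then obtain x where x: "0 \<le> x" "x \<le> u" "f x = c"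
        using IVT2'[of f u c 0] f0 u0 cont by auto
      then have "u \<le> x" using u0 by (intro u(2)) (auto simp: Z_def)
      then show False using x \<open>f u < c\<close> by auto
    qed
    have "f x \<ge> c" if "0 \<le> x" "x \<le> u" for x
    proof (rule ccontr)
      assume a: "\<not> f x \<ge> c"
      then have "x \<in> Z" using that u0 by (auto simp: Z_def)
      then have "x = u" using u(2) that by force
      then show False using a fu by simp
    qed
    from taylor[OF u0(1) this] above[OF u0(1)] fu show False by simp
  qed
  then show ?thesis using taylor[OF t] by simp
qed

text \<open>Decay is assumed in the form in which it enters the second derivative of |x|^2 along the
  flow: smallness of the potential and of x . grad V.\<close>

locale scattering_dynamics = damped_dynamics V \<phi> C0 W
  for V :: "real^'n::finite \<Rightarrow> real" and \<phi> :: "real \<Rightarrow> 'n phase \<Rightarrow> 'n phase" and C0 :: real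
    and W :: "'n phase \<Rightarrow> real" +
  fixes E0 :: real
  assumes E0_pos: "E0 > 0"
    and V_decay: "\<And>\<epsilon>. \<epsilon> > 0 \<Longrightarrow> \<exists>R. \<forall>x. norm x \<ge> R \<longrightarrow> \<bar>V x\<bar> \<le> \<epsilon> \<and> \<bar>x \<bullet> gradient V x\<bar> \<le> \<epsilon>"
    and damping: "\<And>w. hamiltonian V w = E0 \<Longrightarrow>
      \<not> bounded (range (\<lambda>t. \<phi> t w)) \<or> (\<exists>t. W (\<phi> t w) > 0)"
begin

lemma norm_snd_le_of_energy:
  assumes "hamiltonian V w = E0"
  shows "norm (snd w) \<le> sqrt (E0 + C0)"
  using assms V_bound[of "fst w"] by (intro real_le_rsqrt) (auto simp: hamiltonian_def case_prod_unfold)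

lemma norm_fst_flow_deriv:
  "((\<lambda>t. (norm (fst (\<phi> t w)))\<^sup>2) has_real_derivative 4 * (fst (\<phi> t w) \<bullet> snd (\<phi> t w))) (at t)"
proof -
  have "((\<lambda>t. fst (\<phi> t w) \<bullet> fst (\<phi> t w)) has_derivative
    (\<lambda>h. fst (\<phi> t w) \<bullet> (h *\<^sub>R (2 *\<^sub>R snd (\<phi> t w))) + (h *\<^sub>R (2 *\<^sub>R snd (\<phi> t w))) \<bullet> fst (\<phi> t w))) (at t)"
    by (rule has_derivative_inner) (use fst_flow[of w t] in \<open>auto simp: has_vector_derivative_def\<close>)
  then show ?thesis
    unfolding power2_norm_eq_inner has_field_derivative_def
    by (rule has_derivative_eq_rhs) (auto simp: inner_commute)
qed

text \<open>Far out \<open>|x|\<^sup>2\<close> is convex along the flow, and a trajectory that is not too incoming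
  stays so far out that the convexity persists.\<close>

lemma escape:
  obtains R where "R > 0"
    "\<And>w t. hamiltonian V w = E0 \<Longrightarrow> norm (fst w) \<ge> R \<Longrightarrow>
      fst w \<bullet> snd w \<ge> - (1 / 3) * norm (fst w) * norm (snd w) \<Longrightarrow> t \<ge> 0 \<Longrightarrow>
      (norm (fst (\<phi> t w)))\<^sup>2 \<ge> (norm (fst w))\<^sup>2 + 4 * (fst w \<bullet> snd w) * t + 2 * E0 * t\<^sup>2 \<and>
      (norm (fst (\<phi> t w)))\<^sup>2 \<ge> (norm (fst w))\<^sup>2 / 2"
proof -
  \<comment> \<open>With both quantities at most E0/4, |\<xi>|^2 \<ge> 3/4 E0 far out, so the second
    derivative 8 |\<xi>|^2 - 4 x . grad V of |x|^2 is at least 5 E0, more than the 4 E0 used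
    below.\<close>
  obtain R1 where R1: "\<And>x. norm x \<ge> R1 \<Longrightarrow> \<bar>V x\<bar> \<le> E0 / 4 \<and> \<bar>x \<bullet> gradient V x\<bar> \<le> E0 / 4"
    using V_decay[of "E0 / 4"] E0_pos by auto
  define R0 where "R0 = max R1 1"
  have R0: "R0 > 0" "\<And>x. norm x \<ge> R0 \<Longrightarrow> \<bar>V x\<bar> \<le> E0 / 4" "\<And>x. norm x \<ge> R0 \<Longrightarrow> \<bar>x \<bullet> gradient V x\<bar> \<le> E0 / 4"
    using R1 by (auto simp: R0_def)
  show thesis
  \<comment> \<open>From twice the radius, half of |x|^2 is still at least 2 R0^2, so an orbit that
    keeps |x|^2 above half its initial value stays where the convexity bound holds.\<close>
  proof (rule that[of "2 * R0"])
    show "2 * R0 > 0" using R0(1) by simp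
    fix w :: "'n phase" and t :: real
    assume H: "hamiltonian V w = E0" and far: "norm (fst w) \<ge> 2 * R0"
      and dir: "fst w \<bullet> snd w \<ge> - (1 / 3) * norm (fst w) * norm (snd w)" and t: "t \<ge> 0"
    define f where "f t = (norm (fst (\<phi> t w)))\<^sup>2" for t
    define f' where "f' t = 4 * (fst (\<phi> t w) \<bullet> snd (\<phi> t w))" for t
    define f'' where "f'' t = 8 * (norm (snd (\<phi> t w)))\<^sup>2 - 4 * (fst (\<phi> t w) \<bullet> gradient V (fst (\<phi> t w)))" for t
    have d1: "(f has_real_derivative f' t) (at t)" for t
      unfolding f_def f'_def by (rule norm_fst_flow_deriv)
    have d2: "(f' has_real_derivative f'' t) (at t)" for t
    proof -
      have "((\<lambda>t. fst (\<phi> t w) \<bullet> snd (\<phi> t w)) has_derivative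
        (\<lambda>h. fst (\<phi> t w) \<bullet> (h *\<^sub>R - gradient V (fst (\<phi> t w))) + (h *\<^sub>R (2 *\<^sub>R snd (\<phi> t w))) \<bullet> snd (\<phi> t w))) (at t)"
        by (rule has_derivative_inner) (use fst_flow[of w t] snd_flow[of w t] in \<open>auto simp: has_vector_derivative_def\<close>)
      then have "((\<lambda>t. 4 * (fst (\<phi> t w) \<bullet> snd (\<phi> t w))) has_derivative
        (\<lambda>h. 4 * (fst (\<phi> t w) \<bullet> (h *\<^sub>R - gradient V (fst (\<phi> t w))) + (h *\<^sub>R (2 *\<^sub>R snd (\<phi> t w))) \<bullet> snd (\<phi> t w)))) (at t)"
        by (rule has_derivative_mult_right)
      then show ?thesis
        unfolding f'_def has_field_derivative_def
        by (rule has_derivative_eq_rhs) (auto simp: f''_def power2_norm_eq_inner algebra_simps)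
    qed
    have energy: "(norm (snd (\<phi> t w)))\<^sup>2 = E0 - V (fst (\<phi> t w))" for t
      using flow_energy[of t w] H by (simp add: hamiltonian_def case_prod_unfold)
    have convex: "f'' s \<ge> 4 * E0" if "f s \<ge> R0\<^sup>2" for s
    proof -
      have "norm (fst (\<phi> s w)) \<ge> R0"
        using that R0(1) by (auto simp: f_def intro: power2_le_imp_le)
      from R0(2,3)[OF this] E0_pos energy[of s] show ?thesis unfolding f''_def by linarith
    qed
    \<comment> \<open>With a = |x| and b = |\<xi>|, the angle condition and the square (a - 4/3 b
      s)^2 \<ge> 0 leave 8/9 b^2 s^2 to be absorbed. As b^2 \<le> 5/4 E0, this is at most 10/9 E0
      s^2, which the term 2 E0 s^2 covers.\<close>
    have above: "(norm (fst w))\<^sup>2 + 4 * (fst w \<bullet> snd w) * s + 2 * E0 * s\<^sup>2 \<ge> (norm (fst w))\<^sup>2 / 2" if s: "s \<ge> 0" for s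
    proof -
      let ?a = "norm (fst w)" and ?b = "norm (snd w)"
      have "\<bar>V (fst w)\<bar> \<le> E0 / 4" using far R0(1) by (intro R0(2)) auto
      then have "?b\<^sup>2 \<le> 5 / 4 * E0" using energy[of 0] by simp
      then have "?b\<^sup>2 * s\<^sup>2 \<le> 5 / 4 * E0 * s\<^sup>2" by (intro mult_right_mono) auto
      moreover have "4 * (fst w \<bullet> snd w) * s \<ge> 4 * (- (1 / 3) * ?a * ?b) * s"
        using dir s by (intro mult_right_mono) auto
      moreover have "0 \<le> 1 / 2 * (?a - 4 / 3 * (?b * s))\<^sup>2" by simp
      moreover have "0 \<le> ?b\<^sup>2 * s\<^sup>2" by simp
      ultimately show ?thesis by (simp add: power2_eq_square algebra_simps)
    qed
    have "f t \<ge> f 0 + f' 0 * t + (4 * E0) / 2 * t\<^sup>2"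
    proof (rule convex_escape[OF d1 d2 convex _ t])
      fix s :: real assume s: "s \<ge> 0"
      have "R0\<^sup>2 < (2 * R0)\<^sup>2 / 2" using R0(1) by (simp add: power2_eq_square)
      also have "\<dots> \<le> (norm (fst w))\<^sup>2 / 2" using far R0(1) by (intro divide_right_mono power_mono) auto
      also have "\<dots> \<le> f 0 + f' 0 * s + (4 * E0) / 2 * s\<^sup>2" using above[OF s] by (simp add: f_def f'_def)
      finally show "R0\<^sup>2 < f 0 + f' 0 * s + (4 * E0) / 2 * s\<^sup>2" .
    qed
    then have "f t \<ge> (norm (fst w))\<^sup>2 + 4 * (fst w \<bullet> snd w) * t + 2 * E0 * t\<^sup>2" by (simp add: f_def f'_def)
    then show "(norm (fst (\<phi> t w)))\<^sup>2 \<ge> (norm (fst w))\<^sup>2 + 4 * (fst w \<bullet> snd w) * t + 2 * E0 * t\<^sup>2 \<and>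
      (norm (fst (\<phi> t w)))\<^sup>2 \<ge> (norm (fst w))\<^sup>2 / 2"
      using above[OF t] by (simp add: f_def)
  qed
qed

text \<open>A far point of the orbit could be incoming. \<open>escape\<close> is therefore applied
  at the time of greatest distance up to it, where the radial velocity cannot be negative; from
  there on |x|^2 is at least 2 E0 s^2 after a further time s.\<close>

lemma forward_unbounded_escapes:
  assumes H: "hamiltonian V w = E0"
    and unb: "\<not> bounded ((\<lambda>t. fst (\<phi> t w)) ` {0..})"
  shows "\<forall>\<^sub>F t in at_top. norm (fst (\<phi> t w)) > r"
proof -
  obtain R where R: "R > 0" "\<And>w t. hamiltonian V w = E0 \<Longrightarrow> norm (fst w) \<ge> R \<Longrightarrow>
      fst w \<bullet> snd w \<ge> - (1 / 3) * norm (fst w) * norm (snd w) \<Longrightarrow> t \<ge> 0 \<Longrightarrow>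
      (norm (fst (\<phi> t w)))\<^sup>2 \<ge> (norm (fst w))\<^sup>2 + 4 * (fst w \<bullet> snd w) * t + 2 * E0 * t\<^sup>2 \<and>
      (norm (fst (\<phi> t w)))\<^sup>2 \<ge> (norm (fst w))\<^sup>2 / 2"
    using escape by metis
  define f where "f t = (norm (fst (\<phi> t w)))\<^sup>2" for t
  have d1: "(f has_real_derivative 4 * (fst (\<phi> t w) \<bullet> snd (\<phi> t w))) (at t)" for t
    unfolding f_def by (rule norm_fst_flow_deriv)
  have cont: "continuous_on S f" for S
    using d1 DERIV_isCont by (intro continuous_at_imp_continuous_on) blast
  obtain t1 where t1: "t1 \<ge> 0" "norm (fst (\<phi> t1 w)) > max (norm (fst w)) R"
  proof -
    have "\<not> (\<forall>x\<in>(\<lambda>t. fst (\<phi> t w)) ` {0..}. norm x \<le> max (norm (fst w)) R)"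
      using unb unfolding bounded_iff by blast
    then show ?thesis using that by (auto simp: not_le)
  qed
  obtain tm where tm: "tm \<in> {0..t1}" "\<And>s. s \<in> {0..t1} \<Longrightarrow> f s \<le> f tm"
    using continuous_attains_sup[OF compact_Icc _ cont, of 0 t1] t1(1) by auto
  have "f t1 \<le> f tm" using tm(2) t1(1) by auto
  then have n: "norm (fst (\<phi> t1 w)) \<le> norm (fst (\<phi> tm w))"
    by (auto simp: f_def intro: power2_le_imp_le)
  \<comment> \<open>Were the derivative of |x|^2 negative at \<open>tm\<close>, slightly earlier
    times would be farther out. Such times are available: \<open>tm\<close> is not 0, because at
    \<open>t1\<close> the orbit is farther out than at the start.\<close>
  have pos: "fst (\<phi> tm w) \<bullet> snd (\<phi> tm w) \<ge> 0"
  proof (rule ccontr)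
    assume "\<not> ?thesis"
    then obtain d where d: "d > 0" "\<And>h. 0 < h \<Longrightarrow> h < d \<Longrightarrow> f tm < f (tm - h)"
      using DERIV_neg_dec_left[OF d1[of tm]] by auto
    have "tm \<noteq> 0" using n t1(2) by auto
    then have "tm > 0" using tm(1) by auto
    define h where "h = min (d / 2) (tm / 2)"
    have "f tm < f (tm - h)" using d \<open>tm > 0\<close> by (intro d(2)) (auto simp: h_def)
    moreover have "f (tm - h) \<le> f tm" using tm(1) \<open>tm > 0\<close> d(1) by (intro tm(2)) (auto simp: h_def)
    ultimately show False by simp
  qed
  have Htm: "hamiltonian V (\<phi> tm w) = E0" using H flow_energy by simp
  have grow: "(norm (fst (\<phi> (s + tm) w)))\<^sup>2 \<ge> 2 * E0 * s\<^sup>2" if s: "s \<ge> 0" for s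
  proof -
    have "- (1 / 3) * norm (fst (\<phi> tm w)) * norm (snd (\<phi> tm w)) \<le> fst (\<phi> tm w) \<bullet> snd (\<phi> tm w)"
      by (rule order_trans[OF _ pos]) simp
    moreover have "R \<le> norm (fst (\<phi> tm w))" using n t1(2) by simp
    ultimately have "(norm (fst (\<phi> s (\<phi> tm w))))\<^sup>2 \<ge> (norm (fst (\<phi> tm w)))\<^sup>2 + 4 * (fst (\<phi> tm w) \<bullet> snd (\<phi> tm w)) * s + 2 * E0 * s\<^sup>2"
      using R(2)[OF Htm _ _ s] by blast
    moreover have "4 * (fst (\<phi> tm w) \<bullet> snd (\<phi> tm w)) * s \<ge> 0" using pos s by simp
    moreover have "(norm (fst (\<phi> tm w)))\<^sup>2 \<ge> 0" by simp
    ultimately show ?thesis unfolding flow_add by linarith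
  qed
  have "filterlim (\<lambda>t. 2 * E0 * (t - tm)\<^sup>2) at_top at_top"
    using E0_pos
    by (intro filterlim_tendsto_pos_mult_at_top[OF tendsto_const] filterlim_pow_at_top)
      (auto intro!: filterlim_at_top_add_at_top filterlim_tendsto_add_at_top[OF tendsto_const[of "- tm"] filterlim_ident, simplified add.commute[of "- tm"], simplified])
  then have "\<forall>\<^sub>F t in at_top. 2 * E0 * (t - tm)\<^sup>2 > (max r 0)\<^sup>2" by (simp add: filterlim_at_top_dense)
  then show ?thesis
    using eventually_ge_at_top[of tm]
  proof eventually_elim
    case (elim t)
    have "(norm (fst (\<phi> t w)))\<^sup>2 > (max r 0)\<^sup>2" using grow[of "t - tm"] elim by simp
    then have "norm (fst (\<phi> t w)) > max r 0" by (rule power2_less_imp_less) simp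
    then show ?case by simp
  qed
qed

lemma action_mono:
  assumes "s \<le> t"
  shows "action s w \<le> action t w"
proof (rule DERIV_nonneg_imp_nondecreasing[OF assms])
  fix x
  show "\<exists>y. ((\<lambda>t. action t w) has_real_derivative y) (at x) \<and> 0 \<le> y"
    using action_deriv[of w x] W_nonneg
    by (intro exI[of _ "W (\<phi> x w)"]) (simp add: has_real_derivative_iff_has_vector_derivative)
qed

lemma action_continuous:
  assumes "t \<ge> 0"
  shows "continuous_on UNIV (action t)"
proof (rule continuous_at_imp_continuous_on, rule ballI)
  fix w :: "'n phase"
  obtain L where L: "\<And>s u v. u \<in> cball 0 (norm w + 1) \<Longrightarrow> v \<in> cball 0 (norm w + 1) \<Longrightarrow> 0 \<le> s \<Longrightarrow> s \<le> t \<Longrightarrow> \<bar>action s u - action s v\<bar> \<le> L * norm (u - v)"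
    using action_lipschitz by metis
  have "continuous_on (cball 0 (norm w + 1)) (action t)"
    by (rule lipschitz_imp_continuous_on[of _ _ L]) (use L assms in auto)
  then show "isCont (action t) w"
    by (rule continuous_on_interior) (auto simp: interior_cball)
qed

text \<open>If the action stayed bounded, its increments over infinitely many non-overlapping unit
  intervals would tend to 0. By continuity they tend instead to the increment along the orbit of the
  limit point over a unit interval that starts where the damping is positive.\<close>

lemma forward_bounded_action:
  assumes H: "hamiltonian V w = E0"
    and bdd: "bounded ((\<lambda>t. fst (\<phi> t w)) ` {0..})"
  shows "filterlim (\<lambda>t. action t w) at_top at_top"
proof (rule ccontr)
  assume "\<not> ?thesis"
  then obtain B where B: "\<not> (\<forall>\<^sub>F t in at_top. action t w \<ge> B)" by (auto simp: filterlim_at_top)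
  have act_B: "action t w \<le> B" for t
  proof (rule ccontr)
    assume "\<not> action t w \<le> B"
    then have "\<forall>\<^sub>F s in at_top. action s w \<ge> B"
      using action_mono[of t _ w] by (intro eventually_mono[OF eventually_ge_at_top[of t]]) force
    then show False using B by simp
  qed
  obtain b where b: "\<And>t. t \<ge> 0 \<Longrightarrow> norm (fst (\<phi> t w)) \<le> b"
    using bdd unfolding bounded_iff by auto
  define K where "K = cball (0 :: 'n phase) (b + sqrt (E0 + C0))"
  have inK: "\<phi> t w \<in> K" if "t \<ge> 0" for t
  proof -
    have "norm (\<phi> t w) \<le> norm (fst (\<phi> t w)) + norm (snd (\<phi> t w))" by (metis norm_Pair_le prod.collapse)
    moreover have "norm (snd (\<phi> t w)) \<le> sqrt (E0 + C0)" using H flow_energy by (intro norm_snd_le_of_energy) simp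
    ultimately show ?thesis using b[OF that] by (simp add: K_def)
  qed
  have "seq_compact K" by (simp add: K_def compact_imp_seq_compact)
  then obtain l r where lr: "l \<in> K" "strict_mono (r :: nat \<Rightarrow> nat)" "((\<lambda>n. \<phi> (real n) w) \<circ> r) \<longlonglongrightarrow> l"
    using inK by (metis seq_compactE of_nat_0_le_iff)
  have lim: "(\<lambda>n. \<phi> (t + real (r n)) w) \<longlonglongrightarrow> \<phi> t l" for t
  proof -
    have "isCont (\<phi> t) l" using flow_continuous[of UNIV t] continuous_on_eq_continuous_at by blast
    then have "(\<lambda>n. \<phi> t (\<phi> (real (r n)) w)) \<longlonglongrightarrow> \<phi> t l"
      by (rule isCont_tendsto_compose) (use lr(3) in \<open>simp add: o_def\<close>)
    then show ?thesis by (simp add: flow_add)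
  qed
  have r_inf: "filterlim (\<lambda>n. real (r n)) at_top sequentially"
    using filterlim_compose[OF filterlim_real_sequentially filterlim_subseq[OF lr(2)]] by simp
  \<comment> \<open>Negative \<open>t\<close> are included, since \<open>t + real (r n)\<close> is
    eventually nonnegative; so the two-sided orbit of the limit point is bounded, as
    \<open>damping\<close> requires.\<close>
  have l_K: "\<phi> t l \<in> K" for t
  proof (rule Lim_in_closed_set[OF _ _ _ lim[of t]])
    show "closed K" by (simp add: K_def)
    have "\<forall>\<^sub>F n in sequentially. real (r n) \<ge> - t" using r_inf by (simp add: filterlim_at_top)
    then show "\<forall>\<^sub>F n in sequentially. \<phi> (t + real (r n)) w \<in> K"
      by eventually_elim (rule inK, simp)
  qed simp
  have Hl: "hamiltonian V l = E0"
  proof -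
    have "continuous_on UNIV V" by (rule smooth_on_continuous[OF smooth_V])
    then have "continuous_on UNIV (\<lambda>w :: 'n phase. V (fst w))"
      by (rule continuous_on_compose2) (auto intro: continuous_intros)
    then have "continuous_on UNIV (hamiltonian V)"
      unfolding hamiltonian_def case_prod_unfold by (intro continuous_intros)
    then have "isCont (hamiltonian V) l" using continuous_on_eq_continuous_at by blast
    then have "(\<lambda>n. hamiltonian V (\<phi> (0 + real (r n)) w)) \<longlonglongrightarrow> hamiltonian V (\<phi> 0 l)"
      using isCont_tendsto_compose lim[of 0] by fastforce
    then have "(\<lambda>n. E0) \<longlonglongrightarrow> hamiltonian V l" by (simp add: flow_energy H)
    then show ?thesis by (metis LIMSEQ_const_iff)
  qed
  have "bounded (range (\<lambda>t. \<phi> t l))"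
    by (rule bounded_subset[of K]) (use l_K in \<open>auto simp: K_def\<close>)
  then obtain t0 where t0: "W (\<phi> t0 l) > 0" using damping[OF Hl] by blast
  define u where "u = \<phi> t0 l"
  have pos: "action 1 u > 0"
  proof -
    have "((\<lambda>t. action t u) has_real_derivative W u) (at 0)"
      using action_deriv[of u 0] by (simp add: has_real_derivative_iff_has_vector_derivative)
    then obtain d where d: "d > 0" "\<And>h. 0 < h \<Longrightarrow> h < d \<Longrightarrow> action 0 u < action (0 + h) u"
      using DERIV_pos_inc_right t0 unfolding u_def by blast
    have "0 < action (min (d / 2) 1) u" using d(2)[of "min (d / 2) 1"] d(1) by auto
    also have "\<dots> \<le> action 1 u" by (rule action_mono) simp
    finally show ?thesis .
  qed
  \<comment> \<open>Values of the action at the start and the end of the unit intervals. As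
    \<open>r\<close> increases strictly through the naturals, consecutive intervals do not overlap,
    so the two sequences interlace and share a limit.\<close>
  define \<beta> where "\<beta> n = action (t0 + real (r n)) w" for n
  define \<gamma> where "\<gamma> n = action (1 + (t0 + real (r n))) w" for n
  have inc: "\<gamma> n \<le> \<beta> (Suc n)" for n
  proof -
    have "r n < r (Suc n)" using lr(2) by (simp add: strict_mono_Suc_iff)
    then have "1 + real (r n) \<le> real (r (Suc n))" by linarith
    then show ?thesis unfolding \<beta>_def \<gamma>_def by (intro action_mono) simp
  qed
  have le: "\<beta> n \<le> \<gamma> n" for n unfolding \<beta>_def \<gamma>_def by (rule action_mono) simp
  have "incseq \<beta>" using inc le order_trans by (intro incseq_SucI) blast
  then obtain \<Lambda> where \<Lambda>: "\<beta> \<longlonglongrightarrow> \<Lambda>" by (rule incseq_convergent[of \<beta> B]) (use act_B in \<open>auto simp: \<beta>_def\<close>)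
  have "\<gamma> \<longlonglongrightarrow> \<Lambda>"
    by (rule tendsto_sandwich[OF _ _ \<Lambda> LIMSEQ_Suc[OF \<Lambda>]]) (use inc le in auto)
  then have "(\<lambda>n. \<gamma> n - \<beta> n) \<longlonglongrightarrow> 0" using tendsto_diff[OF _ \<Lambda>] by force
  moreover have "\<gamma> n - \<beta> n = action 1 (\<phi> (t0 + real (r n)) w)" for n
    by (simp add: \<beta>_def \<gamma>_def action_add)
  moreover have "(\<lambda>n. action 1 (\<phi> (t0 + real (r n)) w)) \<longlonglongrightarrow> action 1 u"
    unfolding u_def
    by (rule isCont_tendsto_compose[OF _ lim])
      (use action_continuous[of 1] continuous_on_eq_continuous_at in auto)
  ultimately have "action 1 u = 0" using LIMSEQ_unique by auto
  then show False using pos by simp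
qed

lemma evolve_tendsto_0:
  assumes H: "hamiltonian V w = E0" and zero: "\<And>w. norm w > r \<Longrightarrow> q w = 0" and B: "\<And>w. norm (q w) \<le> B"
  shows "((\<lambda>t. evolve q t w) \<longlongrightarrow> 0) at_top"
proof (cases "bounded ((\<lambda>t. fst (\<phi> t w)) ` {0..})")
  case True
  have "((\<lambda>t. B * exp (- action t w)) \<longlongrightarrow> B * 0) at_top"
    by (intro tendsto_mult tendsto_const filterlim_compose[OF exp_at_bot]
        filterlim_compose[OF filterlim_uminus_at_bot_at_top] forward_bounded_action[OF H True])
  then have lim: "((\<lambda>t. B * exp (- action t w)) \<longlongrightarrow> 0) at_top" by simp
  show ?thesis
    by (rule Lim_null_comparison[OF _ lim])
      (auto simp: evolve_def norm_mult intro!: always_eventually mult_right_mono B)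
next
  case False
  have "\<forall>\<^sub>F t in at_top. evolve q t w = 0"
    using forward_unbounded_escapes[OF H False, of r]
  proof eventually_elim
    case (elim t)
    have "norm (fst (\<phi> t w)) \<le> norm (\<phi> t w)" by (metis norm_fst_le prod.collapse)
    then show ?case using elim zero by (simp add: evolve_def)
  qed
  then show ?thesis by (rule tendsto_eventually)
qed

lemma evolve_integral_tendsto_0:
  fixes \<nu> :: "'n phase measure"
  assumes nu: "sets \<nu> = sets borel" "\<And>K. compact K \<Longrightarrow> emeasure \<nu> K < \<infinity>"
    and energy: "AE w in \<nu>. hamiltonian V w = E0"
    and incoming: "AE w in \<nu>. \<not> (norm (fst w) > R \<and> fst w \<bullet> snd w < - (1 / 3) * norm (fst w) * norm (snd w))"
    and q: "test_function q"
  shows "((\<lambda>t. LINT w|\<nu>. evolve q t w) \<longlongrightarrow> 0) at_top"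
proof -
  have sm: "smooth_on UNIV q" using q by (simp add: test_function_def)
  obtain r where r: "r \<ge> 0" "\<And>w. norm w > r \<Longrightarrow> q w = 0" using test_functionD[OF q] by metis
  obtain B where B: "B \<ge> 0" "\<And>x. norm (q x) \<le> B"
    using continuous_vanishing_bounded[OF smooth_on_continuous[OF sm] r(2)] by metis
  obtain R2 where R2: "R2 > 0" "\<And>w t. hamiltonian V w = E0 \<Longrightarrow> norm (fst w) \<ge> R2 \<Longrightarrow>
      fst w \<bullet> snd w \<ge> - (1 / 3) * norm (fst w) * norm (snd w) \<Longrightarrow> t \<ge> 0 \<Longrightarrow>
      (norm (fst (\<phi> t w)))\<^sup>2 \<ge> (norm (fst w))\<^sup>2 + 4 * (fst w \<bullet> snd w) * t + 2 * E0 * t\<^sup>2 \<and>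
      (norm (fst (\<phi> t w)))\<^sup>2 \<ge> (norm (fst w))\<^sup>2 / 2"
    using escape by metis
  \<comment> \<open>Almost every point beyond \<open>R'\<close> is not incoming, so |x|^2 never
    drops below half its initial value, which exceeds 2 r^2; its orbit misses the ball outside which
    \<open>q\<close> vanishes.\<close>
  define R' where "R' = max (max R R2) (2 * r)"
  define K where "K = cball (0 :: 'n phase) (R' + sqrt (E0 + C0))"
  have bound: "norm (evolve q t w) \<le> indicator K w * B"
    if H: "hamiltonian V w = E0" and out: "\<not> (norm (fst w) > R \<and> fst w \<bullet> snd w < - (1 / 3) * norm (fst w) * norm (snd w))"
      and t: "t \<ge> 0" for w t
  proof (cases "norm (fst w) > R'")
    case True
    then have "(norm (fst (\<phi> t w)))\<^sup>2 \<ge> (norm (fst w))\<^sup>2 / 2"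
      using R2(2)[OF H _ _ t] out by (force simp: R'_def)
    moreover have "(norm (fst w))\<^sup>2 > (2 * r)\<^sup>2"
      using True r(1) by (intro power_strict_mono) (auto simp: R'_def)
    moreover have "(2 * r)\<^sup>2 = 4 * r\<^sup>2" by simp
    ultimately have "(norm (fst (\<phi> t w)))\<^sup>2 > r\<^sup>2" using zero_le_power2[of r] by linarith
    then have "norm (fst (\<phi> t w)) > r" by (rule power2_less_imp_less) simp
    moreover have "norm (fst (\<phi> t w)) \<le> norm (\<phi> t w)" by (metis norm_fst_le prod.collapse)
    ultimately have "evolve q t w = 0" using r(2) by (simp add: evolve_def)
    then show ?thesis using B(1) by simp
  next
    case False
    have "norm w \<le> norm (fst w) + norm (snd w)" by (metis norm_Pair_le prod.collapse)
    then have "w \<in> K" using False norm_snd_le_of_energy[OF H] by (simp add: K_def)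
    then show ?thesis using norm_evolve_le[OF t B(2)] by simp
  qed
  have meas: "evolve q t \<in> borel_measurable \<nu>" if "t \<ge> 0" for t
    unfolding measurable_cong_sets[OF nu(1) refl]
    by (rule borel_measurable_continuous_onI[OF evolve_continuous[OF q that]])
  \<comment> \<open>The convergence theorem asks for measurability at every real t;
    \<open>max t 0\<close> provides it and changes nothing for t \<ge> 0.\<close>
  have "((\<lambda>t. LINT w|\<nu>. evolve q (max t 0) w) \<longlongrightarrow> (LINT w|\<nu>. 0)) at_top"
  proof (rule integral_dominated_convergence_at_top[where w="\<lambda>w. indicator K w * B"])
    show "\<And>t. evolve q (max t 0) \<in> borel_measurable \<nu>" by (rule meas) simp
    show "(\<lambda>w. 0) \<in> borel_measurable \<nu>" by simp
    show "integrable \<nu> (\<lambda>w. indicator K w * B)"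
      using nu by (intro integrable_mult_left integrable_real_indicator) (auto simp: K_def)
    show "\<forall>\<^sub>F t in at_top. AE w in \<nu>. norm (evolve q (max t 0) w) \<le> indicator K w * B"
    proof (rule always_eventually, rule allI)
      fix t show "AE w in \<nu>. norm (evolve q (max t 0) w) \<le> indicator K w * B"
        using energy incoming by eventually_elim (rule bound, auto)
    qed
    show "AE w in \<nu>. ((\<lambda>t. evolve q (max t 0) w) \<longlongrightarrow> 0) at_top"
      using energy
    proof eventually_elim
      case (elim w)
      have "((\<lambda>t. evolve q t w) \<longlongrightarrow> 0) at_top"
        by (rule evolve_tendsto_0[OF elim r(2) B(2)])
      then show ?case
        by (rule Lim_transform_eventually)
          (rule eventually_mono[OF eventually_ge_at_top[of 0]], simp add: max_def)
    qed
  qed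
  then have "((\<lambda>t. LINT w|\<nu>. evolve q (max t 0) w) \<longlongrightarrow> 0) at_top" by simp
  then show ?thesis
    by (rule Lim_transform_eventually) (rule eventually_mono[OF eventually_ge_at_top[of 0]], simp add: max_def)
qed

text \<open>For complex \<open>q\<close>, convergence of the integrals over [0,n] does not give
  absolute convergence. A nonnegative bump dominating |q| has increasing time integrals with a
  finite limit, hence an integrable time density, and this density bounds the one of
  \<open>q\<close>.\<close>

lemma transport_solution:
  fixes \<nu> m :: "'n phase measure"
  assumes nu: "sets \<nu> = sets borel" "\<And>K. compact K \<Longrightarrow> emeasure \<nu> K < \<infinity>"
    and energy: "AE w in \<nu>. hamiltonian V w = E0"
    and incoming: "AE w in \<nu>. \<not> (norm (fst w) > R \<and> fst w \<bullet> snd w < - (1 / 3) * norm (fst w) * norm (snd w))"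
    and m: "sets m = sets borel" "finite_measure m"
    and weak: "\<And>q. test_function q \<Longrightarrow>
      (LINT w|\<nu>. - hamilton_field V q w + of_real (W w) * q w) = (LINT w|m. q w)"
    and q: "test_function q"
  shows "set_integrable lborel {0..} (\<lambda>t. LINT w|m. evolve q t w)"
    "(LINT w|\<nu>. q w) = (LINT t:{0..}|lborel. LINT w|m. evolve q t w)"
proof -
  interpret m: finite_measure m by (rule m(2))
  have sm: "smooth_on UNIV q" using q by (simp add: test_function_def)
  obtain r where r: "r \<ge> 0" "\<And>w. norm w > r \<Longrightarrow> q w = 0" using test_functionD[OF q] by metis
  obtain B where B: "B \<ge> 0" "\<And>x. norm (q x) \<le> B"
    using continuous_vanishing_bounded[OF smooth_on_continuous[OF sm] r(2)] by metis
  \<comment> \<open>On the ball of radius \<open>r\<close> the bump of radius r + 1 is at least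
    \<open>flat_exp 1\<close>, because (r + 1)^2 - |w|^2 \<ge> 1 there; the factor \<open>c\<close>
    raises it to at least \<open>B\<close>.\<close>
  define c where "c = B / flat_exp 1"
  have f1: "flat_exp 1 > 0" by (simp add: flat_exp_pos_iff)
  have c0: "c \<ge> 0" using B(1) f1 by (simp add: c_def)
  define b where "b w = complex_of_real (c * bump 0 (r + 1) w)" for w :: "'n phase"
  have b_test: "test_function b" unfolding b_def using r(1) by (intro test_function_bump) simp
  have q_le_b: "norm (q w) \<le> c * bump 0 (r + 1) w" for w
  proof (cases "norm w > r")
    case True
    then show ?thesis using r(2) c0 bump_nonneg[of 0 "r + 1" w] by simp
  next
    case False
    then have "(norm w)\<^sup>2 \<le> r\<^sup>2" by (intro power_mono) auto
    moreover have "(r + 1)\<^sup>2 = r\<^sup>2 + 2 * r + 1" by (simp add: power2_sum)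
    ultimately have "1 \<le> (r + 1)\<^sup>2 - (norm w)\<^sup>2" using r(1) by linarith
    then have "flat_exp 1 \<le> bump 0 (r + 1) w" by (simp add: bump_def flat_exp_mono)
    then have "c * flat_exp 1 \<le> c * bump 0 (r + 1) w" using c0 by (rule mult_left_mono)
    then show ?thesis using B(2)[of w] f1 by (simp add: c_def)
  qed
  define J where "J f t = (LINT w|m. evolve f t w)" for f t
  have limit: "(\<lambda>n. LINT t:{0..real n}|lborel. J f t) \<longlonglongrightarrow> (LINT w|\<nu>. f w)" if "test_function f" for f
  proof -
    have "(\<lambda>n. (LINT w|\<nu>. f w) - (LINT w|\<nu>. evolve f (real n) w)) \<longlonglongrightarrow> (LINT w|\<nu>. f w) - 0"
      by (intro tendsto_diff tendsto_const
          filterlim_compose[OF evolve_integral_tendsto_0[OF nu energy incoming that] filterlim_real_sequentially])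
    then show ?thesis
      unfolding J_def by (simp add: duhamel(1)[OF nu m weak that])
  qed
  have J_int: "set_integrable lborel {0..real n} (J f)" if "test_function f" for f n
    using duhamel(2)[OF nu m weak that, of "real n"] by (simp add: J_def[abs_def])
  have ev_int: "integrable m (evolve f t)" if f: "test_function f" and t: "t \<ge> 0" for f t
  proof -
    obtain r where r: "\<And>w. norm w > r \<Longrightarrow> f w = 0" using test_functionD[OF f] by metis
    have "smooth_on UNIV f" using f by (simp add: test_function_def)
    then have fc: "continuous_on UNIV f" by (rule smooth_on_continuous)
    obtain B where B: "\<And>x. norm (f x) \<le> B"
      using continuous_vanishing_bounded[OF fc r] by blast
    show ?thesis
    proof (rule m.integrable_const_bound)
      show "AE w in m. norm (evolve f t w) \<le> B" using norm_evolve_le[OF t B] by simp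
      show "evolve f t \<in> borel_measurable m"
        unfolding measurable_cong_sets[OF m(1) refl]
        by (rule borel_measurable_continuous_onI[OF evolve_continuous[OF f t]])
    qed
  qed
  define \<beta> where "\<beta> t = (LINT w|m. c * bump 0 (r + 1) (\<phi> t w) * exp (- action t w))" for t
  have Jb: "J b t = of_real (\<beta> t)" for t
    unfolding J_def \<beta>_def integral_complex_of_real[symmetric]
    by (intro Bochner_Integration.integral_cong refl) (simp add: evolve_def b_def)
  have \<beta>0: "\<beta> t \<ge> 0" for t
    unfolding \<beta>_def using c0 by (intro Bochner_Integration.integral_nonneg) (simp add: bump_nonneg)
  have J_le: "norm (J q t) \<le> \<beta> t" if t: "t \<ge> 0" for t
    unfolding J_def \<beta>_def
  proof (rule norm_integral_le[OF ev_int[OF q t]])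
    have "integrable m (\<lambda>w. Re (evolve b t w))" using ev_int[OF b_test t] by simp
    then show "integrable m (\<lambda>w. c * bump 0 (r + 1) (\<phi> t w) * exp (- action t w))"
      by (simp add: evolve_def b_def)
    show "norm (evolve q t w) \<le> c * bump 0 (r + 1) (\<phi> t w) * exp (- action t w)" for w
      using q_le_b[of "\<phi> t w"] by (simp add: evolve_def norm_mult mult_right_mono)
  qed
  define F where "F n t = indicator {0..real n} t *\<^sub>R \<beta> t" for n t
  have F_int: "integrable lborel (F n)" for n
  proof -
    have "integrable lborel (\<lambda>t. Re (indicator {0..real n} t *\<^sub>R J b t))"
      using J_int[OF b_test, of n] by (simp only: set_integrable_def integrable_Re)
    then show ?thesis by (simp add: Jb F_def[abs_def])
  qed
  have lim_ind: "(\<lambda>n. indicator {0..real n} t *\<^sub>R x) \<longlonglongrightarrow> indicator {0..} t *\<^sub>R x" for t and x :: "'z::real_normed_vector"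
  proof (rule tendsto_eventually)
    obtain N where "t \<le> real N" using real_arch_simple by blast
    then show "\<forall>\<^sub>F n in sequentially. indicator {0..real n} t *\<^sub>R x = indicator {0..} t *\<^sub>R x"
      by (intro eventually_mono[OF eventually_ge_at_top[of N]]) (auto simp: indicator_def)
  qed
  have \<beta>_int: "integrable lborel (\<lambda>t. indicator {0..} t *\<^sub>R \<beta> t)"
  proof (rule integrable_monotone_convergence[where f=F])
    show "integrable lborel (F n)" for n by (rule F_int)
    show "AE t in lborel. mono (\<lambda>n. F n t)"
      using \<beta>0 by (intro AE_I2 monoI) (auto simp: F_def indicator_def)
    show "AE t in lborel. (\<lambda>n. F n t) \<longlonglongrightarrow> indicator {0..} t *\<^sub>R \<beta> t"
      unfolding F_def by (intro AE_I2 lim_ind)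
    have "(\<lambda>n. Re (LINT t:{0..real n}|lborel. J b t)) \<longlonglongrightarrow> Re (LINT w|\<nu>. b w)"
      by (intro tendsto_Re limit b_test)
    moreover have "Re (LINT t:{0..real n}|lborel. J b t) = (LINT t|lborel. F n t)" for n
    proof -
      have "(LINT t:{0..real n}|lborel. J b t) = (LINT t|lborel. complex_of_real (F n t))"
        unfolding set_lebesgue_integral_def
        by (intro Bochner_Integration.integral_cong refl) (simp add: Jb F_def scaleR_conv_of_real)
      then show ?thesis by simp
    qed
    ultimately show "(\<lambda>n. LINT t|lborel. F n t) \<longlonglongrightarrow> Re (LINT w|\<nu>. b w)" by simp
    show "(\<lambda>t. indicator {0..} t *\<^sub>R \<beta> t) \<in> borel_measurable lborel"
    proof (rule borel_measurable_LIMSEQ_metric)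
      show "F n \<in> borel_measurable lborel" for n by (rule borel_measurable_integrable[OF F_int])
      show "(\<lambda>n. F n t) \<longlonglongrightarrow> indicator {0..} t *\<^sub>R \<beta> t" for t unfolding F_def by (rule lim_ind)
    qed
  qed
  have Jq_meas: "(\<lambda>t. indicator {0..} t *\<^sub>R J q t) \<in> borel_measurable lborel"
  proof (rule borel_measurable_LIMSEQ_metric)
    show "(\<lambda>t. indicator {0..real n} t *\<^sub>R J q t) \<in> borel_measurable lborel" for n
      using J_int[OF q, of n] by (simp only: set_integrable_def borel_measurable_integrable)
  qed (rule lim_ind)
  have Jq_int: "integrable lborel (\<lambda>t. indicator {0..} t *\<^sub>R J q t)"
    by (rule Bochner_Integration.integrable_bound[OF \<beta>_int Jq_meas])
      (use J_le \<beta>0 in \<open>auto simp: indicator_def\<close>)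
  then show "set_integrable lborel {0..} (\<lambda>t. LINT w|m. evolve q t w)"
    by (simp add: set_integrable_def J_def)
  have "(\<lambda>n. LINT t:{0..real n}|lborel. J q t) \<longlonglongrightarrow> (LINT t:{0..}|lborel. J q t)"
    unfolding set_lebesgue_integral_def
  proof (rule integral_dominated_convergence[OF Jq_meas _ \<beta>_int])
    show "(\<lambda>t. indicator {0..real n} t *\<^sub>R J q t) \<in> borel_measurable lborel" for n
      using J_int[OF q, of n] by (simp only: set_integrable_def borel_measurable_integrable)
    show "AE t in lborel. norm (indicator {0..real n} t *\<^sub>R J q t) \<le> indicator {0..} t *\<^sub>R \<beta> t" for n
      using J_le \<beta>0 by (intro AE_I2) (auto simp: indicator_def)
  qed (intro AE_I2 lim_ind)
  then show "(LINT w|\<nu>. q w) = (LINT t:{0..}|lborel. LINT w|m. evolve q t w)"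
    using limit[OF q] LIMSEQ_unique unfolding J_def by blast
qed

end


section \<open>Charts of the normal energy shell\<close>

lemma smooth_on_powr_comp:
  fixes h :: "'a::real_normed_vector \<Rightarrow> real"
  assumes "open S" "smooth_on S h" "\<And>x. x \<in> S \<Longrightarrow> h x > 0"
  shows "smooth_on S (\<lambda>x. h x powr r)"
  by (rule smooth_on_compose[OF assms(1) _ smooth_on_powr assms(2)]) (use assms(3) in auto)

lemma smooth_on_mult:
  fixes h k :: "'a::real_normed_vector \<Rightarrow> real"
  assumes "open S" "smooth_on S h" "smooth_on S k"
  shows "smooth_on S (\<lambda>x. h x * k x)"
  by (rule smooth_on_bilinear[OF assms(1) bounded_bilinear_mult assms(2,3)])

text \<open>\<open>powr\<close> is smooth on positive bases; writing 1/h as h (h^2)^(-1) admits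
  either sign of h.\<close>

lemma smooth_on_inverse:
  fixes h :: "'a::real_normed_vector \<Rightarrow> real"
  assumes "open S" "smooth_on S h" "\<And>x. x \<in> S \<Longrightarrow> h x \<noteq> 0"
  shows "smooth_on S (\<lambda>x. inverse (h x))"
proof (rule smooth_on_cong[OF assms(1)])
  show "smooth_on S (\<lambda>x. h x * (h x * h x) powr (- 1))"
    by (intro smooth_on_mult smooth_on_powr_comp assms(1,2)) (use assms(3) in \<open>force simp: zero_less_mult_iff\<close>)
  show "h x * (h x * h x) powr (- 1) = inverse (h x)" if "x \<in> S" for x
    using assms(3)[OF that] by (simp add: powr_minus field_simps zero_less_mult_iff linorder_neq_iff)
qed

lemma smooth_on_diff:
  assumes "open S" "smooth_on S f" "smooth_on S g"
  shows "smooth_on S (\<lambda>x. f x - g x)"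
  using smooth_on_add[OF assms(1,2) smooth_on_linear_comp[OF assms(1) bounded_linear_minus[OF bounded_linear_ident] assms(3)]]
  by simp

lemma smooth_on_inner:
  fixes f g :: "'a::real_normed_vector \<Rightarrow> 'b::real_inner"
  assumes "open S" "smooth_on S f" "smooth_on S g"
  shows "smooth_on S (\<lambda>x. f x \<bullet> g x)"
  by (rule smooth_on_bilinear[OF assms(1) bounded_bilinear_inner assms(2,3)])

lemma smooth_on_scaleR:
  fixes f :: "'a::real_normed_vector \<Rightarrow> real"
  assumes "open S" "smooth_on S f" "smooth_on S g"
  shows "smooth_on S (\<lambda>x. f x *\<^sub>R g x)"
  by (rule smooth_on_bilinear[OF assms(1) bounded_bilinear_scaleR assms(2,3)])

text \<open>For \<open>\<Gamma>\<close>, which is relatively open in \<open>\<Gamma>2\<close>: its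
  charts are those of \<open>\<Gamma>2\<close>, cut down to an open set.\<close>

lemma slice_chart_restrict:
  assumes c: "slice_chart d M U V f g B" and W: "open W"
  shows "slice_chart d (M \<inter> W) (U \<inter> W) (V \<inter> g -` W) f g B"
proof -
  note h = c[unfolded slice_chart_def homeomorphism_def]
  have gV: "g ` V = U" and fU: "f ` U = V" and gf: "\<And>x. x \<in> U \<Longrightarrow> g (f x) = x" and fg: "\<And>y. y \<in> V \<Longrightarrow> f (g y) = y"
    using h by auto
  have 1: "f ` (U \<inter> W) = V \<inter> g -` W"
  proof
    show "f ` (U \<inter> W) \<subseteq> V \<inter> g -` W" using fU gf by auto
    show "V \<inter> g -` W \<subseteq> f ` (U \<inter> W)"
    proof
      fix y assume "y \<in> V \<inter> g -` W"
      then have "y = f (g y)" "g y \<in> U \<inter> W" using fg gV by auto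
      then show "y \<in> f ` (U \<inter> W)" by blast
    qed
  qed
  have 2: "g ` (V \<inter> g -` W) = U \<inter> W" using gV by auto
  have 3: "f ` (M \<inter> W \<inter> (U \<inter> W)) = (V \<inter> g -` W) \<inter> span B"
  proof -
    have MU: "f ` (M \<inter> U) = V \<inter> span B" using h by blast
    show ?thesis
    proof
      show "f ` (M \<inter> W \<inter> (U \<inter> W)) \<subseteq> (V \<inter> g -` W) \<inter> span B" using MU gf by auto
      show "(V \<inter> g -` W) \<inter> span B \<subseteq> f ` (M \<inter> W \<inter> (U \<inter> W))"
      proof
        fix y assume y: "y \<in> (V \<inter> g -` W) \<inter> span B"
        then obtain x where x: "x \<in> M \<inter> U" "y = f x" using MU by blast
        then have "x \<in> W" using y gf by auto
        then show "y \<in> f ` (M \<inter> W \<inter> (U \<inter> W))" using x by blast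
      qed
    qed
  qed
  have op: "open (V \<inter> g -` W)"
    using h W by (intro continuous_open_preimage) auto
  show ?thesis
    unfolding slice_chart_def homeomorphism_def 1 2 3
    using h W op gf fg by (auto intro: continuous_on_subset smooth_on_subset open_Int)
qed

section \<open>Cotangent lift of a slice chart\<close>

locale straightening =
  fixes \<Gamma> U Y :: "(real^'n::finite) set" and f g :: "real^'n \<Rightarrow> real^'n" and B :: "(real^'n) set" and d :: nat
  assumes chart: "slice_chart d \<Gamma> U Y f g B"
begin

abbreviation "Df z \<equiv> frechet_derivative f (at z)"
abbreviation "Dg y \<equiv> frechet_derivative g (at y)"

lemma open_U: "open U" and open_Y: "open Y" and smooth_f: "smooth_on U f" and smooth_g: "smooth_on Y g"
  and B_Basis: "B \<subseteq> Basis" and card_B: "card B = d" and f_\<Gamma>: "f ` (\<Gamma> \<inter> U) = Y \<inter> span B"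
  using chart by (auto simp: slice_chart_def)

lemma f_in: "z \<in> U \<Longrightarrow> f z \<in> Y" and g_in: "y \<in> Y \<Longrightarrow> g y \<in> U"
  and gf: "z \<in> U \<Longrightarrow> g (f z) = z" and fg: "y \<in> Y \<Longrightarrow> f (g y) = y"
  using chart by (auto simp: slice_chart_def homeomorphism_def)

lemma in_span_B: "y \<in> span B \<longleftrightarrow> (\<forall>i\<in>Basis. i \<notin> B \<longrightarrow> y \<bullet> i = 0)"
  using span_substd_basis[OF B_Basis] by auto

lemma in_\<Gamma>_iff:
  assumes "z \<in> U"
  shows "z \<in> \<Gamma> \<longleftrightarrow> f z \<in> span B"
proof
  assume "z \<in> \<Gamma>"
  then show "f z \<in> span B" using f_\<Gamma> assms by blast
next
  assume "f z \<in> span B"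
  then have "f z \<in> f ` (\<Gamma> \<inter> U)" using f_\<Gamma> f_in[OF assms] by blast
  then obtain x where x: "x \<in> \<Gamma>" "x \<in> U" "f z = f x" by blast
  have "g (f z) = g (f x)" by (simp only: x(3))
  then have "z = x" by (simp only: gf[OF assms] gf[OF x(2)])
  then show "z \<in> \<Gamma>" using x(1) by simp
qed

lemma df: "z \<in> U \<Longrightarrow> (f has_derivative Df z) (at z)"
  by (rule smooth_on_has_derivative[OF smooth_f])

lemma dg: "y \<in> Y \<Longrightarrow> (g has_derivative Dg y) (at y)"
  by (rule smooth_on_has_derivative[OF smooth_g])

lemma linear_Df: "z \<in> U \<Longrightarrow> linear (Df z)" and linear_Dg: "y \<in> Y \<Longrightarrow> linear (Dg y)"
  using df dg has_derivative_linear by blast+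

lemma Dg_Df: assumes "z \<in> U" shows "Dg (f z) (Df z v) = v"
proof -
  have "((\<lambda>x. g (f x)) has_derivative (\<lambda>v. Dg (f z) (Df z v))) (at z)"
    by (rule has_derivative_compose[OF df[OF assms] dg[OF f_in[OF assms]]])
  moreover have "((\<lambda>x. g (f x)) has_derivative (\<lambda>v. v)) (at z)"
    by (rule has_derivative_transform_within_open[OF has_derivative_ident open_U assms]) (simp add: gf)
  ultimately show ?thesis using has_derivative_unique by (metis (no_types))
qed

lemma Df_Dg: assumes "y \<in> Y" shows "Df (g y) (Dg y v) = v"
proof -
  have "((\<lambda>x. f (g x)) has_derivative (\<lambda>v. Df (g y) (Dg y v))) (at y)"
    by (rule has_derivative_compose[OF dg[OF assms] df[OF g_in[OF assms]]])
  moreover have "((\<lambda>x. f (g x)) has_derivative (\<lambda>v. v)) (at y)"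
    by (rule has_derivative_transform_within_open[OF has_derivative_ident open_Y assms]) (simp add: fg)
  ultimately show ?thesis using has_derivative_unique by (metis (no_types))
qed

text \<open>\<open>pull z\<close> is the transpose of the derivative of \<open>g\<close> at \<open>f z\<close>: together with \<open>f\<close> it is
  the canonical lift of the chart to covectors. \<open>push\<close> is its inverse.\<close>

definition pull :: "real^'n \<Rightarrow> real^'n \<Rightarrow> real^'n" where
  "pull z \<xi> = (\<Sum>i\<in>Basis. (\<xi> \<bullet> Dg (f z) i) *\<^sub>R i)"

definition push :: "real^'n \<Rightarrow> real^'n \<Rightarrow> real^'n" where
  "push y \<theta> = (\<Sum>i\<in>Basis. (\<theta> \<bullet> Df (g y) i) *\<^sub>R i)"

lemma pull_inner: assumes "z \<in> U" shows "pull z \<xi> \<bullet> v = \<xi> \<bullet> Dg (f z) v"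
proof -
  note lin = linear_Dg[OF f_in[OF assms]]
  have "Dg (f z) v = (\<Sum>i\<in>Basis. (v \<bullet> i) *\<^sub>R Dg (f z) i)"
    by (subst euclidean_representation[symmetric, of v]) (simp only: linear_sum[OF lin] linear_scale[OF lin])
  then show ?thesis unfolding pull_def
    by (simp add: inner_sum_left inner_sum_right mult.commute inner_commute[of v])
qed

lemma push_inner: assumes "y \<in> Y" shows "push y \<theta> \<bullet> v = \<theta> \<bullet> Df (g y) v"
proof -
  note lin = linear_Df[OF g_in[OF assms]]
  have "Df (g y) v = (\<Sum>i\<in>Basis. (v \<bullet> i) *\<^sub>R Df (g y) i)"
    by (subst euclidean_representation[symmetric, of v]) (simp only: linear_sum[OF lin] linear_scale[OF lin])
  then show ?thesis unfolding push_def
    by (simp add: inner_sum_left inner_sum_right mult.commute inner_commute[of v])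
qed

lemma push_pull: assumes "z \<in> U" shows "push (f z) (pull z \<xi>) = \<xi>"
  by (rule vector_eq_rdot[THEN iffD1]) (simp add: push_inner pull_inner assms f_in gf Dg_Df)

lemma pull_push: assumes "y \<in> Y" shows "pull (g y) (push y \<theta>) = \<theta>"
  by (rule vector_eq_rdot[THEN iffD1]) (simp add: push_inner pull_inner assms g_in fg Df_Dg)

lemma push_scale: "push y (c *\<^sub>R \<theta>) = c *\<^sub>R push y \<theta>"
  by (simp add: push_def scaleR_sum_right)

lemma pull_scale: "pull z (c *\<^sub>R \<xi>) = c *\<^sub>R pull z \<xi>"
  by (simp add: pull_def scaleR_sum_right)

text \<open>Tangent vectors are velocities of curves. In one direction the curves are images under
  \<open>g\<close> of coordinate lines through \<open>f z\<close>. In the other, \<open>f\<close>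
  takes any curve in \<open>\<Gamma>\<close> near \<open>z\<close> into the span of
  \<open>B\<close>, so \<open>Df z v\<close> has no component outside \<open>B\<close>, while \<xi>
  . v equals the pairing of \<open>pull z \<xi>\<close> with \<open>Df z v\<close>.\<close>

lemma conormal_iff:
  assumes z: "z \<in> \<Gamma>" "z \<in> U"
  shows "(\<forall>v\<in>tangent_space \<Gamma> z. orthogonal \<xi> v) \<longleftrightarrow> (\<forall>b\<in>B. pull z \<xi> \<bullet> b = 0)"
proof
  assume L: "\<forall>v\<in>tangent_space \<Gamma> z. orthogonal \<xi> v"
  show "\<forall>b\<in>B. pull z \<xi> \<bullet> b = 0"
  proof
    fix b assume b: "b \<in> B"
    then have nb: "norm b = 1" using B_Basis by auto
    obtain e where e: "e > 0" "ball (f z) e \<subseteq> Y" using open_Y f_in[OF z(2)] open_contains_ball by blast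
    let ?l = "\<lambda>t::real. f z + t *\<^sub>R b" and ?I = "{- e<..<e}"
    have l: "?l t \<in> Y" if "t \<in> ?I" for t
      using that nb e(2) by (auto simp: dist_norm subset_iff)
    have sp: "?l t \<in> span B" for t
      using in_\<Gamma>_iff[OF z(2)] z(1) span_base[OF b] by (auto intro!: span_add span_scale)
    have "smooth_on ?I ?l"
      by (intro smooth_on_add smooth_on_const smooth_on_linear bounded_linear_scaleR_left open_greaterThanLessThan)
    then have "smooth_on ?I (\<lambda>t. g (?l t))"
      by (rule smooth_on_compose[OF open_greaterThanLessThan _ smooth_g, rotated]) (use l in auto)
    moreover have "(\<lambda>t. g (?l t)) ` ?I \<subseteq> \<Gamma>"
      using l sp in_\<Gamma>_iff g_in fg by auto
    moreover have "((\<lambda>t. g (?l t)) has_vector_derivative Dg (f z) b) (at 0)"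
    proof -
      have "(?l has_derivative (\<lambda>t. t *\<^sub>R b)) (at 0)" by (auto intro!: derivative_eq_intros)
      from has_derivative_compose[OF this, of g "Dg (f z)"] dg[OF f_in[OF z(2)]]
      show ?thesis by (simp add: has_vector_derivative_def linear_scale[OF linear_Dg[OF f_in[OF z(2)]]])
    qed
    moreover have "g (?l 0) = z" using gf z by simp
    ultimately have "Dg (f z) b \<in> tangent_space \<Gamma> z"
      unfolding tangent_space_def using e(1) by blast
    then show "pull z \<xi> \<bullet> b = 0" using L by (simp add: pull_inner z orthogonal_def)
  qed
next
  assume R: "\<forall>b\<in>B. pull z \<xi> \<bullet> b = 0"
  show "\<forall>v\<in>tangent_space \<Gamma> z. orthogonal \<xi> v"
  proof
    fix v assume "v \<in> tangent_space \<Gamma> z"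
    then obtain e \<gamma> where e: "e > 0" and \<gamma>: "smooth_on {- e<..<e} \<gamma>" "\<gamma> ` {- e<..<e} \<subseteq> \<Gamma>"
      "\<gamma> (0::real) = z" "(\<gamma> has_vector_derivative v) (at 0)"
      unfolding tangent_space_def by blast
    \<comment> \<open>The curve is known to stay in \<open>U\<close> only near time 0, which is
      enough for the derivative there.\<close>
    have op: "open ({- e<..<e} \<inter> \<gamma> -` U)"
      by (rule continuous_open_preimage[OF smooth_on_continuous[OF \<gamma>(1)] open_greaterThanLessThan open_U])
    have mem: "0 \<in> {- e<..<e} \<inter> \<gamma> -` U" using e z \<gamma>(3) by simp
    have comp: "((\<lambda>t. f (\<gamma> t)) has_derivative (\<lambda>h. Df z (h *\<^sub>R v))) (at 0)"
      by (rule has_derivative_compose[where g=f]) (use \<gamma>(3,4) df[OF z(2)] in \<open>auto simp: has_vector_derivative_def\<close>)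
    have zero: "Df z v \<bullet> i = 0" if i: "i \<in> Basis" "i \<notin> B" for i
    proof -
      have "((\<lambda>t. f (\<gamma> t) \<bullet> i) has_derivative (\<lambda>h. Df z (h *\<^sub>R v) \<bullet> i)) (at 0)"
        by (rule has_derivative_inner_left[OF comp])
      moreover have "((\<lambda>t. f (\<gamma> t) \<bullet> i) has_derivative (\<lambda>h. 0)) (at 0)"
      proof (rule has_derivative_transform_within_open[OF has_derivative_const[of 0]])
        show "open ({- e<..<e} \<inter> \<gamma> -` U)" "0 \<in> {- e<..<e} \<inter> \<gamma> -` U" by (fact op mem)+
        fix t assume t: "t \<in> {- e<..<e} \<inter> \<gamma> -` U"
        then have "\<gamma> t \<in> \<Gamma>" using \<gamma>(2) by blast
        then have "f (\<gamma> t) \<in> span B" using in_\<Gamma>_iff[of "\<gamma> t"] t by simp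
        then show "0 = f (\<gamma> t) \<bullet> i" using in_span_B i by auto
      qed
      ultimately have "(\<lambda>h. Df z (h *\<^sub>R v) \<bullet> i) = (\<lambda>h. 0)" by (rule has_derivative_unique)
      from fun_cong[OF this, of 1] show ?thesis by simp
    qed
    have "\<xi> \<bullet> v = pull z \<xi> \<bullet> Df z v" by (simp add: pull_inner z Dg_Df)
    also have "\<dots> = (\<Sum>i\<in>Basis. (pull z \<xi> \<bullet> i) * (Df z v \<bullet> i))" by (rule euclidean_inner)
    also have "\<dots> = 0" using R zero by (intro sum.neutral) auto
    finally show "orthogonal \<xi> v" by (simp add: orthogonal_def)
  qed
qed

lemma smooth_pull: "smooth_on (U \<times> UNIV) (\<lambda>w. pull (fst w) (snd w))"
proof -
  have op: "open (U \<times> (UNIV :: (real^'n) set))" using open_U by (simp add: open_Times)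
  have "smooth_on U (\<lambda>z. Dg (f z) i)" for i
    by (rule smooth_on_compose[OF open_U _ smooth_on_frechet[OF smooth_g] smooth_f]) (use f_in in auto)
  then have "smooth_on (U \<times> UNIV) (\<lambda>w :: 'n phase. Dg (f (fst w)) i)" for i
    by (rule smooth_on_compose[OF op, rotated]) (auto intro: smooth_on_linear op bounded_linear_fst)
  then show ?thesis unfolding pull_def
    by (intro smooth_on_sum[OF op] smooth_on_linear_comp[OF op bounded_linear_scaleR_left]
        smooth_on_inner[OF op] smooth_on_linear[OF op bounded_linear_snd])
qed

lemma smooth_push: "smooth_on (Y \<times> UNIV) (\<lambda>w. push (fst w) (snd w))"
proof -
  have op: "open (Y \<times> (UNIV :: (real^'n) set))" using open_Y by (simp add: open_Times)
  have "smooth_on Y (\<lambda>y. Df (g y) i)" for i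
    by (rule smooth_on_compose[OF open_Y _ smooth_on_frechet[OF smooth_f] smooth_g]) (use g_in in auto)
  then have "smooth_on (Y \<times> UNIV) (\<lambda>w :: 'n phase. Df (g (fst w)) i)" for i
    by (rule smooth_on_compose[OF op, rotated]) (auto intro: smooth_on_linear op bounded_linear_fst)
  then show ?thesis unfolding push_def
    by (intro smooth_on_sum[OF op] smooth_on_linear_comp[OF op bounded_linear_scaleR_left]
        smooth_on_inner[OF op] smooth_on_linear[OF op bounded_linear_snd])
qed

end

section \<open>A slice chart of the normal energy shell\<close>

locale shell_straightening = straightening \<Gamma> U Y f g B d
  for \<Gamma> U Y :: "(real^'n::finite) set" and f g B d +
  fixes V :: "real^'n \<Rightarrow> real" and E :: real and j :: "real^'n" and \<epsilon> :: real
  assumes smooth_V: "smooth_on UNIV V" and j: "j \<in> Basis" "j \<notin> B" and \<epsilon>: "\<epsilon> = 1 \<or> \<epsilon> = - 1"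
begin

text \<open>The sign \<epsilon> of the \<open>j\<close>-th entry is fixed because dividing by that
  entry identifies a covector with its negative.\<close>

definition dom :: "'n phase set" where
  "dom = {w. fst w \<in> U \<and> V (fst w) < E \<and> \<epsilon> * (pull (fst w) (snd w) \<bullet> j) > 0}"

text \<open>\<open>snd w \<bullet> j > - 1\<close> says that the energy |\<xi>|^2 / (E - V),
  recorded minus 1, is positive.\<close>

definition cod :: "'n phase set" where
  "cod = {w. fst w \<in> Y \<and> V (g (fst w)) < E \<and> snd w \<bullet> j > - 1}"

text \<open>Dividing the covector by its \<open>j\<close>-th coordinate makes that coordinate constant, so its
  slot can record the energy \<open>|\<xi>|\<^sup>2 / (E - V) - 1\<close> instead. On a ray of covectors the energy is
  quadratic, so the inverse is explicit and no inverse function theorem is needed.\<close>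

definition chart_map :: "'n phase \<Rightarrow> 'n phase" where
  "chart_map w = (f (fst w), inverse (pull (fst w) (snd w) \<bullet> j) *\<^sub>R pull (fst w) (snd w)
     + ((snd w \<bullet> snd w) * inverse (E - V (fst w)) - 2) *\<^sub>R j)"

text \<open>The slot \<open>j\<close> holds the energy. Putting 1 back there recovers the normalised
  covector, and \<open>push\<close> turns it into a multiple of the original \<xi>.\<close>

definition ray :: "'n phase \<Rightarrow> real^'n" where
  "ray w = push (fst w) (snd w + (1 - snd w \<bullet> j) *\<^sub>R j)"

text \<open>Length and direction of \<xi> are restored separately: the power 1/2 gives |\<xi>|, the
  power -1/2 gives the inverse norm of the ray, and \<epsilon> chooses between two opposite vectors.
  Roots are written with \<open>powr\<close> because its smoothness is at hand.\<close>

definition chart_inv :: "'n phase \<Rightarrow> 'n phase" where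
  "chart_inv w = (g (fst w),
     (\<epsilon> * (((1 + snd w \<bullet> j) * (E - V (g (fst w)))) powr (1 / 2) * (ray w \<bullet> ray w) powr (- (1 / 2)))) *\<^sub>R ray w)"

text \<open>The \<open>d\<close> positions along \<open>\<Gamma>\<close> and the n - d - 1 entries
  of the normalised conormal covector other than the \<open>j\<close>-th; on the shell all remaining
  coordinates vanish.\<close>

definition coords :: "'n phase set" where
  "coords = (\<lambda>b. (b, 0)) ` B \<union> (\<lambda>b. (0, b)) ` (Basis - B - {j})"

lemma jj [simp]: "j \<bullet> j = 1" using j by simp

lemma cont_V: "continuous_on S V" using smooth_on_continuous[OF smooth_V] continuous_on_subset by blast

lemma open_dom: "open dom"
proof -
  have op: "open (U \<times> (UNIV :: (real^'n) set))" using open_U by (simp add: open_Times)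
  let ?h = "\<lambda>w :: 'n phase. min (E - V (fst w)) (\<epsilon> * (pull (fst w) (snd w) \<bullet> j))"
  have "continuous_on (U \<times> UNIV) ?h"
    by (intro continuous_intros continuous_on_compose2[OF cont_V[of UNIV]] smooth_on_continuous[OF smooth_pull]) auto
  then have "open ((U \<times> UNIV) \<inter> ?h -` {0<..})"
    by (rule continuous_open_preimage[OF _ op open_greaterThan])
  moreover have "(U \<times> UNIV) \<inter> ?h -` {0<..} = dom" by (auto simp: dom_def)
  ultimately show ?thesis by simp
qed

lemma open_cod: "open cod"
proof -
  have op: "open (Y \<times> (UNIV :: (real^'n) set))" using open_Y by (simp add: open_Times)
  let ?h = "\<lambda>w :: 'n phase. min (E - V (g (fst w))) (snd w \<bullet> j + 1)"
  have "continuous_on (Y \<times> UNIV) ?h"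
    by (intro continuous_intros continuous_on_compose2[OF cont_V[of UNIV]]
        continuous_on_compose2[OF smooth_on_continuous[OF smooth_g]]) auto
  then have "open ((Y \<times> UNIV) \<inter> ?h -` {0<..})"
    by (rule continuous_open_preimage[OF _ op open_greaterThan])
  moreover have "(Y \<times> UNIV) \<inter> ?h -` {0<..} = cod" by (auto simp: cod_def)
  ultimately show ?thesis by simp
qed

lemma smooth_chart_map: "smooth_on dom chart_map"
proof -
  note op = open_dom
  have p: "smooth_on dom (\<lambda>w. pull (fst w) (snd w))"
    by (rule smooth_on_subset[OF smooth_pull]) (auto simp: dom_def)
  have v: "smooth_on dom (\<lambda>w. E - V (fst w))"
    by (intro smooth_on_diff op smooth_on_const smooth_on_comp_fst[OF op smooth_V]) simp
  show ?thesis unfolding chart_map_def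
    by (intro smooth_on_Pair op smooth_on_add smooth_on_scaleR smooth_on_inverse smooth_on_inner smooth_on_diff
        smooth_on_mult smooth_on_const p v smooth_on_linear[OF op bounded_linear_snd]
        smooth_on_comp_fst[OF op smooth_f])
      (auto simp: dom_def)
qed

text \<open>Its image under \<open>pull\<close> has \<open>j\<close>-th entry 1.\<close>

lemma ray_nonzero: "w \<in> cod \<Longrightarrow> ray w \<noteq> 0"
proof
  assume w: "w \<in> cod" and "ray w = 0"
  then have "pull (g (fst w)) 0 = snd w + (1 - snd w \<bullet> j) *\<^sub>R j"
    using pull_push[of "fst w" "snd w + (1 - snd w \<bullet> j) *\<^sub>R j"] by (simp add: ray_def cod_def)
  then have "(snd w + (1 - snd w \<bullet> j) *\<^sub>R j) \<bullet> j = 0" by (simp add: pull_def)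
  then show False by (simp add: inner_add_left)
qed

lemma smooth_chart_inv: "smooth_on cod chart_inv"
proof -
  note op = open_cod
  have snd: "smooth_on cod (\<lambda>w. snd w)" by (rule smooth_on_linear[OF op bounded_linear_snd])
  have gs: "smooth_on cod (\<lambda>w. g (fst w))"
    by (rule smooth_on_comp_fst[OF op smooth_g]) (auto simp: cod_def)
  have v: "smooth_on cod (\<lambda>w. E - V (g (fst w)))"
    by (intro smooth_on_diff op smooth_on_const smooth_on_compose[OF op _ smooth_V gs]) simp
  have r: "smooth_on cod ray"
  proof -
    have "smooth_on cod (\<lambda>w. (fst w, snd w + (1 - snd w \<bullet> j) *\<^sub>R j))"
      by (intro smooth_on_Pair op smooth_on_add smooth_on_scaleR smooth_on_diff smooth_on_inner smooth_on_const snd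
          smooth_on_linear[OF op bounded_linear_fst])
    from smooth_on_compose[OF op _ smooth_push this] show ?thesis
      unfolding ray_def by (simp add: cod_def image_subset_iff)
  qed
  show ?thesis unfolding chart_inv_def
    by (intro smooth_on_Pair op smooth_on_scaleR smooth_on_mult smooth_on_powr_comp smooth_on_inner smooth_on_add
        smooth_on_const gs snd v r)
      (auto simp: cod_def ray_nonzero)
qed

lemma chart_inv_map:
  assumes w: "w \<in> dom"
  shows "chart_inv (chart_map w) = w" "chart_map w \<in> cod"
proof -
  obtain z \<xi> where wz: "w = (z, \<xi>)" by (cases w)
  define \<eta> where "\<eta> = pull z \<xi>"
  define e where "e = E - V z"
  have z: "z \<in> U" and e: "e > 0" and hj: "\<epsilon> * (\<eta> \<bullet> j) > 0" using w by (auto simp: dom_def wz \<eta>_def e_def)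
  have hj0: "\<eta> \<bullet> j \<noteq> 0" using hj by auto
  have \<xi>0: "\<xi> \<noteq> 0" using hj0 by (auto simp: \<eta>_def pull_def)
  have \<xi>p: "\<xi> \<bullet> \<xi> > 0" using \<xi>0 by simp
  have cm: "chart_map w = (f z, inverse (\<eta> \<bullet> j) *\<^sub>R \<eta> + ((\<xi> \<bullet> \<xi>) * inverse e - 2) *\<^sub>R j)"
    by (simp add: chart_map_def wz \<eta>_def e_def)
  \<comment> \<open>The normalised covector contributes 1, so the summand -2 in
    \<open>chart_map\<close> leaves the energy minus 1, which is 0 exactly when |\<xi>|^2 = E -
    V.\<close>
  have uj: "snd (chart_map w) \<bullet> j = (\<xi> \<bullet> \<xi>) * inverse e - 1"
    using hj0 by (simp add: cm inner_add_left inner_diff_left)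
  show "chart_map w \<in> cod"
    using z e \<xi>p uj w by (simp add: cod_def) (simp add: cm f_in gf e_def)
  have "snd (chart_map w) + (1 - snd (chart_map w) \<bullet> j) *\<^sub>R j = inverse (\<eta> \<bullet> j) *\<^sub>R \<eta>"
    unfolding uj by (simp add: cm algebra_simps)
  then have ray: "ray (chart_map w) = inverse (\<eta> \<bullet> j) *\<^sub>R \<xi>"
    using push_pull[OF z, of \<xi>] by (simp add: ray_def push_scale \<eta>_def[symmetric]) (simp add: cm)
  have "((1 + snd (chart_map w) \<bullet> j) * (E - V (g (fst (chart_map w))))) powr (1 / 2) = norm \<xi>"
    using e z by (simp add: uj) (simp add: cm gf e_def[symmetric] powr_half_sqrt norm_eq_sqrt_inner)
  moreover have "(ray (chart_map w) \<bullet> ray (chart_map w)) powr (- (1 / 2)) = inverse (norm (inverse (\<eta> \<bullet> j) *\<^sub>R \<xi>))"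
    unfolding ray by (simp only: powr_minus powr_half_sqrt[OF inner_ge_zero] norm_eq_sqrt_inner)
  ultimately have "chart_inv (chart_map w) = (z, (\<epsilon> * (norm \<xi> * inverse (norm (inverse (\<eta> \<bullet> j) *\<^sub>R \<xi>)))) *\<^sub>R inverse (\<eta> \<bullet> j) *\<^sub>R \<xi>)"
    unfolding chart_inv_def ray using gf[OF z] by (simp add: cm)
  \<comment> \<open>The ray has norm |\<xi>| divided by the absolute value of
    \<open>\<eta> \<bullet> j\<close>, and \<epsilon> has the sign of
    \<open>\<eta> \<bullet> j\<close>.\<close>
  also have "\<epsilon> * (norm \<xi> * inverse (norm (inverse (\<eta> \<bullet> j) *\<^sub>R \<xi>))) = \<eta> \<bullet> j"
    using \<xi>0 hj \<epsilon> by (auto simp: abs_if)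
  finally show "chart_inv (chart_map w) = w" using hj0 by (simp add: wz)
qed

lemma chart_map_inv:
  assumes w: "w \<in> cod"
  shows "chart_map (chart_inv w) = w" "chart_inv w \<in> dom"
proof -
  obtain y u where wy: "w = (y, u)" by (cases w)
  define \<theta> where "\<theta> = u + (1 - u \<bullet> j) *\<^sub>R j"
  define a where "a = push y \<theta>"
  define e where "e = E - V (g y)"
  have y: "y \<in> Y" and e: "e > 0" and u: "u \<bullet> j > - 1" using w by (auto simp: cod_def wy e_def)
  have ra: "ray w = a" by (simp add: ray_def wy a_def \<theta>_def)
  have a0: "a \<noteq> 0" using ray_nonzero[OF w] ra by simp
  define \<kappa> where "\<kappa> = \<epsilon> * (sqrt ((1 + u \<bullet> j) * e) * inverse (norm a))"
  have "chart_inv w = (g y, (\<epsilon> * (((1 + u \<bullet> j) * e) powr (1 / 2) * (a \<bullet> a) powr (- (1 / 2)))) *\<^sub>R a)"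
    unfolding chart_inv_def ra by (simp add: wy e_def)
  moreover have "((1 + u \<bullet> j) * e) powr (1 / 2) = sqrt ((1 + u \<bullet> j) * e)"
    using e u by (intro powr_half_sqrt) simp
  moreover have "(a \<bullet> a) powr (- (1 / 2)) = inverse (norm a)"
    by (simp only: powr_minus powr_half_sqrt[OF inner_ge_zero] norm_eq_sqrt_inner)
  ultimately have ci: "chart_inv w = (g y, \<kappa> *\<^sub>R a)" by (simp add: \<kappa>_def)
  have \<kappa>: "\<epsilon> * \<kappa> > 0" using \<epsilon> e u a0 by (auto simp: \<kappa>_def)
  have pl: "pull (g y) (\<kappa> *\<^sub>R a) = \<kappa> *\<^sub>R \<theta>"
    by (simp add: pull_scale a_def pull_push[OF y])
  have \<theta>j: "\<theta> \<bullet> j = 1" by (simp add: \<theta>_def inner_add_left)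
  show "chart_inv w \<in> dom"
    using y e \<kappa> by (simp add: dom_def ci pl \<theta>j g_in e_def)
  have \<kappa>0: "\<kappa> \<noteq> 0" using \<kappa> by auto
  have "\<kappa>\<^sup>2 * (norm a)\<^sup>2 = (1 + u \<bullet> j) * e"
    using \<epsilon> a0 e u by (auto simp: \<kappa>_def power_mult_distrib power_inverse)
  then have "(\<kappa> *\<^sub>R a) \<bullet> (\<kappa> *\<^sub>R a) * inverse e = 1 + u \<bullet> j"
    using e by (simp add: power2_eq_square power2_norm_eq_inner[symmetric] field_simps)
  then have "chart_map (chart_inv w) = (y, \<theta> + (u \<bullet> j - 1) *\<^sub>R j)"
    using \<kappa>0 y by (simp add: chart_map_def ci pl \<theta>j fg e_def[symmetric] del: inner_scaleR_left inner_scaleR_right)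
       (simp add: \<theta>j)
  then show "chart_map (chart_inv w) = w" by (simp add: wy \<theta>_def algebra_simps)
qed

lemma coords_Basis: "coords \<subseteq> Basis"
  using B_Basis by (auto simp: coords_def Basis_prod_def)

lemma card_coords: "card coords = CARD('n) - 1"
proof -
  have finB: "finite B" by (rule finite_subset[OF B_Basis finite_Basis])
  have "card coords = card ((\<lambda>b. (b, 0 :: real^'n)) ` B) + card ((\<lambda>b. (0 :: real^'n, b)) ` (Basis - B - {j}))"
    unfolding coords_def using B_Basis by (intro card_Un_disjoint finite_imageI finB) auto
  also have "\<dots> = card B + card (Basis - B - {j})"
    by (simp add: card_image inj_on_def)
  also have "card (Basis - B - {j}) = CARD('n) - card B - 1"
    using j B_Basis finB by (simp add: card_Diff_subset)
  also have "card B + (CARD('n) - card B - 1) = CARD('n) - 1"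
  proof -
    have "card B < card (Basis :: (real^'n) set)" using j B_Basis by (intro psubset_card_mono) auto
    then show ?thesis by simp
  qed
  finally show ?thesis .
qed

text \<open>The coordinates outside \<open>coords\<close> form three groups, one for each condition:
  position entries outside \<open>B\<close> test membership in \<open>\<Gamma>\<close>, covector
  entries in \<open>B\<close> test conormality, and the entry \<open>j\<close> tests the
  energy.\<close>

lemma in_shell_iff:
  assumes w: "w \<in> dom"
  shows "w \<in> normal_shell V E \<Gamma> \<longleftrightarrow> chart_map w \<in> span coords"
proof -
  obtain z \<xi> where wz: "w = (z, \<xi>)" by (cases w)
  define \<eta> where "\<eta> = pull z \<xi>"
  define e where "e = E - V z"
  have z: "z \<in> U" and e: "e > 0" and hj0: "\<eta> \<bullet> j \<noteq> 0" using w by (auto simp: dom_def wz \<eta>_def e_def)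
  define u where "u = inverse (\<eta> \<bullet> j) *\<^sub>R \<eta> + ((\<xi> \<bullet> \<xi>) * inverse e - 2) *\<^sub>R j"
  have cm: "chart_map w = (f z, u)" by (simp add: chart_map_def wz \<eta>_def e_def u_def)
  have uj: "u \<bullet> j = (\<xi> \<bullet> \<xi>) * inverse e - 1"
    using hj0 by (simp add: u_def inner_add_left inner_diff_left)
  have ub: "u \<bullet> b = inverse (\<eta> \<bullet> j) * (\<eta> \<bullet> b)" if "b \<in> B" for b
  proof -
    have "b \<noteq> j" "b \<in> Basis" using that j B_Basis by auto
    then have "j \<bullet> b = 0" using j by (simp add: inner_not_same_Basis)
    then show ?thesis by (simp add: u_def inner_add_left)
  qed
  have "chart_map w \<in> span coords \<longleftrightarrow> (\<forall>i\<in>Basis. i \<notin> coords \<longrightarrow> (f z, u) \<bullet> i = 0)"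
    unfolding cm using span_substd_basis[OF coords_Basis] by auto
  also have "\<dots> \<longleftrightarrow> (\<forall>i\<in>Basis. i \<notin> B \<longrightarrow> f z \<bullet> i = 0) \<and> (\<forall>b\<in>Basis. b \<in> B \<or> b = j \<longrightarrow> u \<bullet> b = 0)"
    unfolding Basis_prod_def coords_def using nonzero_Basis by (auto 0 4 simp: ball_Un inner_prod_def)
  also have "\<dots> \<longleftrightarrow> f z \<in> span B \<and> (\<forall>b\<in>B. u \<bullet> b = 0) \<and> u \<bullet> j = 0"
    using in_span_B B_Basis j by auto
  also have "\<dots> \<longleftrightarrow> z \<in> \<Gamma> \<and> (\<forall>b\<in>B. \<eta> \<bullet> b = 0) \<and> \<xi> \<bullet> \<xi> = e"
    using in_\<Gamma>_iff[OF z] ub hj0 uj e by (auto simp: field_simps)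
  also have "\<dots> \<longleftrightarrow> w \<in> normal_shell V E \<Gamma>"
  proof -
    have "norm \<xi> = sqrt e \<longleftrightarrow> \<xi> \<bullet> \<xi> = e" using e by (simp add: norm_eq_sqrt_inner)
    then show ?thesis using conormal_iff[OF _ z, of \<xi>] by (auto simp: normal_shell_def wz \<eta>_def e_def)
  qed
  finally show ?thesis ..
qed

lemma slice_chart_shell:
  "slice_chart (CARD('n) - 1) (normal_shell V E \<Gamma>) dom cod chart_map chart_inv coords"
proof -
  have im: "chart_map ` dom = cod" "chart_inv ` cod = dom"
  proof -
    show "chart_map ` dom = cod"
    proof
      show "cod \<subseteq> chart_map ` dom"
        using chart_map_inv by (metis image_eqI subsetI)
    qed (use chart_inv_map in auto)
    show "chart_inv ` cod = dom"
    proof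
      show "dom \<subseteq> chart_inv ` cod"
        using chart_inv_map by (metis image_eqI subsetI)
    qed (use chart_map_inv in auto)
  qed
  have sl: "chart_map ` (normal_shell V E \<Gamma> \<inter> dom) = cod \<inter> span coords"
  proof
    show "chart_map ` (normal_shell V E \<Gamma> \<inter> dom) \<subseteq> cod \<inter> span coords"
      using in_shell_iff chart_inv_map by auto
    show "cod \<inter> span coords \<subseteq> chart_map ` (normal_shell V E \<Gamma> \<inter> dom)"
    proof
      fix w assume w: "w \<in> cod \<inter> span coords"
      then have "chart_inv w \<in> dom" "chart_map (chart_inv w) = w" using chart_map_inv by auto
      then show "w \<in> chart_map ` (normal_shell V E \<Gamma> \<inter> dom)"
        using in_shell_iff w by (metis IntD2 IntI image_eqI)
    qed
  qed
  show ?thesis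
    unfolding slice_chart_def homeomorphism_def im sl
    using open_dom open_cod smooth_chart_map smooth_chart_inv coords_Basis card_coords chart_inv_map chart_map_inv
    by (auto intro: smooth_on_continuous)
qed

end


section \<open>The source measure and the theorem\<close>

lemma norm_orth_proj_le:
  fixes W :: "'a::euclidean_space set"
  assumes "subspace W"
  shows "norm (orth_proj W x) \<le> norm x"
proof -
  obtain y z where yz: "y \<in> span W" "\<And>w. w \<in> span W \<Longrightarrow> orthogonal z w" "x = y + z"
    using orthogonal_subspace_decomp_exists[of W x] by metis
  have sp: "span W = W" using assms span_eq_iff by blast
  have "orth_proj W x = y"
    unfolding orth_proj_def
  proof (rule the_equality)
    show "y \<in> W \<and> (\<forall>w\<in>W. orthogonal (x - y) w)" using yz sp by auto
    fix y' assume y': "y' \<in> W \<and> (\<forall>w\<in>W. orthogonal (x - y') w)"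
    have "y - y' \<in> W" using y' yz(1) sp assms subspace_diff by auto
    then have "orthogonal (x - y') (y - y')" "orthogonal z (y - y')" using y' yz(2) sp by auto
    then have "(y - y') \<bullet> (y - y') = 0" by (simp add: orthogonal_def yz(3) inner_diff_left inner_add_left)
    then show "y' = y" by simp
  qed
  moreover have "(norm y)\<^sup>2 \<le> (norm x)\<^sup>2"
    using norm_add_Pythagorean[of y z] yz by (simp add: orthogonal_commute)
  ultimately show ?thesis using power2_le_imp_le[of "norm y" "norm x"] by simp
qed

text \<open>The orthogonal complement of any set is a subspace, so the projection is a contraction
  and each of the two terms is at most |u| |v|. The finiteness proof takes no other information from
  the metric.\<close>

lemma abs_shell_metric_le:
  fixes u v :: "'n::finite phase"
  shows "\<bar>shell_metric \<Gamma> w u v\<bar> \<le> 2 * (norm u * norm v)"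
proof -
  define W where "W = orthogonal_comp {x + r *\<^sub>R snd w |x r. x \<in> tangent_space \<Gamma> (fst w)}"
  have W: "subspace W" unfolding W_def by (rule subspace_orthogonal_comp)
  have eq: "shell_metric \<Gamma> w u v = fst u \<bullet> fst v + orth_proj W (snd u) \<bullet> orth_proj W (snd v)"
    by (simp add: shell_metric_def W_def case_prod_unfold Let_def)
  have n: "norm (fst a) \<le> norm a" "norm (snd a) \<le> norm a" for a :: "'n phase"
    by (metis norm_fst_le prod.collapse) (metis norm_snd_le prod.collapse)
  have "\<bar>fst u \<bullet> fst v\<bar> \<le> norm u * norm v"
    by (rule order_trans[OF Cauchy_Schwarz_ineq2]) (intro mult_mono n norm_ge_zero)
  moreover have "\<bar>orth_proj W (snd u) \<bullet> orth_proj W (snd v)\<bar> \<le> norm u * norm v"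
    by (rule order_trans[OF Cauchy_Schwarz_ineq2])
      (intro mult_mono order_trans[OF norm_orth_proj_le[OF W] n(2)] norm_ge_zero)
  ultimately show ?thesis unfolding eq by linarith
qed

text \<open>If the vector lies in the ball, each of its coordinates lies in [-R,R], and a finite
  product of bounded intervals has finite measure.\<close>

lemma coord_lebesgue_cball_finite:
  fixes B :: "'a::euclidean_space set"
  assumes "B \<subseteq> Basis"
  shows "emeasure (coord_lebesgue B) (cball 0 R) < \<infinity>"
proof -
  interpret product_sigma_finite "\<lambda>_::'a. lborel :: real measure"
    by (simp add: product_sigma_finite_def sigma_finite_lborel)
  have fin: "finite B" by (rule finite_subset[OF assms finite_Basis])
  let ?P = "PiM B (\<lambda>_. lborel :: real measure)" and ?s = "\<lambda>x. \<Sum>b\<in>B. x b *\<^sub>R b"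
  have meas: "?s \<in> measurable ?P borel" by measurable
  have sub: "?s -` cball 0 R \<inter> space ?P \<subseteq> PiE B (\<lambda>_. {- R..R})"
  proof
    fix x assume x: "x \<in> ?s -` cball 0 R \<inter> space ?P"
    have "x b \<in> {- R..R}" if b: "b \<in> B" for b
    proof -
      have "?s x \<bullet> b = (\<Sum>c\<in>B. if c = b then x b else 0)"
        unfolding inner_sum_left using assms b by (intro sum.cong refl) (auto simp: inner_Basis subset_iff)
      also have "\<dots> = x b" using b fin by simp
      finally have "\<bar>x b\<bar> \<le> norm (?s x)" using Basis_le_norm[of b "?s x"] assms b by auto
      then show ?thesis using x by auto
    qed
    then show "x \<in> PiE B (\<lambda>_. {- R..R})" using x by (auto simp: space_PiM PiE_def)
  qed
  have "emeasure (coord_lebesgue B) (cball 0 R) = emeasure ?P (?s -` cball 0 R \<inter> space ?P)"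
    unfolding coord_lebesgue_def by (rule emeasure_distr[OF meas]) simp
  also have "\<dots> \<le> emeasure ?P (PiE B (\<lambda>_. {- R..R}))"
    by (rule emeasure_mono[OF sub]) (simp add: fin sets_PiM_I_finite)
  also have "\<dots> = (\<Prod>b\<in>B. emeasure lborel {- R..R})"
    by (rule emeasure_PiM) (auto simp: fin)
  also have "\<dots> < \<infinity>"
    by (simp add: power_less_top_ennreal emeasure_lborel_Icc_eq)
  finally show ?thesis .
qed

lemma abs_det_on_le:
  assumes "finite B" "\<And>i k. i \<in> B \<Longrightarrow> k \<in> B \<Longrightarrow> \<bar>a i k\<bar> \<le> c"
  shows "\<bar>det_on B a\<bar> \<le> real (card {p. p permutes B}) * c ^ card B"
proof -
  have "\<bar>det_on B a\<bar> \<le> (\<Sum>p | p permutes B. \<bar>of_int (sign p) * (\<Prod>i\<in>B. a i (p i))\<bar>)"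
    unfolding det_on_def by (rule sum_abs)
  also have "\<dots> \<le> (\<Sum>p | p permutes B. c ^ card B)"
  proof (rule sum_mono)
    fix p assume p: "p \<in> {p. p permutes B}"
    have "\<bar>of_int (sign p) * (\<Prod>i\<in>B. a i (p i))\<bar> = (\<Prod>i\<in>B. \<bar>a i (p i)\<bar>)"
      by (simp add: abs_mult abs_prod sign_def)
    also have "\<dots> \<le> (\<Prod>i\<in>B. c)"
      using p permutes_in_image[of p B] by (intro prod_mono conjI assms(2)) auto
    finally show "\<bar>of_int (sign p) * (\<Prod>i\<in>B. a i (p i))\<bar> \<le> c ^ card B" by simp
  qed
  finally show ?thesis by simp
qed

text \<open>In the chart the measure has the square root of a Gram determinant as density on a
  bounded piece of coordinate space. Its entries are bounded on a compact ball because the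
  derivatives of \<open>g\<close> are continuous there.\<close>

lemma riemannian_measure_locally_finite:
  fixes M :: "'a::euclidean_space set"
  assumes mu: "riemannian_measure k M G \<mu>" and chart: "slice_chart k M U Y f g B"
    and G: "\<And>w u v. \<bar>G w u v\<bar> \<le> 2 * (norm u * norm v)" and w: "w \<in> U"
  obtains O' where "open O'" "w \<in> O'" "emeasure \<mu> (M \<inter> O') < \<infinity>"
proof -
  have h: "open U" "open Y" "continuous_on U f" "smooth_on Y g" "B \<subseteq> Basis" "f w \<in> Y"
    "\<And>y. y \<in> Y \<Longrightarrow> f (g y) = y"
    using chart w by (auto simp: slice_chart_def homeomorphism_def)
  obtain r where r: "r > 0" "cball (f w) r \<subseteq> Y" using h(2,6) open_contains_cball by blast
  define O' where "O' = U \<inter> f -` ball (f w) r"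
  have op: "open O'" unfolding O'_def by (rule continuous_open_preimage[OF h(3,1) open_ball])
  define X where "X = M \<inter> O'"
  have X: "X \<in> sets \<mu>"
    using mu op unfolding riemannian_measure_def X_def by (simp add: sets_restrict_space)
  have fin: "finite B" by (rule finite_subset[OF h(5) finite_Basis])
  have "\<exists>C\<ge>0. \<forall>y\<in>cball (f w) r. norm (frechet_derivative g (at y) b) \<le> C" for b
  proof -
    have "continuous_on (cball (f w) r) (\<lambda>y. frechet_derivative g (at y) b)"
      by (rule continuous_on_subset[OF smooth_on_continuous[OF smooth_on_frechet[OF h(4)]] r(2)])
    from continuous_on_compact_bounded[OF compact_cball this] show ?thesis by metis
  qed
  then obtain C where C: "\<And>b. C b \<ge> 0" "\<And>b y. y \<in> cball (f w) r \<Longrightarrow> norm (frechet_derivative g (at y) b) \<le> C b"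
    by metis
  define c where "c = 2 * ((\<Sum>b\<in>B. C b) * (\<Sum>b\<in>B. C b))"
  define D where "D = sqrt (real (card {p. p permutes B}) * c ^ card B)"
  let ?det = "\<lambda>y. det_on B (\<lambda>b b'. G (g y) (frechet_derivative g (at y) b) (frechet_derivative g (at y) b'))"
  have D: "sqrt (?det y) \<le> D" if y: "y \<in> cball (f w) r" for y
  proof -
    have nb: "norm (frechet_derivative g (at y) b) \<le> (\<Sum>b\<in>B. C b)" if "b \<in> B" for b
      by (rule order_trans[OF C(2)[OF y] member_le_sum[OF that]]) (use C(1) fin in auto)
    have "\<bar>?det y\<bar> \<le> real (card {p. p permutes B}) * c ^ card B"
    proof (rule abs_det_on_le[OF fin])
      fix b b' assume b: "b \<in> B" "b' \<in> B"
      have "norm (frechet_derivative g (at y) b) * norm (frechet_derivative g (at y) b') \<le> (\<Sum>b\<in>B. C b) * (\<Sum>b\<in>B. C b)"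
        using b C(1) by (intro mult_mono nb) (auto intro: sum_nonneg)
      then show "\<bar>G (g y) (frechet_derivative g (at y) b) (frechet_derivative g (at y) b')\<bar> \<le> c"
        unfolding c_def by (intro order_trans[OF G]) simp
    qed
    then show ?thesis unfolding D_def by (simp add: real_sqrt_le_mono)
  qed
  have "emeasure \<mu> X = (\<integral>\<^sup>+ y. indicator (Y \<inter> span B) y * indicator X (g y) * ennreal (sqrt (?det y)) \<partial>coord_lebesgue B)"
  proof -
    have "X \<subseteq> U" by (auto simp: X_def O'_def)
    then show ?thesis using mu[unfolded riemannian_measure_def, THEN conjunct2, rule_format, OF chart X] by blast
  qed
  also have "\<dots> \<le> (\<integral>\<^sup>+ y. ennreal D * indicator (cball 0 (norm (f w) + r)) y \<partial>coord_lebesgue B)"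
  proof (rule nn_integral_mono)
    fix y
    show "indicator (Y \<inter> span B) y * indicator X (g y) * ennreal (sqrt (?det y)) \<le> ennreal D * indicator (cball 0 (norm (f w) + r)) y"
    proof (cases "y \<in> Y \<and> g y \<in> X")
      case True
      then have y: "y \<in> cball (f w) r" using h(7) by (auto simp: X_def O'_def)
      then have "norm (y - f w) \<le> r" by (simp add: dist_norm norm_minus_commute)
      then have "y \<in> cball 0 (norm (f w) + r)" using norm_triangle_sub[of y "f w"] by simp
      then show ?thesis using D[OF y] by (auto simp: indicator_def intro: ennreal_leI)
    next
      case False
      then show ?thesis by (auto simp: indicator_def)
    qed
  qed
  also have "\<dots> = ennreal D * emeasure (coord_lebesgue B) (cball 0 (norm (f w) + r))"
    by (rule nn_integral_cmult_indicator) (simp add: coord_lebesgue_def)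
  also have "\<dots> < \<infinity>"
    using coord_lebesgue_cball_finite[OF h(5)] by (simp add: ennreal_mult_less_top)
  finally have "emeasure \<mu> X < \<infinity>" .
  then show thesis using that[of O'] op w r(1) by (auto simp: O'_def X_def)
qed

text \<open>If \<open>S\<close> is not integrable, its Fourier integral takes the junk value \<open>0\<close> everywhere.\<close>

lemma fourier_continuous:
  fixes S :: "'a::euclidean_space \<Rightarrow> complex"
  assumes "continuous_on UNIV S"
  shows "continuous_on X (fourier S)"
proof -
  have n1: "norm (exp (- \<i> * complex_of_real t)) = 1" for t
    using norm_exp_i_times[of "- t"] by simp
  have S: "S \<in> borel_measurable borel" by (rule borel_measurable_continuous_onI[OF assms])
  have m: "(\<lambda>y. exp (- \<i> * of_real (y \<bullet> \<xi>)) * S y) \<in> borel_measurable borel" for \<xi>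
    by (intro borel_measurable_continuous_onI continuous_intros assms)
  show ?thesis
  proof (cases "integrable lborel S")
    case True
    show ?thesis
      unfolding continuous_on_sequentially
    proof (intro allI ballI impI)
      fix x and \<xi> assume x: "\<xi> \<in> X" "(\<forall>n. x n \<in> X) \<and> x \<longlonglongrightarrow> \<xi>"
      show "(fourier S \<circ> x) \<longlonglongrightarrow> fourier S \<xi>"
        unfolding o_def fourier_def
      proof (rule integral_dominated_convergence[where w="\<lambda>y. norm (S y)"])
        show "AE y in lborel. (\<lambda>n. exp (- \<i> * of_real (y \<bullet> x n)) * S y) \<longlonglongrightarrow> exp (- \<i> * of_real (y \<bullet> \<xi>)) * S y"
          using x(2) by (intro AE_I2 tendsto_intros) auto
      qed (use True m in \<open>auto simp: norm_mult n1\<close>)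
    qed
  next
    case False
    have "fourier S \<xi> = 0" for \<xi>
      unfolding fourier_def
    proof (rule not_integrable_integral_eq, rule notI)
      assume "integrable lborel (\<lambda>y. exp (- \<i> * of_real (y \<bullet> \<xi>)) * S y)"
      then have "integrable lborel S"
        by (rule Bochner_Integration.integrable_bound) (use S in \<open>auto simp: norm_mult n1\<close>)
      then show False using False by simp
    qed
    then show ?thesis by simp
  qed
qed

lemma smooth_on_submanifold_continuous:
  assumes "smooth_on_submanifold M f"
  shows "continuous_on M f"
  unfolding continuous_on_eq_continuous_within
proof
  fix x assume x: "x \<in> M"
  obtain U F where U: "open U" "x \<in> U" "smooth_on U F" "\<forall>y\<in>M \<inter> U. f y = F y"
    using assms x unfolding smooth_on_submanifold_def by blast
  have "isCont F x" using smooth_on_continuous[OF U(3)] U(1,2) continuous_on_eq_continuous_at by blast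
  then have "continuous (at x within M) F" using continuous_at_imp_continuous_at_within by blast
  then have "(F \<longlongrightarrow> F x) (at x within M)" by (simp add: continuous_within)
  then have "(f \<longlongrightarrow> F x) (at x within M)"
  proof (rule Lim_transform_eventually)
    show "\<forall>\<^sub>F y in at x within M. F y = f y"
      unfolding eventually_at_topological using U(1,2,4) by (intro exI[of _ U]) auto
  qed
  then show "continuous (at x within M) f" using U(2,4) x by (simp add: continuous_within)
qed

text \<open>By Lindelof, countably many of the null neighbourhoods cover the set.\<close>

lemma emeasure_open_null:
  fixes O' :: "'a::second_countable_topology set"
  assumes "sets \<nu> = sets borel"
    and "\<And>w. w \<in> O' \<Longrightarrow> \<exists>U. open U \<and> w \<in> U \<and> U \<subseteq> O' \<and> emeasure \<nu> U = 0"
  shows "O' \<in> null_sets \<nu>"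
proof -
  define \<F> where "\<F> = {U. open U \<and> U \<subseteq> O' \<and> emeasure \<nu> U = 0}"
  obtain \<F>' where F: "\<F>' \<subseteq> \<F>" "countable \<F>'" "\<Union>\<F>' = \<Union>\<F>"
    using Lindelof[of \<F>] by (auto simp: \<F>_def)
  have "\<Union>\<F> = O'" using assms(2) by (fastforce simp: \<F>_def)
  moreover have "(\<Union>U\<in>\<F>'. U) \<in> null_sets \<nu>"
    by (rule null_sets_UN'[OF F(2)]) (use F(1) assms(1) in \<open>auto simp: \<F>_def null_sets_def\<close>)
  ultimately show ?thesis using F(3) by simp
qed

lemma compact_finite_neighbourhood:
  assumes K: "compact K" and mu: "sets \<mu> = sets (restrict_space borel M)"
    and loc: "\<And>w. w \<in> K \<Longrightarrow> \<exists>O'. open O' \<and> w \<in> O' \<and> emeasure \<mu> (M \<inter> O') < \<infinity>"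
  obtains P where "open P" "K \<subseteq> P" "emeasure \<mu> (M \<inter> P) < \<infinity>"
proof -
  have "\<forall>w\<in>K. \<exists>O'. open O' \<and> w \<in> O' \<and> emeasure \<mu> (M \<inter> O') < \<infinity>" by (intro ballI loc)
  then obtain T where T: "\<forall>w\<in>K. open (T w) \<and> w \<in> T w \<and> emeasure \<mu> (M \<inter> T w) < \<infinity>"
    by (rule bchoice[THEN exE])
  then have T1: "\<And>w. w \<in> K \<Longrightarrow> open (T w)" and T2: "\<And>w. w \<in> K \<Longrightarrow> w \<in> T w"
    and T3: "\<And>w. w \<in> K \<Longrightarrow> emeasure \<mu> (M \<inter> T w) < \<infinity>" by simp_all
  have "K \<subseteq> (\<Union>w\<in>K. T w)" using T2 by (intro subsetI UN_I)
  with K T1 obtain C where C: "C \<subseteq> K" "finite C" "K \<subseteq> (\<Union>c\<in>C. T c)"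
    by (rule compactE_image)
  have sets: "M \<inter> T c \<in> sets \<mu>" if "c \<in> C" for c
    unfolding mu sets_restrict_space using C(1) that by (intro imageI borel_open T1) blast
  have "emeasure \<mu> (M \<inter> (\<Union>c\<in>C. T c)) = emeasure \<mu> (\<Union>c\<in>C. M \<inter> T c)" by simp
  also have "\<dots> \<le> (\<Sum>c\<in>C. emeasure \<mu> (M \<inter> T c))"
    by (rule emeasure_subadditive_finite[OF C(2)]) (use sets in auto)
  also have "\<dots> < \<infinity>"
    using T3 C(1,2) by (auto simp: subset_iff)
  finally show thesis
    using C T1 by (intro that[of "\<Union>c\<in>C. T c"] open_UN) auto
qed

text \<open>Points off the shell are included because compactness will be used on a set containing
  all directions of \<xi>. If an entry of the lifted covector in \<open>B\<close> is nonzero, it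
  stays so on a neighbourhood that misses the shell; otherwise some entry \<open>j\<close> outside
  \<open>B\<close> is nonzero and the chart of the shell is available.\<close>

lemma shell_locally_finite:
  fixes \<Gamma> \<Gamma>2 :: "(real^'n::finite) set"
  assumes V: "smooth_on UNIV V" and \<Gamma>2: "submanifold d \<Gamma>2" and \<Gamma>: "openin (top_of_set \<Gamma>2) \<Gamma>"
    and mu: "riemannian_measure (CARD('n) - 1) (normal_shell V E \<Gamma>) (shell_metric \<Gamma>) \<mu>"
    and w: "fst w \<in> \<Gamma>" "V (fst w) < E" "snd w \<noteq> 0"
  shows "\<exists>O'. open O' \<and> w \<in> O' \<and> emeasure \<mu> (normal_shell V E \<Gamma> \<inter> O') < \<infinity>"
proof -
  obtain Q where Q: "open Q" "\<Gamma> = \<Gamma>2 \<inter> Q" using \<Gamma> by (auto simp: openin_open)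
  have "fst w \<in> \<Gamma>2" using w(1) Q by auto
  then obtain U0 Y0 f g B where c0: "fst w \<in> U0" "slice_chart d \<Gamma>2 U0 Y0 f g B"
    using \<Gamma>2 unfolding submanifold_def by metis
  define U Y where "U = U0 \<inter> Q" and "Y = Y0 \<inter> g -` Q"
  interpret straightening \<Gamma> U Y f g B d
    by unfold_locales (use slice_chart_restrict[OF c0(2) Q(1)] in \<open>simp add: Q(2) U_def Y_def\<close>)
  have wU: "fst w \<in> U" using c0(1) w(1) Q by (simp add: U_def)
  let ?p = "pull (fst w) (snd w)"
  show ?thesis
  proof (cases "\<forall>b\<in>B. ?p \<bullet> b = 0")
    case False
    then obtain b where b: "b \<in> B" "?p \<bullet> b \<noteq> 0" by blast
    have op: "open (U \<times> (UNIV :: (real^'n) set))" using open_U by (simp add: open_Times)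
    define O' where "O' = (U \<times> UNIV) \<inter> (\<lambda>w. pull (fst w) (snd w) \<bullet> b) -` (- {0})"
    have "open O'" unfolding O'_def
      by (rule continuous_open_preimage[OF _ op])
        (auto intro!: continuous_intros smooth_on_continuous[OF smooth_pull])
    moreover have "w \<in> O'" using wU b by (auto simp: O'_def mem_Times_iff)
    moreover have "normal_shell V E \<Gamma> \<inter> O' = {}"
      using conormal_iff b(1) by (fastforce simp: normal_shell_def O'_def)
    ultimately show ?thesis by (intro exI[of _ O']) simp
  next
    case True
    have "?p \<noteq> 0" using push_pull[OF wU, of "snd w"] w(3) by (auto simp: push_def)
    then obtain j where pj: "j \<in> Basis" "?p \<bullet> j \<noteq> 0" using euclidean_all_zero_iff by blast
    define \<epsilon> where "\<epsilon> = sgn (?p \<bullet> j)"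
    interpret shell_straightening \<Gamma> U Y f g B d V E j \<epsilon>
      by unfold_locales (use V pj True in \<open>auto simp: \<epsilon>_def sgn_if\<close>)
    have "\<epsilon> * (?p \<bullet> j) > 0" using pj(2) by (auto simp: \<epsilon>_def sgn_if)
    then have "w \<in> dom" using wU w(2) by (simp add: dom_def)
    from riemannian_measure_locally_finite[OF mu slice_chart_shell abs_shell_metric_le this]
    show ?thesis by metis
  qed
qed

text \<open>The density times the shell measure is pushed forward by the inclusion of the shell, so
  that the right side of the weak equation becomes integration against a finite Borel measure on the
  whole phase space. It is finite because the density is bounded and vanishes on the shell outside a
  compact set that has a neighbourhood of finite measure.\<close>

lemma source_measure:
  fixes \<Gamma> \<Gamma>2 :: "(real^'n::finite) set" and A S :: "real^'n \<Rightarrow> complex"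
  assumes V: "smooth_on UNIV V" and \<Gamma>2: "submanifold d \<Gamma>2" and \<Gamma>: "openin (top_of_set \<Gamma>2) \<Gamma>"
    and A: "smooth_on_submanifold \<Gamma>2 A" "compact (support_in \<Gamma>2 A)" "support_in \<Gamma>2 A \<subseteq> \<Gamma>"
    and S: "continuous_on UNIV S"
    and V_less: "\<And>z. z \<in> \<Gamma> \<Longrightarrow> V z < E"
    and mu: "riemannian_measure (CARD('n) - 1) (normal_shell V E \<Gamma>) (shell_metric \<Gamma>) \<mu>"
  obtains m where "sets m = sets borel" "finite_measure m"
    "\<And>h. h \<in> borel_measurable borel \<Longrightarrow>
      (LINT w|m. h w) = (LINT w|\<mu>. complex_of_real (source_density d A S w) * h w)"
    "\<And>h. h \<in> borel_measurable borel \<Longrightarrow> integrable m h \<Longrightarrow>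
      integrable \<mu> (\<lambda>w. complex_of_real (source_density d A S w) * h w)"
proof -
  let ?N = "normal_shell V E \<Gamma>" and ?c = "source_density d A S"
  have sets_mu: "sets \<mu> = sets (restrict_space borel ?N)" using mu by (simp add: riemannian_measure_def)
  have space_mu: "space \<mu> = ?N"
    using sets_eq_imp_space_eq[OF sets_mu] by (simp add: space_restrict_space)
  have \<Gamma>_sub: "\<Gamma> \<subseteq> \<Gamma>2" using \<Gamma> openin_imp_subset by blast
  have A_cont: "continuous_on \<Gamma>2 A" by (rule smooth_on_submanifold_continuous[OF A(1)])
  have V_cont: "continuous_on UNIV V" by (rule smooth_on_continuous[OF V])
  have c_cont: "continuous_on X ?c" if X: "\<And>w. w \<in> X \<Longrightarrow> fst w \<in> \<Gamma>2 \<and> snd w \<noteq> 0" for X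
  proof -
    have a: "continuous_on X (\<lambda>w. A (fst w))"
      by (rule continuous_on_compose2[OF A_cont continuous_on_fst[OF continuous_on_id]]) (use X in auto)
    have s: "continuous_on X (\<lambda>w. fourier S (snd w))"
      by (rule continuous_on_compose2[OF fourier_continuous[OF S, of UNIV] continuous_on_snd[OF continuous_on_id] subset_UNIV])
    show ?thesis
      unfolding source_density_def case_prod_unfold
      by (intro continuous_intros a s) (use X in auto)
  qed
  have N: "fst w \<in> \<Gamma> \<and> norm (snd w) = sqrt (E - V (fst w))" if "w \<in> ?N" for w
    using that by (auto simp: normal_shell_def)
  have N_snd: "snd w \<noteq> 0" if "w \<in> ?N" for w
    using N[OF that] V_less[of "fst w"] by auto
  have c_meas: "?c \<in> borel_measurable \<mu>"
    unfolding measurable_cong_sets[OF sets_mu refl]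
    by (rule borel_measurable_continuous_on_restrict[OF c_cont]) (use N N_snd \<Gamma>_sub in auto)
  have c_nonneg: "?c w \<ge> 0" for w
    by (cases w) (simp add: source_density_def)
  \<comment> \<open>All covectors of the right length over the support of \<open>A\<close>, conormal
    or not: this set is visibly compact, and on the shell the density vanishes outside it.\<close>
  define K where "K = {w :: 'n phase. fst w \<in> support_in \<Gamma>2 A \<and> norm (snd w) = sqrt (E - V (fst w))}"
  have K_pt: "fst w \<in> \<Gamma>" "V (fst w) < E" "snd w \<noteq> 0" if "w \<in> K" for w
  proof -
    show 1: "fst w \<in> \<Gamma>" using that A(3) by (auto simp: K_def)
    show 2: "V (fst w) < E" using 1 V_less by simp
    show "snd w \<noteq> 0" using that 2 by (auto simp: K_def)
  qed
  have "compact K"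
  proof -
    obtain b where b: "\<And>z. z \<in> support_in \<Gamma>2 A \<Longrightarrow> norm (V z) \<le> b"
      using continuous_on_compact_bounded[OF A(2) continuous_on_subset[OF V_cont subset_UNIV]] by metis
    have "closed {w :: 'n phase. norm (snd w) = sqrt (E - V (fst w))}"
      by (intro closed_Collect_eq continuous_intros continuous_on_compose2[OF V_cont]) auto
    then have "compact ((support_in \<Gamma>2 A \<times> cball 0 (sqrt (\<bar>E\<bar> + b))) \<inter> {w :: 'n phase. norm (snd w) = sqrt (E - V (fst w))})"
      by (intro compact_Int_closed compact_Times A(2) compact_cball)
    moreover have "(support_in \<Gamma>2 A \<times> cball 0 (sqrt (\<bar>E\<bar> + b))) \<inter> {w :: 'n phase. norm (snd w) = sqrt (E - V (fst w))} = K"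
      using b by (fastforce simp: K_def)
    ultimately show ?thesis by simp
  qed
  have "continuous_on K ?c" by (rule c_cont) (use K_pt \<Gamma>_sub in auto)
  then obtain C where C: "C \<ge> 0" "\<And>w. w \<in> K \<Longrightarrow> norm (?c w) \<le> C"
    using continuous_on_compact_bounded[OF \<open>compact K\<close>] by metis
  obtain P where P: "open P" "K \<subseteq> P" "emeasure \<mu> (?N \<inter> P) < \<infinity>"
    by (rule compact_finite_neighbourhood[OF \<open>compact K\<close> sets_mu])
      (use shell_locally_finite[OF V \<Gamma>2 \<Gamma> mu K_pt] in blast)+
  have c_bound: "?c w \<le> C * indicator (?N \<inter> P) w" if w: "w \<in> ?N" for w
  proof (cases "fst w \<in> support_in \<Gamma>2 A")
    case True
    then have "w \<in> K" using N[OF w] by (simp add: K_def)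
    then show ?thesis using C(2)[of w] P(2) w by auto
  next
    case False
    moreover have "fst w \<in> \<Gamma>2" using N[OF w] \<Gamma>_sub by auto
    ultimately have "A (fst w) = 0"
      unfolding support_in_def using closure_subset[of "{x \<in> \<Gamma>2. A x \<noteq> 0}"] by blast
    then have "?c w = 0" by (cases w) (simp add: source_density_def)
    then show ?thesis using C(1) by simp
  qed
  have NP: "?N \<inter> P \<in> sets \<mu>" using P(1) sets_mu by (simp add: sets_restrict_space)
  have c_fin: "(\<integral>\<^sup>+w. ennreal (?c w) \<partial>\<mu>) < \<infinity>"
  proof -
    have "(\<integral>\<^sup>+w. ennreal (?c w) \<partial>\<mu>) \<le> (\<integral>\<^sup>+w. ennreal C * indicator (?N \<inter> P) w \<partial>\<mu>)"
    proof (rule nn_integral_mono)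
      fix w assume "w \<in> space \<mu>"
      then have "?c w \<le> C * indicator (?N \<inter> P) w" using c_bound space_mu by simp
      then show "ennreal (?c w) \<le> ennreal C * indicator (?N \<inter> P) w"
        using C(1) by (auto simp: indicator_def ennreal_leI ennreal_neg split: if_splits)
    qed
    also have "\<dots> = ennreal C * emeasure \<mu> (?N \<inter> P)" by (rule nn_integral_cmult_indicator[OF NP])
    also have "\<dots> < \<infinity>" using P(3) by (simp add: ennreal_mult_less_top)
    finally show ?thesis .
  qed
  define D where "D = density \<mu> (\<lambda>w. ennreal (?c w))"
  have idm: "(\<lambda>w. w) \<in> measurable D borel"
    unfolding D_def by (simp add: measurable_cong_sets[OF sets_mu refl] measurable_restrict_space1)
  define m where "m = distr D borel (\<lambda>w. w)"
  have h_mu: "h \<in> borel_measurable \<mu>" if "h \<in> borel_measurable borel" for h :: "'n phase \<Rightarrow> complex"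
    using that by (simp add: measurable_cong_sets[OF sets_mu refl] measurable_restrict_space1)
  show thesis
  proof (rule that[of m])
    show "sets m = sets borel" by (simp add: m_def)
    show "finite_measure m"
    proof (rule finite_measureI)
      have "emeasure m (space m) = emeasure D (space D)"
        unfolding m_def using idm by (simp add: emeasure_distr)
      also have "\<dots> = (\<integral>\<^sup>+w. ennreal (?c w) \<partial>\<mu>)"
        unfolding D_def using c_meas by (subst emeasure_density) (auto intro!: nn_integral_cong)
      finally show "emeasure m (space m) \<noteq> \<infinity>" using c_fin by simp
    qed
    fix h :: "'n phase \<Rightarrow> complex" assume h: "h \<in> borel_measurable borel"
    have "(LINT w|m. h w) = (LINT w|D. h w)" unfolding m_def by (rule integral_distr[OF idm h])
    also have "\<dots> = (LINT w|\<mu>. ?c w *\<^sub>R h w)"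
      unfolding D_def by (rule integral_density[OF h_mu[OF h] c_meas]) (simp add: c_nonneg)
    finally show "(LINT w|m. h w) = (LINT w|\<mu>. complex_of_real (?c w) * h w)"
      by (simp add: scaleR_conv_of_real)
    assume "integrable m h"
    then have "integrable D h" unfolding m_def using integrable_distr_eq[OF idm h] by simp
    then have "integrable \<mu> (\<lambda>w. ?c w *\<^sub>R h w)"
      unfolding D_def by (subst (asm) integrable_density[OF h_mu[OF h] c_meas]) (simp_all add: c_nonneg)
    then show "integrable \<mu> (\<lambda>w. complex_of_real (?c w) * h w)" by (simp add: scaleR_conv_of_real)
  qed
qed

section \<open>Decay of the potential, sign of Im E1, null sets\<close>

lemma multi_partial_0: "multi_partial (\<lambda>_. 0) f = f"
proof -
  have "foldr (\<lambda>i. partial i ^^ 0) xs f = f" for xs by (induction xs) auto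
  then show ?thesis unfolding multi_partial_def by blast
qed

text \<open>Whichever enumeration of the coordinates is chosen, \<open>i\<close> occurs in it
  exactly once.\<close>

lemma multi_partial_single:
  fixes f :: "real^'n::finite \<Rightarrow> 'b::real_normed_vector"
  shows "multi_partial (\<lambda>k. if k = i then 1 else 0) f = partial i f"
proof -
  have 1: "foldr (\<lambda>k. partial k ^^ (if k = i then 1 else 0)) xs f = (if i \<in> set xs then partial i f else f)"
    if "distinct xs" for xs
    using that by (induction xs) auto
  have "\<exists>xs. distinct xs \<and> set xs = (UNIV :: 'n set)"
    using finite_distinct_list[of "UNIV :: 'n set"] by auto
  then have 2: "distinct (SOME xs. distinct xs \<and> set xs = (UNIV :: 'n set))"
    "set (SOME xs. distinct xs \<and> set xs = (UNIV :: 'n set)) = UNIV"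
    by (metis (mono_tags, lifting) someI_ex)+
  show ?thesis unfolding multi_partial_def using 1[OF 2(1)] 2(2) by simp
qed

lemma japanese_bracket_ge: "japanese_bracket x \<ge> 1" "japanese_bracket x \<ge> norm x"
  by (auto simp: japanese_bracket_def real_le_rsqrt)

text \<open>Each first derivative decays one power of the bracket faster than \<open>V\<close>; the
  factor \<open>x $ i\<close>, bounded by the bracket, uses up that power.\<close>

lemma symbol_decay_bounds:
  fixes V :: "real^'n::finite \<Rightarrow> real"
  assumes "symbol_decay \<rho> V" "\<rho> > 0"
  obtains C where "C \<ge> 0"
    "\<And>x. \<bar>V x\<bar> \<le> C * japanese_bracket x powr (- \<rho>)"
    "\<And>x. \<bar>x \<bullet> gradient V x\<bar> \<le> C * japanese_bracket x powr (- \<rho>)"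
proof -
  obtain C1 where C1: "\<And>x. \<bar>V x\<bar> \<le> C1 * japanese_bracket x powr (- \<rho>)"
    using assms(1)[unfolded symbol_decay_def, rule_format, of "\<lambda>_. 0"] by (auto simp: multi_partial_0)
  have "\<exists>C. \<forall>x. \<bar>partial i V x\<bar> \<le> C * japanese_bracket x powr (- \<rho> - 1)" for i
  proof -
    have "(\<Sum>k\<in>UNIV. if k = i then 1 else 0 :: nat) = 1" by simp
    then show ?thesis
      using assms(1)[unfolded symbol_decay_def, rule_format, of "\<lambda>k. if k = i then 1 else 0"]
      by (simp only: multi_partial_single of_nat_1)
  qed
  then obtain c where c: "\<And>i x. \<bar>partial i V x\<bar> \<le> c i * japanese_bracket x powr (- \<rho> - 1)" by metis
  define C where "C = max \<bar>C1\<bar> (\<Sum>i\<in>UNIV. \<bar>c i\<bar>)"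
  show thesis
  proof (rule that[of C])
    show "C \<ge> 0" by (simp add: C_def)
    fix x :: "real^'n"
    let ?j = "japanese_bracket x"
    have "C1 * ?j powr (- \<rho>) \<le> C * ?j powr (- \<rho>)" by (intro mult_right_mono) (auto simp: C_def)
    then show "\<bar>V x\<bar> \<le> C * ?j powr (- \<rho>)" using C1[of x] by simp
    have "\<bar>x \<bullet> gradient V x\<bar> \<le> (\<Sum>i\<in>UNIV. \<bar>x $ i * partial i V x\<bar>)"
      unfolding inner_vec_def gradient_def by (simp add: sum_abs)
    also have "\<dots> \<le> (\<Sum>i\<in>UNIV. ?j * (\<bar>c i\<bar> * ?j powr (- \<rho> - 1)))"
    proof (rule sum_mono)
      fix i
      have 1: "\<bar>x $ i\<bar> \<le> ?j" using component_le_norm_cart[of x i] japanese_bracket_ge(2)[of x] by linarith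
      have "c i * ?j powr (- \<rho> - 1) \<le> \<bar>c i\<bar> * ?j powr (- \<rho> - 1)" by (intro mult_right_mono) auto
      then have "\<bar>partial i V x\<bar> \<le> \<bar>c i\<bar> * ?j powr (- \<rho> - 1)" using c[of i x] by linarith
      then show "\<bar>x $ i * partial i V x\<bar> \<le> ?j * (\<bar>c i\<bar> * ?j powr (- \<rho> - 1))"
        unfolding abs_mult using 1 japanese_bracket_ge(1)[of x] by (intro mult_mono) auto
    qed
    also have "\<dots> = (\<Sum>i\<in>UNIV. \<bar>c i\<bar>) * (?j powr 1 * ?j powr (- \<rho> - 1))"
      using japanese_bracket_ge(1)[of x] by (simp add: sum_distrib_right sum_distrib_left algebra_simps)
    also have "?j powr 1 * ?j powr (- \<rho> - 1) = ?j powr (- \<rho>)" by (simp only: powr_add[symmetric]) simp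
    also have "(\<Sum>i\<in>UNIV. \<bar>c i\<bar>) * ?j powr (- \<rho>) \<le> C * ?j powr (- \<rho>)"
      by (intro mult_right_mono) (auto simp: C_def)
    finally show "\<bar>x \<bullet> gradient V x\<bar> \<le> C * ?j powr (- \<rho>)" .
  qed
qed

lemma bracket_powr_small:
  assumes "\<rho> > 0" "\<epsilon> > 0"
  shows "\<exists>R. \<forall>x :: 'a::real_normed_vector. norm x \<ge> R \<longrightarrow> C * japanese_bracket x powr (- \<rho>) \<le> \<epsilon>"
proof -
  have "((\<lambda>r. C * r powr (- \<rho>)) \<longlongrightarrow> C * 0) at_top"
    using assms(1) by (intro tendsto_mult tendsto_const tendsto_neg_powr filterlim_ident) auto
  then have "\<forall>\<^sub>F r in at_top. C * r powr (- \<rho>) < \<epsilon>" using assms(2) by (simp add: order_tendstoD(2))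
  then obtain R where "\<And>r. r \<ge> R \<Longrightarrow> C * r powr (- \<rho>) < \<epsilon>" by (auto simp: eventually_at_top_linorder)
  then show ?thesis using japanese_bracket_ge(2) by (intro exI[of _ R] allI impI less_imp_le) (blast intro: order_trans)
qed

text \<open>\<open>E0\<close> is real, so Im E_h = h Im E_1 + o(h), and a negative Im E_1 would make
  this negative for small h.\<close>

lemma Im_nonneg_of_expansion:
  fixes E :: "real \<Rightarrow> complex"
  assumes "\<And>h. 0 < h \<Longrightarrow> h \<le> 1 \<Longrightarrow> Im (E h) \<ge> 0"
    "(\<lambda>h. E h - (of_real E0 + of_real h * E1)) \<in> o[at_right 0](\<lambda>h. of_real h)"
  shows "Im E1 \<ge> 0"
proof (rule ccontr)
  assume neg: "\<not> Im E1 \<ge> 0"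
  \<comment> \<open>Half of |Im E1|: an error of at most \<delta> h still leaves Im (E h) \<le> -
    \<delta> h.\<close>
  define \<delta> where "\<delta> = - Im E1 / 2"
  have \<delta>: "\<delta> > 0" using neg by (simp add: \<delta>_def)
  have "\<forall>\<^sub>F h in at_right 0. norm (E h - (of_real E0 + of_real h * E1)) \<le> \<delta> * norm (complex_of_real h)"
    by (rule landau_o.smallD[OF assms(2) \<delta>])
  moreover have "\<forall>\<^sub>F h in at_right 0. h \<in> {0<..<(1::real)}"
    by (rule eventually_at_right_real) simp
  ultimately have "\<forall>\<^sub>F h in at_right (0::real). False"
  proof eventually_elim
    case (elim h)
    have "\<bar>Im (E h - (of_real E0 + of_real h * E1))\<bar> \<le> \<delta> * h"
      using abs_Im_le_cmod[of "E h - (of_real E0 + of_real h * E1)"] elim by simp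
    then have "Im (E h) \<le> h * Im E1 + \<delta> * h" by simp
    also have "\<dots> = - \<delta> * h" by (simp add: \<delta>_def)
    also have "\<dots> < 0" using \<delta> elim by simp
    finally show False using assms(1)[of h] elim by simp
  qed
  then show False by (simp add: trivial_limit_at_right_real)
qed

text \<open>Bumps are nonnegative, so a bump with zero integral vanishes almost everywhere and the
  ball on which it is positive is null.\<close>

lemma null_set_of_bump_integrals:
  fixes \<nu> :: "'a::euclidean_space measure"
  assumes nu: "sets \<nu> = sets borel" "\<And>K. compact K \<Longrightarrow> emeasure \<nu> K < \<infinity>"
    and O': "open O'" "\<And>q. test_function q \<Longrightarrow> support_in UNIV q \<subseteq> O' \<Longrightarrow> (LINT w|\<nu>. q w) = 0"
  shows "O' \<in> null_sets \<nu>"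
proof (rule emeasure_open_null[OF nu(1)])
  fix w assume "w \<in> O'"
  then obtain r where r: "r > 0" "cball w r \<subseteq> O'" using O'(1) open_contains_cball by blast
  have b: "(LINT x|\<nu>. complex_of_real (1 * bump w r x)) = 0"
    by (rule O'(2)) (use test_function_bump[of r 1 w] r in auto)
  have int: "integrable \<nu> (bump w r)"
  proof (rule continuous_vanishing_integrable[OF nu continuous_on_bump])
    fix x :: 'a assume "norm x > norm w + r"
    then show "bump w r x = 0"
      using r(1) norm_triangle_ineq2[of x w] by (intro bump_eq_0) (auto simp: dist_norm norm_minus_commute)
  qed
  have "(LINT x|\<nu>. bump w r x) = 0" using b by simp
  then have "AE x in \<nu>. bump w r x = 0"
    using integral_nonneg_eq_0_iff_AE[OF int] by (simp add: bump_nonneg)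
  then have "AE x in \<nu>. x \<notin> ball w r"
    by eventually_elim (use bump_pos_iff[of r w] r(1) in force)
  then have "emeasure \<nu> (ball w r) = 0"
    by (subst (asm) AE_iff_measurable[of "ball w r"]) (auto simp: nu sets_eq_imp_space_eq[OF nu(1)])
  then show "\<exists>U. open U \<and> w \<in> U \<and> U \<subseteq> O' \<and> emeasure \<nu> U = 0"
    using r by (intro exI[of _ "ball w r"]) auto
qed

text \<open>Integrability is part of the conclusion because the Bochner integral of a non-integrable
  function is 0 by convention, so the identity alone would not express convergence.\<close>

theorem proposition5p4:
  fixes V1 V2 :: "real^'n::finite \<Rightarrow> real"
    and \<rho> E0 :: real
    and E :: "real \<Rightarrow> complex" and E1 :: complex
    and \<phi> :: "real \<Rightarrow> 'n phase \<Rightarrow> 'n phase"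
    and \<Gamma> \<Gamma>1 \<Gamma>2 :: "(real^'n) set" and d :: nat
    and A S :: "real^'n \<Rightarrow> complex"
    and \<sigma>' \<nu> :: "'n phase measure"
  assumes V_smooth: "smooth_on UNIV V1" "smooth_on UNIV V2"
    and V2_nonneg: "\<And>x. V2 x \<ge> 0"
    and decay: "\<rho> > 0" "symbol_decay \<rho> V1" "symbol_decay \<rho> V2"
    and flow: "hamilton_flow V1 \<phi>"
    and energy: "\<And>h. 0 < h \<Longrightarrow> h \<le> 1 \<Longrightarrow> Im (E h) \<ge> 0"
      "(\<lambda>h. E h - (of_real E0 + of_real h * E1)) \<in> o[at_right 0](\<lambda>h. of_real h)"
    and E0_pos: "E0 > 0"
    and damping: "\<And>w. hamiltonian V1 w = E0 \<Longrightarrow>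
      \<not> bounded (range (\<lambda>t. \<phi> t w)) \<or> (\<exists>t. fst (\<phi> t w) \<in> {x. V2 x > 0})"
    and Gamma2: "bounded \<Gamma>2" "d < CARD('n)" "submanifold d \<Gamma>2"
    and A: "smooth_on_submanifold \<Gamma>2 A" "compact (support_in \<Gamma>2 A)"
    and S: "schwartz S"
    and Gammas: "openin (top_of_set \<Gamma>2) \<Gamma>" "openin (top_of_set \<Gamma>2) \<Gamma>1"
      "support_in \<Gamma>2 A \<subseteq> \<Gamma>" "closure \<Gamma> \<subseteq> \<Gamma>1" "closure \<Gamma>1 \<subseteq> \<Gamma>2"
    and V1_Gamma: "\<And>z. z \<in> closure \<Gamma> \<Longrightarrow> V1 z < E0"
    and measure_shell:
      "riemannian_measure (CARD('n) - 1) (normal_shell V1 E0 \<Gamma>) (shell_metric \<Gamma>) \<sigma>'"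
    and no_return: "{w \<in> normal_shell V1 E0 \<Gamma>. \<exists>t>0. \<phi> t w \<in> normal_shell V1 E0 \<Gamma>} \<in> null_sets \<sigma>'"
    and radon: "radon_measure \<nu>"
    and i: "measure_support \<nu> \<subseteq> {w. hamiltonian V1 w = E0}"
    and ii: "\<And>\<sigma>. 0 < \<sigma> \<Longrightarrow> \<sigma> < 1 \<Longrightarrow> \<exists>R\<ge>0. \<forall>q. test_function q \<longrightarrow>
      support_in UNIV q \<subseteq> incoming_region R (- \<sigma>) \<longrightarrow> (LINT w|\<nu>. q w) = 0"
    and iii: "\<And>q. test_function q \<Longrightarrow>
      (LINT w|\<nu>. - hamilton_field V1 q w + of_real (2 * Im E1 + 2 * V2 (fst w)) * q w) =
      (LINT w|\<sigma>'. of_real (source_density d A S w) * q w)"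
    and q: "test_function q"
  defines "F \<equiv> \<lambda>t w. of_real (source_density d A S w) * q (\<phi> t w) *
      of_real (exp (- 2 * t * Im E1 - 2 * (LINT s:{0..t}|lborel. V2 (fst (\<phi> s w)))))"
  shows "(\<forall>t\<ge>0. integrable \<sigma>' (F t)) \<and>
    set_integrable lborel {0..} (\<lambda>t. LINT w|\<sigma>'. F t w) \<and>
    (LINT w|\<nu>. q w) = (LINT t:{0..}|lborel. LINT w|\<sigma>'. F t w)"
proof -
  define W where "W w = 2 * Im E1 + 2 * V2 (fst w)" for w :: "'n phase"
  have ImE1: "Im E1 \<ge> 0" by (rule Im_nonneg_of_expansion[OF energy])
  obtain C where C: "C \<ge> 0" "\<And>x. \<bar>V1 x\<bar> \<le> C * japanese_bracket x powr (- \<rho>)"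
    "\<And>x. \<bar>x \<bullet> gradient V1 x\<bar> \<le> C * japanese_bracket x powr (- \<rho>)"
    using symbol_decay_bounds[OF decay(2,1)] by metis
  interpret scattering_dynamics V1 \<phi> C W E0
  proof
    show "smooth_on UNIV V1" "hamilton_flow V1 \<phi>" "E0 > 0" by fact+
    show "\<bar>V1 x\<bar> \<le> C" for x
    proof -
      have "japanese_bracket x powr (- \<rho>) \<le> 1"
        using powr_mono[of "- \<rho>" 0 "japanese_bracket x"] japanese_bracket_ge(1)[of x] decay(1) by simp
      then show ?thesis using C(2)[of x] mult_left_mono[OF _ C(1), of _ 1] by fastforce
    qed
    have "smooth_on UNIV (\<lambda>w :: 'n phase. 2 * Im E1 + 2 * V2 (fst w))"
      by (intro smooth_on_add smooth_on_const smooth_on_linear_comp[OF _ bounded_linear_mult_right] smooth_on_comp_fst[OF _ V_smooth(2)] open_UNIV subset_UNIV)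
    then show "smooth_on UNIV W" by (simp add: W_def[abs_def])
    show "W w \<ge> 0" for w using ImE1 V2_nonneg by (simp add: W_def)
    show "\<exists>R. \<forall>x. norm x \<ge> R \<longrightarrow> \<bar>V1 x\<bar> \<le> \<epsilon> \<and> \<bar>x \<bullet> gradient V1 x\<bar> \<le> \<epsilon>" if "\<epsilon> > 0" for \<epsilon>
      using bracket_powr_small[OF decay(1) that, of C] C(2,3) order_trans by meson
    show "\<not> bounded (range (\<lambda>t. \<phi> t w)) \<or> (\<exists>t. W (\<phi> t w) > 0)" if "hamiltonian V1 w = E0" for w
    proof -
      have "W (\<phi> t w) > 0" if "V2 (fst (\<phi> t w)) > 0" for t
        using that ImE1 by (simp add: W_def)
      then show ?thesis using damping[OF that] by blast
    qed
  qed
  have V_cont: "continuous_on UNIV V1" by (rule smooth_on_continuous[OF V_smooth(1)])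
  have nu: "sets \<nu> = sets borel" "\<And>K. compact K \<Longrightarrow> emeasure \<nu> K < \<infinity>"
    using radon by (auto simp: radon_measure_def)
  have energy_AE: "AE w in \<nu>. hamiltonian V1 w = E0"
  proof -
    have "continuous_on UNIV (\<lambda>w :: 'n phase. V1 (fst w))"
      by (rule continuous_on_compose2[OF V_cont]) (auto intro: continuous_intros)
    then have "continuous_on UNIV (hamiltonian V1)"
      unfolding hamiltonian_def case_prod_unfold by (intro continuous_intros)
    then have op: "open {w. hamiltonian V1 w \<noteq> E0}" by (intro open_Collect_neq continuous_on_const)
    \<comment> \<open>Every point outside the support has a null neighbourhood; a countable subcover
      makes the whole open set null.\<close>
    have "{w. hamiltonian V1 w \<noteq> E0} \<in> null_sets \<nu>"
    proof (rule emeasure_open_null[OF nu(1)])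
      fix w assume w: "w \<in> {w. hamiltonian V1 w \<noteq> E0}"
      then have "w \<notin> measure_support \<nu>" using i by blast
      then obtain U where U: "open U" "w \<in> U" "emeasure \<nu> U = 0"
        by (auto simp: measure_support_def not_gr_zero)
      have "emeasure \<nu> (U \<inter> {w. hamiltonian V1 w \<noteq> E0}) \<le> emeasure \<nu> U"
        using U(1) by (intro emeasure_mono) (auto simp: nu(1))
      then show "\<exists>U. open U \<and> w \<in> U \<and> U \<subseteq> {w. hamiltonian V1 w \<noteq> E0} \<and> emeasure \<nu> U = 0"
        using U op w by (intro exI[of _ "U \<inter> {w. hamiltonian V1 w \<noteq> E0}"]) auto
    qed
    from AE_not_in[OF this] show ?thesis by simp
  qed
  \<comment> \<open>The aperture 1/3 is the one for which \<open>escape\<close> is proved.\<close>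
  obtain R where R: "\<And>q. test_function q \<Longrightarrow> support_in UNIV q \<subseteq> incoming_region R (- (1 / 3)) \<Longrightarrow> (LINT w|\<nu>. q w) = 0"
    using ii[of "1 / 3"] by auto
  have incoming_AE: "AE w in \<nu>. \<not> (norm (fst w) > R \<and> fst w \<bullet> snd w < - (1 / 3) * norm (fst w) * norm (snd w))"
  proof -
    \<comment> \<open>The strict inequality in the radius makes the set open; it still lies in the
      incoming region, whose radius condition is not strict.\<close>
    have "{w :: 'n phase. norm (fst w) > R \<and> fst w \<bullet> snd w < - (1 / 3) * norm (fst w) * norm (snd w)} \<in> null_sets \<nu>"
    proof (rule null_set_of_bump_integrals[OF nu])
      show "open {w :: 'n phase. norm (fst w) > R \<and> fst w \<bullet> snd w < - (1 / 3) * norm (fst w) * norm (snd w)}"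
        by (intro open_Collect_conj open_Collect_less continuous_intros)
      fix q :: "'n phase \<Rightarrow> complex" assume q: "test_function q"
        and sub: "support_in UNIV q \<subseteq> {w. norm (fst w) > R \<and> fst w \<bullet> snd w < - (1 / 3) * norm (fst w) * norm (snd w)}"
      show "(LINT w|\<nu>. q w) = 0"
        by (rule R[OF q], rule order_trans[OF sub]) (auto simp: incoming_region_def)
    qed
    from AE_not_in[OF this] show ?thesis by simp
  qed
  have S_cont: "continuous_on UNIV S" using S by (simp add: schwartz_def smooth_on_continuous)
  have V_less: "V1 z < E0" if "z \<in> \<Gamma>" for z using V1_Gamma that closure_subset by blast
  obtain m where m: "sets m = sets borel" "finite_measure m"
    "\<And>h. h \<in> borel_measurable borel \<Longrightarrow>
      (LINT w|m. h w) = (LINT w|\<sigma>'. complex_of_real (source_density d A S w) * h w)"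
    "\<And>h. h \<in> borel_measurable borel \<Longrightarrow> integrable m h \<Longrightarrow>
      integrable \<sigma>' (\<lambda>w. complex_of_real (source_density d A S w) * h w)"
    by (rule source_measure[OF V_smooth(1) Gamma2(3) Gammas(1) A Gammas(3) S_cont V_less measure_shell]) blast+
  interpret m: finite_measure m by (rule m(2))
  have weak: "(LINT w|\<nu>. - hamilton_field V1 q w + of_real (W w) * q w) = (LINT w|m. q w)"
    if "test_function q" for q
  proof -
    have "q \<in> borel_measurable borel"
      using that by (auto simp: test_function_def intro!: borel_measurable_continuous_onI smooth_on_continuous)
    then show ?thesis using iii[OF that] m(3)[of q] by (simp add: W_def)
  qed
  note sol = transport_solution[OF nu energy_AE incoming_AE m(1,2) weak q]
  \<comment> \<open>The time integral in the statement is a Lebesgue integral and the action is a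
    gauge integral; they agree because the integrand is continuous on a compact interval.\<close>
  have F_eq: "F t w = of_real (source_density d A S w) * evolve q t w" if t: "t \<ge> 0" for t w
  proof -
    have c: "continuous_on {0..t} (\<lambda>s. V2 (fst (\<phi> s w)))"
      by (intro continuous_on_compose2[OF smooth_on_continuous[OF V_smooth(2)]] continuous_intros flow_time_continuous) auto
    have "set_integrable lborel {0..t} (\<lambda>s. V2 (fst (\<phi> s w)))"
      unfolding set_integrable_def by (rule borel_integrable_compact[OF compact_Icc c])
    then have e: "(LINT s:{0..t}|lborel. V2 (fst (\<phi> s w))) = integral {0..t} (\<lambda>s. V2 (fst (\<phi> s w)))"
      by (rule set_borel_integral_eq_integral(2))
    have "action t w = integral {0..t} (\<lambda>s. 2 * Im E1 + 2 * V2 (fst (\<phi> s w)))"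
      using action_eq[OF t, of w] by (simp add: W_def)
    also have "\<dots> = integral {0..t} (\<lambda>s. 2 * Im E1) + integral {0..t} (\<lambda>s. 2 * V2 (fst (\<phi> s w)))"
      by (intro Henstock_Kurzweil_Integration.integral_add integrable_continuous_real continuous_intros c)
    also have "\<dots> = 2 * t * Im E1 + 2 * (LINT s:{0..t}|lborel. V2 (fst (\<phi> s w)))"
      using t by (simp add: e)
    finally have "- 2 * t * Im E1 - 2 * (LINT s:{0..t}|lborel. V2 (fst (\<phi> s w))) = - action t w" by simp
    then show ?thesis unfolding F_def evolve_def by (simp add: mult.assoc)
  qed
  have ev_meas: "evolve q t \<in> borel_measurable borel" if "t \<ge> 0" for t
    by (rule borel_measurable_continuous_onI[OF evolve_continuous[OF q that]])
  have F_int: "integrable \<sigma>' (F t)" if t: "t \<ge> 0" for t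
  proof -
    obtain r where r: "\<And>w. norm w > r \<Longrightarrow> q w = 0" using test_functionD[OF q] by metis
    have qc: "continuous_on UNIV q" using q by (simp add: test_function_def smooth_on_continuous)
    obtain B where B: "\<And>x. norm (q x) \<le> B" using continuous_vanishing_bounded[OF qc r] by blast
    have "integrable m (evolve q t)"
      by (rule m.integrable_const_bound[of _ B])
        (use norm_evolve_le[OF t B] ev_meas[OF t] in \<open>auto simp: measurable_cong_sets[OF m(1) refl]\<close>)
    from m(4)[OF ev_meas[OF t] this] show ?thesis by (simp only: F_eq[OF t, abs_def, symmetric])
  qed
  have F_LINT: "(LINT w|\<sigma>'. F t w) = (LINT w|m. evolve q t w)" if t: "t \<ge> 0" for t
    unfolding m(3)[OF ev_meas[OF t]] F_eq[OF t] ..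
  have "set_integrable lborel {0..} (\<lambda>t. LINT w|\<sigma>'. F t w)"
    using sol(1) by (subst set_integrable_cong[OF refl refl F_LINT]) auto
  moreover have "(LINT t:{0..}|lborel. LINT w|\<sigma>'. F t w) = (LINT t:{0..}|lborel. LINT w|m. evolve q t w)"
    by (rule set_lebesgue_integral_cong) (auto simp: F_LINT)
  ultimately show ?thesis using F_int sol(2) by simp
qed

end
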